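(* Let $D \subset \mathbb{R}^m$, $m \geq 2$, be a bounded domain, let $\lambda > 0$, and let a real-valued $u \in C^1(D) \cap C^0(\overline{D})$ be such that, for all sufficiently small $r > 0$, $F(u,\cdot,r)$ and $M^\circ(u,\cdot,r)$ are $C^2$-functions on the corresponding subdomain $\{x \in D : \overline{B_r(x)} \subset D\}$. If the equality $$m \, F(u,x,r) = - \lambda^2 r \, M^\bullet(u,x,r)$$ holds for all $x \in D$ and all $r \in (0, r(x)]$, where $r(x) > 0$ is such that $B_{r(x)}(x)$ is admissible, then $u$ is metaharmonic in $D$, that is, $u$ satisfies $\nabla^2 u + \lambda^2 u = 0$ in $D$.
   Context: A domain is an open connected subset of $\mathbb{R}^m$. $B_r(x) = \{ y : |y-x| < r\}$; the ball is called admissible if $\overline{B_r(x)} \subset D$. The mean value over spheres, the mean value over balls and the mean flux are $$M^\circ(u,x,r) = \frac{1}{|\partial B_r|} \int_{\partial B_r(x)} u(y) \, dS_y, \quad M^\bullet(u,x,r) = \frac{1}{|B_r|} \int_{B_r(x)} u(y) \, dy, \quad F(u,x,r) = \frac{1}{|\partial B_r|} \int_{\partial B_r(x)} \frac{\partial u}{\partial n_y} \, dS_y,$$ where $|\partial B_r|$ is the area of the sphere of radius $r$, $|B_r|$ the volume of the ball of radius $r$ in $\mathbb{R}^m$, and $n$ the exterior unit normal. *)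

theory Defs
  imports "HOL-Analysis.Analysis"
begin

definition partial_deriv :: "'a::euclidean_space \<Rightarrow> ('a \<Rightarrow> real) \<Rightarrow> 'a \<Rightarrow> real" where
  "partial_deriv b f x = frechet_derivative f (at x) b"

text \<open>The following two predicates are meant for open \<open>S\<close>.\<close>

definition C1_on :: "('a::euclidean_space \<Rightarrow> real) \<Rightarrow> 'a set \<Rightarrow> bool" where
  "C1_on f S \<longleftrightarrow>
     (\<forall>x\<in>S. f differentiable (at x)) \<and> (\<forall>b\<in>Basis. continuous_on S (partial_deriv b f))"

definition C2_on :: "('a::euclidean_space \<Rightarrow> real) \<Rightarrow> 'a set \<Rightarrow> bool" where
  "C2_on f S \<longleftrightarrow> C1_on f S \<and> (\<forall>b\<in>Basis. C1_on (partial_deriv b f) S)"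

definition laplacian :: "('a::euclidean_space \<Rightarrow> real) \<Rightarrow> 'a \<Rightarrow> real" where
  "laplacian f x = (\<Sum>b\<in>Basis. partial_deriv b (partial_deriv b f) x)"

text \<open>The \<open>C2_on\<close> conjunct is essential: \<^const>\<open>frechet_derivative\<close> is an arbitrary value
  where the derivative does not exist.\<close>

definition metaharmonic_on :: "real \<Rightarrow> ('a::euclidean_space \<Rightarrow> real) \<Rightarrow> 'a set \<Rightarrow> bool" where
  "metaharmonic_on lam u D \<longleftrightarrow> C2_on u D \<and> (\<forall>x\<in>D. laplacian u x + lam\<^sup>2 * u x = 0)"

text \<open>For \<open>r > 0\<close>, the surface measure of a Borel set \<open>A\<close> of points of the sphere of radius \<open>r\<close>
  about \<open>x\<close> is \<open>m / r\<close> times the volume of the cone with base \<open>A\<close> and apex \<open>x\<close>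
  (a cone over a surface element \<open>dS\<close> has volume \<open>r dS / m\<close>), where \<open>m\<close> is the dimension. That is,
  Lebesgue measure on the ball is pushed forward along radial projection and rescaled; the centre,
  a null set, is left out as it has no projection. The measure lives on the Borel sets of the whole
  space, so integrals are to be taken over \<^term>\<open>sphere x r\<close>.\<close>

definition sphere_measure :: "'a::euclidean_space \<Rightarrow> real \<Rightarrow> 'a measure" where
  "sphere_measure x r =
     scale_measure (ennreal (real DIM('a) / r))
       (distr (restrict_space lborel (ball x r - {x})) borel (\<lambda>y. x + r *\<^sub>R sgn (y - x)))"

lemma measurable_radial_projection:
  "(\<lambda>y::'a::euclidean_space. x + r *\<^sub>R sgn (y - x)) \<in> borel_measurable borel"
  unfolding sgn_div_norm by measurable

lemma sets_sphere_measure [simp, measurable_cong]: "sets (sphere_measure x r) = sets borel"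
  by (simp add: sphere_measure_def)

lemma space_sphere_measure [simp]: "space (sphere_measure x r) = UNIV"
  using sets_eq_imp_space_eq[OF sets_sphere_measure[of x r]] by simp

lemma emeasure_sphere_measure:
  fixes x :: "'a::euclidean_space"
  assumes "A \<in> sets borel"
  shows "emeasure (sphere_measure x r) A =
    ennreal (real DIM('a) / r) *
    emeasure lborel {y \<in> ball x r - {x}. x + r *\<^sub>R sgn (y - x) \<in> A}"
proof -
  have m: "(\<lambda>y::'a. x + r *\<^sub>R sgn (y - x)) \<in> measurable (restrict_space lborel (ball x r - {x})) borel"
    by (rule measurable_restrict_space1) (use measurable_radial_projection in simp)
  have eq: "(\<lambda>y. x + r *\<^sub>R sgn (y - x)) -` A \<inter> (ball x r - {x}) =
    {y \<in> ball x r - {x}. x + r *\<^sub>R sgn (y - x) \<in> A}" by auto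
  have "emeasure (sphere_measure x r) A = ennreal (real DIM('a) / r) *
      emeasure (restrict_space lborel (ball x r - {x}))
        ((\<lambda>y. x + r *\<^sub>R sgn (y - x)) -` A \<inter> (ball x r - {x}))"
    using assms by (simp add: sphere_measure_def emeasure_distr[OF m] space_restrict_space)
  also have "emeasure (restrict_space lborel (ball x r - {x}))
        ((\<lambda>y. x + r *\<^sub>R sgn (y - x)) -` A \<inter> (ball x r - {x})) =
      emeasure lborel ((\<lambda>y. x + r *\<^sub>R sgn (y - x)) -` A \<inter> (ball x r - {x}))"
    by (rule emeasure_restrict_space) auto
  finally show ?thesis
    by (simp only: eq)
qed

lemma measure_sphere_measure_sphere:
  fixes x :: "'a::euclidean_space"
  assumes r: "r > 0"
  shows "measure (sphere_measure x r) (sphere x r) =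
    real DIM('a) * unit_ball_vol (real DIM('a)) * r ^ (DIM('a) - 1)"
proof -
  have "{y \<in> ball x r - {x}. x + r *\<^sub>R sgn (y - x) \<in> sphere x r} = ball x r - {x}"
    using r by (auto simp: dist_norm norm_sgn)
  moreover have "emeasure lborel (ball x r - {x}) = emeasure lborel (ball x r)"
    by (rule emeasure_Diff_null_set) (auto intro: finite_imp_null_set_lborel)
  ultimately have "emeasure (sphere_measure x r) (sphere x r) =
      ennreal (real DIM('a) / r) * ennreal (unit_ball_vol (real DIM('a)) * r ^ DIM('a))"
    using r by (simp add: emeasure_sphere_measure emeasure_ball)
  also have "\<dots> = ennreal (real DIM('a) / r * (unit_ball_vol (real DIM('a)) * r ^ DIM('a)))"
    using r by (intro ennreal_mult [symmetric]) auto
  finally have "measure (sphere_measure x r) (sphere x r) =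
      real DIM('a) / r * (unit_ball_vol (real DIM('a)) * r ^ DIM('a))"
    using r by (simp add: measure_def)
  also have "r ^ DIM('a) = r * r ^ (DIM('a) - 1)"
    by (metis DIM_positive power_minus_mult mult.commute)
  finally show ?thesis using r by simp
qed

definition sphere_mean :: "('a::euclidean_space \<Rightarrow> real) \<Rightarrow> 'a \<Rightarrow> real \<Rightarrow> real" where
  "sphere_mean u x r =
     1 / measure (sphere_measure x r) (sphere x r) *
     (LINT y:sphere x r|sphere_measure x r. u y)"

definition ball_mean :: "('a::euclidean_space \<Rightarrow> real) \<Rightarrow> 'a \<Rightarrow> real \<Rightarrow> real" where
  "ball_mean u x r =
     1 / measure lborel (ball x r) * (LINT y:ball x r|lborel. u y)"

text \<open>The exterior unit normal at a point \<open>y\<close> of the sphere is \<open>(y - x) / r\<close>.\<close>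

definition mean_flux :: "('a::euclidean_space \<Rightarrow> real) \<Rightarrow> 'a \<Rightarrow> real \<Rightarrow> real" where
  "mean_flux u x r =
     1 / measure (sphere_measure x r) (sphere x r) *
     (LINT y:sphere x r|sphere_measure x r. frechet_derivative u (at y) ((y - x) /\<^sub>R r))"

end

theory Submission
  imports Defs
begin

text \<open>Write \<open>V\<close> for the volume of the unit ball. For a \<open>C\<^sup>2\<close> function the defect
  \<open>(\<integral>\<^bsub>|z|<1\<^esub> u (x + r z) dz - V u x) / r\<^sup>2\<close> tends to a constant multiple of the Laplacian as
  \<open>r \<rightarrow> 0\<close>. For \<open>u\<close> as in the theorem the flux is the derivative of the spherical mean, and
  integrating twice in \<open>r\<close> shows that the defect tends to the same multiple of \<open>- \<lambda>\<^sup>2 u x\<close>. The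
  admissible radii are not locally uniform in \<open>x\<close>, so this limit is known only pointwise.
  A maximum principle for the limit of the defect, in the manner of Blaschke and Privalov, removes
  this defect of uniformity: on a small ball let \<open>p\<close> be a polynomial close to \<open>u\<close>, and \<open>h\<close> the
  polynomial with \<open>\<Delta> h = - \<lambda>\<^sup>2 p\<close> and \<open>h = p\<close> on the boundary; then \<open>h\<close> is
  uniformly close to \<open>u\<close>.
  The means of \<open>h\<close> almost satisfy a linear integral equation in \<open>r\<close> whose solution is determined
  by its value at \<open>r = 0\<close>. In the limit the spherical mean of \<open>u\<close> over a fixed small
  radius is locally a constant multiple of \<open>u\<close>, nonzero unless \<open>u\<close> vanishes there. Thus \<open>u\<close> inherits the
  \<open>C\<^sup>2\<close> regularity of its spherical mean, and comparing the two limits of the defect gives the equation.\<close>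

section \<open>Means over balls and spheres\<close>

text \<open>The admissible radii may shrink arbitrarily fast from point to point, so the flux
  identity cannot be integrated over a set of centres with a common radius; only its limit at radius
  zero survives. A maximum principle can use such a limit because a contradiction at one maximum
  point suffices. It is applied to \<open>\<Delta>\<close> with \<open>- \<lambda>\<^sup>2 p\<close>
  as given data, not to \<open>\<Delta> + \<lambda>\<^sup>2\<close>, which obeys no maximum
  principle on large balls. Polynomials serve for comparison because the Dirichlet problem on a ball
  with polynomial data has a polynomial solution, found by induction on the degree. The means of a
  true solution are its central value times a Bessel function of the radius. That function never
  appears: the combination \<open>u y * u (x + z) - u x * u (y + z)\<close> vanishes at
  \<open>z = 0\<close>, hence so do its means over small balls about \<open>0\<close>, and the means
  of \<open>u\<close> at \<open>x\<close> and \<open>y\<close> are in the ratio of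
  \<open>u x\<close> to \<open>u y\<close>. A contraction for radii with
  \<open>\<lambda>\<^sup>2 R\<^sup>2 \<le> 1 / 2\<close> replaces the explicit formula.\<close>

definition uball :: "'a::euclidean_space measure" where
  "uball = restrict_space lborel (ball 0 1)"

text \<open>All centres and radii are pulled back to one finite measure, so that \<open>x\<close>
  and \<open>r\<close> enter only through the integrand. Nothing is divided by the volume: a
  constant integrates to \<open>uvol\<close> times itself.\<close>

definition ball_int :: "('a::euclidean_space \<Rightarrow> real) \<Rightarrow> 'a \<Rightarrow> real \<Rightarrow> real" where
  "ball_int f x r = (LINT z|uball. f (x + r *\<^sub>R z))"

text \<open>A function of \<open>sgn z\<close> is constant on rays, so its integral over the solid
  unit ball is \<open>1 / m\<close> of its integral over the unit sphere. Up to the factor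
  \<open>uvol\<close> this is the spherical mean, with no surface measure left. At
  \<open>z = 0\<close> the convention \<open>sgn 0 = 0\<close> gives the value \<open>f x\<close> at
  a null point.\<close>

definition sphere_int :: "('a::euclidean_space \<Rightarrow> real) \<Rightarrow> 'a \<Rightarrow> real \<Rightarrow> real" where
  "sphere_int f x r = (LINT z|uball. f (x + r *\<^sub>R sgn z))"

text \<open>The function \<open>(1 - |z|^2) / 2\<close> has gradient \<open>- z\<close>; this weight
  appears when the derivative in \<open>r\<close> of a ball integral, an integral of
  \<open>z . grad f\<close>, is integrated by parts.\<close>

definition weighted_int :: "('a::euclidean_space \<Rightarrow> real) \<Rightarrow> 'a \<Rightarrow> real \<Rightarrow> real" where
  "weighted_int f x r = (LINT z|uball. (1 - (norm z)\<^sup>2) * f (x + r *\<^sub>R z))"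

abbreviation uvol :: "'a::euclidean_space itself \<Rightarrow> real" where
  "uvol (_::'a itself) \<equiv> unit_ball_vol (real DIM('a))"

lemma space_uball [simp]: "space uball = ball 0 1"
  by (simp add: uball_def space_restrict_space)

lemma measure_uball [simp]: "measure (uball :: 'a::euclidean_space measure) (ball 0 1) = uvol TYPE('a)"
  by (simp add: uball_def measure_restrict_space content_ball)

lemma finite_measure_uball: "finite_measure (uball :: 'a::euclidean_space measure)"
  by (rule finite_measureI) (simp add: uball_def emeasure_restrict_space space_restrict_space emeasure_ball)

interpretation uball: finite_measure "uball :: 'a::euclidean_space measure"
  by (rule finite_measure_uball)

lemma uvol_pos: "uvol TYPE('a::euclidean_space) > 0"
  by (rule unit_ball_vol_pos) simp

lemma uvol_nonzero [simp]: "uvol TYPE('a::euclidean_space) \<noteq> 0"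
  using uvol_pos[where 'a='a] by (metis less_irrefl)

lemma integral_uball_eq: "(LINT z|uball. f z) = (LINT z:ball 0 1|lborel. f z)" for f :: "'a::euclidean_space \<Rightarrow> real"
  unfolding uball_def set_lebesgue_integral_def by (subst integral_restrict_space) auto

lemma measurable_uball_continuous:
  "continuous_on (ball 0 1) f \<Longrightarrow> f \<in> borel_measurable uball" for f :: "'a::euclidean_space \<Rightarrow> real"
  unfolding uball_def
  using borel_measurable_continuous_on_restrict[of "ball 0 1" f]
  by (subst measurable_cong_sets[of _ "restrict_space borel (ball 0 1)" _ borel])
     (auto simp: sets_restrict_space)

lemma measurable_uball_borel: "f \<in> borel_measurable borel \<Longrightarrow> f \<in> borel_measurable uball" 
  for f :: "'a::euclidean_space \<Rightarrow> 'b::topological_space"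
  unfolding uball_def by (rule measurable_restrict_space1) simp

lemma sgn_measurable: "(sgn :: 'a::euclidean_space \<Rightarrow> 'a) \<in> borel_measurable borel"
  unfolding sgn_div_norm by measurable

lemma norm_sgn_le: "norm (sgn z :: 'a::real_normed_vector) \<le> 1"
  by (simp add: norm_sgn)

lemma continuous_on_cball_bounded:
  assumes "continuous_on (cball x r) (f :: 'a::euclidean_space \<Rightarrow> real)"
  obtains K where "K > 0" "\<And>z. z \<in> cball x r \<Longrightarrow> \<bar>f z\<bar> \<le> K"
  using compact_imp_bounded[OF compact_continuous_image[OF assms compact_cball]]
  unfolding bounded_pos by auto

lemma integrable_uball_continuous:
  assumes "continuous_on (cball 0 1) (f :: 'a::euclidean_space \<Rightarrow> real)"
  shows "integrable uball f"
proof -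
  obtain K where K: "\<And>z. z \<in> cball 0 1 \<Longrightarrow> \<bar>f z\<bar> \<le> K"
    using continuous_on_cball_bounded[OF assms] by metis
  show ?thesis
    by (rule uball.integrable_const_bound[where B=K])
       (use K in \<open>auto intro!: AE_I2 measurable_uball_continuous continuous_on_subset[OF assms]\<close>)
qed

lemma integrable_uball_sgn:
  assumes "continuous_on (cball 0 1) (f :: 'a::euclidean_space \<Rightarrow> real)"
  shows "integrable uball (\<lambda>z. f (sgn z))"
proof -
  obtain K where K: "\<And>z. z \<in> cball 0 1 \<Longrightarrow> \<bar>f z\<bar> \<le> K"
    using continuous_on_cball_bounded[OF assms] by metis
  have "(\<lambda>z. f (sgn z)) \<in> borel_measurable uball"
  proof (rule measurable_compose[where f=sgn and g=f and N="restrict_space borel (cball 0 1)"])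
    show "(sgn :: 'a \<Rightarrow> 'a) \<in> measurable uball (restrict_space borel (cball 0 1))"
      by (intro measurable_restrict_space2 measurable_uball_borel sgn_measurable) (auto simp: norm_sgn_le)
    show "f \<in> borel_measurable (restrict_space borel (cball 0 1))"
      by (rule borel_measurable_continuous_on_restrict[OF assms])
  qed
  then show ?thesis
    by (intro uball.integrable_const_bound[where B=K]) (use K in \<open>auto intro!: AE_I2 simp: norm_sgn_le\<close>)
qed

lemma continuous_on_ball_arg:
  assumes "continuous_on (cball x r) (f :: 'a::euclidean_space \<Rightarrow> real)" "0 \<le> s" "s \<le> r"
  shows "continuous_on (cball 0 1) (\<lambda>z. f (x + s *\<^sub>R z))"
proof (rule continuous_on_compose2[OF assms(1)])
  show "(\<lambda>z. x + s *\<^sub>R z) ` cball 0 1 \<subseteq> cball x r"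
    using assms mult_mono[of s r _ 1] by (auto simp: dist_norm)
qed (auto intro!: continuous_intros)

lemma set_integral_ball_scale:
  fixes f :: "'a::euclidean_space \<Rightarrow> real"
  assumes r: "r > 0" and f: "set_borel_measurable borel (ball x r) f"
  shows "(LINT y:ball x r|lborel. f y) = r ^ DIM('a) * ball_int f x r"
proof -
  have m: "(\<lambda>y. indicator (ball x r) y *\<^sub>R f y) \<in> borel_measurable borel"
    using f by (simp add: set_borel_measurable_def)
  have "(LINT y:ball x r|lborel. f y) =
    integral\<^sup>L (density (distr lborel borel (\<lambda>y. x + r *\<^sub>R y)) (\<lambda>_. ennreal (\<bar>r\<bar>^DIM('a))))
      (\<lambda>y. indicator (ball x r) y *\<^sub>R f y)"
    unfolding set_lebesgue_integral_def using lborel_affine[of r x] r by simp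
  also have "\<dots> = r ^ DIM('a) * (LINT z|lborel. indicator (ball x r) (x + r *\<^sub>R z) *\<^sub>R f (x + r *\<^sub>R z))"
    using r by (subst integral_density; (subst integral_distr)?; use m in simp)
  also have "(LINT z|lborel. indicator (ball x r) (x + r *\<^sub>R z) *\<^sub>R f (x + r *\<^sub>R z)) = ball_int f x r"
    unfolding ball_int_def integral_uball_eq set_lebesgue_integral_def
    using r by (intro Bochner_Integration.integral_cong) (auto simp: indicator_def dist_norm)
  finally show ?thesis .
qed

lemma scale_measure_eq_density: "scale_measure c M = density M (\<lambda>_. c)"
  by (rule measure_eqI) (auto simp: emeasure_density_const)

text \<open>The surface measure is a rescaled image of volume, so the integral becomes one over the
  punctured ball. Scaling to the unit ball yields \<open>r ^ m\<close>, and the prefactor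
  \<open>m / r\<close> turns it into \<open>m * r ^ (m - 1)\<close>.\<close>

lemma set_integral_sphere_measure:
  fixes f :: "'a::euclidean_space \<Rightarrow> real"
  assumes r: "r > 0" and f: "continuous_on (sphere x r) f"
  shows "(LINT y:sphere x r|sphere_measure x r. f y) =
    real DIM('a) * r ^ (DIM('a) - 1) * sphere_int f x r"
proof -
  define g where "g y = indicator (sphere x r) y *\<^sub>R f y" for y
  let ?p = "\<lambda>y. x + r *\<^sub>R sgn (y - x)"
  have m: "g \<in> borel_measurable borel"
    using borel_measurable_continuous_on_indicator[OF _ f] unfolding g_def by auto
  have mp: "?p \<in> measurable (restrict_space lborel (ball x r - {x})) borel"
    by (rule measurable_restrict_space1) (use measurable_radial_projection in simp)
  have mgp: "(\<lambda>y. g (?p y)) \<in> borel_measurable borel"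
    by (rule measurable_compose[OF measurable_radial_projection m])
  have eq: "g (?p (x + r *\<^sub>R z)) = f (x + r *\<^sub>R sgn z)" if "z \<noteq> 0" for z
    using r that by (simp add: g_def indicator_def dist_norm sgn_scaleR norm_sgn)
  have "(LINT y:sphere x r|sphere_measure x r. f y) = (LINT y|sphere_measure x r. g y)"
    by (simp add: set_lebesgue_integral_def g_def)
  also have "\<dots> = real DIM('a) / r * (LINT y|restrict_space lborel (ball x r - {x}). g (?p y))"
    unfolding sphere_measure_def scale_measure_eq_density
    using r m by (simp add: integral_density integral_distr[OF mp])
  also have "(LINT y|restrict_space lborel (ball x r - {x}). g (?p y)) =
      (LINT y:ball x r - {x}|lborel. g (?p y))"
    unfolding set_lebesgue_integral_def by (rule integral_restrict_space) auto
  also have "\<dots> = (LINT y:ball x r|lborel. g (?p y))"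
    unfolding set_lebesgue_integral_def
  proof (rule integral_cong_AE)
    show "(\<lambda>y. indicator (ball x r - {x}) y *\<^sub>R g (?p y)) \<in> borel_measurable lborel"
      "(\<lambda>y. indicator (ball x r) y *\<^sub>R g (?p y)) \<in> borel_measurable lborel"
      using mgp by (auto intro!: borel_measurable_times borel_measurable_indicator)
    have "AE y in lborel. y \<noteq> x"
      by (rule AE_lborel_singleton)
    then show "AE y in lborel. indicator (ball x r - {x}) y *\<^sub>R g (?p y) = indicator (ball x r) y *\<^sub>R g (?p y)"
      by eventually_elim (simp add: indicator_def)
  qed
  also have "\<dots> = r ^ DIM('a) * ball_int (\<lambda>y. g (?p y)) x r"
    using mgp unfolding set_borel_measurable_def
    by (intro set_integral_ball_scale r) (auto intro!: borel_measurable_times borel_measurable_indicator simp: set_borel_measurable_def)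
  also have "ball_int (\<lambda>y. g (?p y)) x r = sphere_int f x r"
    unfolding ball_int_def sphere_int_def
  proof (rule integral_cong_AE)
    have mz: "(\<lambda>z. g (?p (x + r *\<^sub>R z))) \<in> borel_measurable borel"
      by (rule measurable_compose[OF _ mgp]) simp
    then show "(\<lambda>z. g (?p (x + r *\<^sub>R z))) \<in> borel_measurable uball"
      by (rule measurable_uball_borel)
    have *: "AE z in uball. z \<noteq> (0::'a)"
      unfolding uball_def using AE_lborel_singleton[of 0] by (subst AE_restrict_space_iff) auto
    show "AE z in uball. g (?p (x + r *\<^sub>R z)) = f (x + r *\<^sub>R sgn z)"
      using * by eventually_elim (rule eq)
    \<comment> \<open>Continuity on the sphere says nothing about \<open>f x\<close>, the value of
      the integrand at \<open>z = 0\<close>; altering a Borel function at one point keeps it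
      Borel.\<close>
    have "(\<lambda>z. if z = 0 then f x else g (?p (x + r *\<^sub>R z))) \<in> borel_measurable borel"
      using mz by (intro measurable_If) auto
    also have "(\<lambda>z. if z = 0 then f x else g (?p (x + r *\<^sub>R z))) = (\<lambda>z. f (x + r *\<^sub>R sgn z))"
      using eq by auto
    finally show "(\<lambda>z. f (x + r *\<^sub>R sgn z)) \<in> borel_measurable uball"
      by (rule measurable_uball_borel)
  qed
  also have "r ^ DIM('a) = r * r ^ (DIM('a) - 1)"
    by (metis DIM_positive power_minus_mult mult.commute)
  finally show ?thesis using r by simp
qed

lemma sphere_mean_eq:
  fixes f :: "'a::euclidean_space \<Rightarrow> real"
  assumes r: "r > 0" and f: "continuous_on (sphere x r) f"
  shows "sphere_mean f x r = sphere_int f x r / uvol TYPE('a)"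
  unfolding sphere_mean_def set_integral_sphere_measure[OF r f] measure_sphere_measure_sphere[OF r]
  using r by simp

lemma mean_flux_eq:
  fixes u :: "'a::euclidean_space \<Rightarrow> real"
  assumes r: "r > 0" and f: "continuous_on (sphere x r) (\<lambda>y. frechet_derivative u (at y) ((y - x) /\<^sub>R r))"
  shows "mean_flux u x r = (LINT z|uball. frechet_derivative u (at (x + r *\<^sub>R sgn z)) (sgn z)) / uvol TYPE('a)"
  unfolding mean_flux_def set_integral_sphere_measure[OF r f] measure_sphere_measure_sphere[OF r]
  using r by (simp add: sphere_int_def)

lemma ball_mean_eq:
  fixes f :: "'a::euclidean_space \<Rightarrow> real"
  assumes r: "r > 0" and f: "continuous_on (ball x r) f"
  shows "ball_mean f x r = ball_int f x r / uvol TYPE('a)"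
proof -
  have "set_borel_measurable borel (ball x r) f"
    unfolding set_borel_measurable_def using borel_measurable_continuous_on_indicator[OF _ f] by simp
  then show ?thesis using r
    by (simp add: ball_mean_def set_integral_ball_scale content_ball)
qed

section \<open>Differentiation of integrals and polar coordinates\<close>

text \<open>The mean value inequality bounds the difference quotients by \<open>K\<close>, and
  constants are integrable on a finite measure, so dominated convergence applies along every
  sequence of increments.\<close>

lemma (in finite_measure) has_real_derivative_integral:
  fixes f f' :: "'a \<Rightarrow> real \<Rightarrow> real"
  assumes der: "\<And>y s. y \<in> space M \<Longrightarrow> s \<in> {a<..<b} \<Longrightarrow> (f y has_real_derivative f' y s) (at s)"
    and bound: "\<And>y s. y \<in> space M \<Longrightarrow> s \<in> {a<..<b} \<Longrightarrow> \<bar>f' y s\<bar> \<le> K"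
    and int: "\<And>s. s \<in> {a<..<b} \<Longrightarrow> integrable M (\<lambda>y. f y s)"
    and t: "t \<in> {a<..<b}"
  shows "((\<lambda>s. LINT y|M. f y s) has_real_derivative (LINT y|M. f' y t)) (at t)"
proof -
  have "((\<lambda>s. ((LINT y|M. f y s) - (LINT y|M. f y t)) / (s - t)) \<longlongrightarrow> (LINT y|M. f' y t))
      (at t within {a<..<b})"
    unfolding tendsto_at_iff_sequentially
  proof (intro allI impI)
    fix X :: "nat \<Rightarrow> real"
    assume X: "\<forall>i. X i \<in> {a<..<b} - {t}" and lim: "X \<longlonglongrightarrow> t"
    let ?q = "\<lambda>i y. (f y (X i) - f y t) / (X i - t)"
    have meas: "?q i \<in> borel_measurable M" for i
      using int[of "X i"] int[OF t] X by auto
    have conv: "(\<lambda>i. ?q i y) \<longlonglongrightarrow> f' y t" if "y \<in> space M" for y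
    proof -
      have "((\<lambda>s. (f y s - f y t) / (s - t)) \<longlongrightarrow> f' y t) (at t within {a<..<b})"
        using der[OF that t] unfolding has_field_derivative_iff by (rule tendsto_within_subset) auto
      then show ?thesis
        using X lim unfolding tendsto_at_iff_sequentially by (auto simp: o_def)
    qed
    have K: "norm (?q i y) \<le> K" if "y \<in> space M" for i y
    proof -
      have "norm (f y (X i) - f y t) \<le> K * norm (X i - t)"
        by (rule field_differentiable_bound[where S = "{a<..<b}" and f' = "f' y"])
           (use X t der that bound in \<open>auto intro: has_field_derivative_at_within\<close>)
      then show ?thesis using X by (auto simp: divide_le_eq)
    qed
    have "(\<lambda>i. integral\<^sup>L M (?q i)) \<longlonglongrightarrow> integral\<^sup>L M (\<lambda>y. f' y t)"
    proof (rule integral_dominated_convergence[where w="\<lambda>_. K"])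
      \<comment> \<open>Measurability of the derivative is inherited as a pointwise limit of the
        quotients.\<close>
      show "(\<lambda>y. f' y t) \<in> borel_measurable M"
        by (rule borel_measurable_LIMSEQ_real[OF conv meas])
    qed (use meas conv K in auto)
    moreover have "integral\<^sup>L M (?q i) = ((LINT y|M. f y (X i)) - (LINT y|M. f y t)) / (X i - t)" for i
    proof -
      have "integrable M (\<lambda>y. f y (X i))" "integrable M (\<lambda>y. f y t)"
        using int X t by auto
      then show ?thesis by simp
    qed
    ultimately show "((\<lambda>s. ((LINT y|M. f y s) - (LINT y|M. f y t)) / (s - t)) \<circ> X) \<longlonglongrightarrow> (LINT y|M. f' y t)"
      unfolding o_def by (simp only:)
  qed
  then show ?thesis
    using t by (simp add: has_field_derivative_iff at_within_open[OF t])
qed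

lemma set_integrable_ball_bounded:
  fixes k :: "'a::euclidean_space \<Rightarrow> real"
  assumes "k \<in> borel_measurable borel" "\<And>z. z \<in> ball x r \<Longrightarrow> \<bar>k z\<bar> \<le> K"
  shows "set_integrable lborel (ball x r) k"
  unfolding set_integrable_def
  by (rule integrableI_bounded_set_indicator[where B=K])
     (use assms emeasure_lborel_ball_finite[of x r] in auto)

lemma set_integral_annulus_bound:
  fixes k :: "'a::euclidean_space \<Rightarrow> real"
  assumes ab: "0 < a" "a \<le> b" and k: "set_integrable lborel (ball 0 b) k"
    and bound: "\<And>z. a \<le> norm z \<Longrightarrow> norm z < b \<Longrightarrow> \<bar>k z\<bar> \<le> e"
  shows "\<bar>(LINT z:ball 0 b|lborel. k z) - (LINT z:ball 0 a|lborel. k z)\<bar>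
    \<le> e * uvol TYPE('a) * (b ^ DIM('a) - a ^ DIM('a))"
proof -
  let ?A = "ball (0::'a) b - ball 0 a"
  have sub: "ball (0::'a) a \<subseteq> ball 0 b" using ab by auto
  have i: "set_integrable lborel ?A k" "set_integrable lborel (ball 0 a) k"
    using k sub by (auto intro: set_integrable_subset)
  have "(LINT z:ball 0 b|lborel. k z) = (LINT z:ball 0 a \<union> ?A|lborel. k z)"
    using sub by (simp add: Un_absorb1)
  also have "\<dots> = (LINT z:ball 0 a|lborel. k z) + (LINT z:?A|lborel. k z)"
    by (rule set_integral_Un) (use i in auto)
  finally have "\<bar>(LINT z:ball 0 b|lborel. k z) - (LINT z:ball 0 a|lborel. k z)\<bar> = \<bar>LINT z:?A|lborel. k z\<bar>"
    by simp
  also have "\<dots> \<le> (LINT z:?A|lborel. \<bar>k z\<bar>)"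
    using set_integral_norm_bound[OF i(1)] by simp
  also have "\<dots> \<le> (LINT z:?A|lborel. e)"
  proof (rule set_integral_mono)
    show "set_integrable lborel ?A (\<lambda>z. \<bar>k z\<bar>)"
      using set_integrable_norm[OF i(1)] by simp
    have "emeasure lborel ?A < \<infinity>"
      by (rule le_less_trans[OF emeasure_mono emeasure_lborel_ball_finite[of "0::'a" b]]) auto
    then show "set_integrable lborel ?A (\<lambda>z. e)"
      unfolding set_integrable_def by (auto intro!: integrable_indicator)
  qed (use bound in auto)
  also have "\<dots> = e * measure lborel ?A"
    by (simp add: set_lebesgue_integral_def)
  also have "measure lborel ?A = measure lborel (ball (0::'a) b) - measure lborel (ball (0::'a) a)"
    by (rule measure_Diff) (use sub emeasure_lborel_ball_finite[of "0::'a" b] in auto)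
  also have "e * \<dots> = e * uvol TYPE('a) * (b ^ DIM('a) - a ^ DIM('a))"
    using ab by (simp add: content_ball algebra_simps)
  finally show ?thesis .
qed

text \<open>Polar coordinates without a product measure: near the sphere of radius \<open>s\<close> replace \<open>g\<close> by
  the function \<open>g (s sgn z)\<close>, homogeneous of degree 0, whose integral over the ball of radius
  \<open>t\<close> is \<open>t\<^sup>m\<close> times a constant.\<close>

lemma has_real_derivative_ball_integral:
  fixes g :: "'a::euclidean_space \<Rightarrow> real"
  assumes g: "continuous_on UNIV g" and s: "s > 0"
  shows "((\<lambda>t. LINT z:ball 0 t|lborel. g z) has_real_derivative
    real DIM('a) * s ^ (DIM('a) - 1) * sphere_int g 0 s) (at s)"
proof -
  let ?m = "DIM('a)"
  define k where "k z = g z - g (s *\<^sub>R sgn z)" for z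
  define E where "E t = (LINT z:ball 0 t|lborel. k z)" for t
  have gm: "g \<in> borel_measurable borel"
    using g by (rule borel_measurable_continuous_onI)
  have hm: "(\<lambda>z. g (s *\<^sub>R sgn z)) \<in> borel_measurable borel"
    by (rule measurable_compose[OF _ gm]) (intro borel_measurable_scaleR sgn_measurable borel_measurable_const)
  obtain K where K: "\<And>z. z \<in> cball 0 (2 * s) \<Longrightarrow> \<bar>g z\<bar> \<le> K"
    using continuous_on_cball_bounded[OF continuous_on_subset[OF g subset_UNIV]] by metis
  have ig: "set_integrable lborel (ball 0 t) g" and ih: "set_integrable lborel (ball 0 t) (\<lambda>z. g (s *\<^sub>R sgn z))"
    if "t \<le> 2 * s" for t
    using that s by (auto intro!: set_integrable_ball_bounded[where K=K] gm hm K simp: norm_sgn)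
  have ik: "set_integrable lborel (ball 0 t) k" if "t \<le> 2 * s" for t
    unfolding k_def using ig[OF that] ih[OF that] by (rule set_integral_diff)
  have split: "(LINT z:ball 0 t|lborel. g z) = t ^ ?m * sphere_int g 0 s + E t" if "0 < t" "t < 2 * s" for t
  proof -
    have "(LINT z:ball 0 t|lborel. g (s *\<^sub>R sgn z)) = t ^ ?m * ball_int (\<lambda>z. g (s *\<^sub>R sgn z)) 0 t"
      using hm that by (intro set_integral_ball_scale) (auto simp: set_borel_measurable_def intro!: borel_measurable_times borel_measurable_indicator)
    also have "ball_int (\<lambda>z. g (s *\<^sub>R sgn z)) 0 t = sphere_int g 0 s"
      using that by (simp add: ball_int_def sphere_int_def sgn_scaleR)
    finally show ?thesis
      using set_integral_diff(2)[OF ig ih, of t] that by (simp add: E_def k_def)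
  qed
  \<comment> \<open>The error integrand \<open>k\<close> vanishes on the sphere of radius
    \<open>s\<close> and is uniformly small nearby, while the shell between the radii
    \<open>s\<close> and \<open>t\<close> has volume of order \<open>|t - s|\<close>. Hence
    \<open>E t - E s\<close> is of smaller order than \<open>t - s\<close>.\<close>
  have E: "(E has_real_derivative 0) (at s)"
    unfolding has_field_derivative_def has_derivative_at_alt
  proof (intro conjI allI impI)
    show "bounded_linear ((*) (0::real))" by (rule bounded_linear_mult_right)
    fix e :: real assume e: "e > 0"
    define L where "L = real ?m * (2 * s) ^ (?m - 1)"
    have L: "L > 0" using s by (simp add: L_def)
    have Lip: "\<bar>a ^ ?m - b ^ ?m\<bar> \<le> L * \<bar>a - b\<bar>" if "0 \<le> a" "a \<le> 2 * s" "0 \<le> b" "b \<le> 2 * s" for a b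
    proof -
      have "norm (a ^ ?m - b ^ ?m) \<le> L * norm (a - b)"
      proof (rule field_differentiable_bound[where S = "{0..2 * s}" and f'="\<lambda>x. real ?m * x ^ (?m - 1)"])
        fix z assume z: "z \<in> {0..2 * s}"
        then have "real ?m * z ^ (?m - 1) \<le> real ?m * (2 * s) ^ (?m - 1)"
          by (intro mult_left_mono power_mono) auto
        then show "norm (real ?m * z ^ (?m - 1)) \<le> L"
          using z by (simp only: L_def real_norm_def abs_of_nonneg[OF mult_nonneg_nonneg] zero_le_power of_nat_0_le_iff atLeastAtMost_iff)
      qed (use that in \<open>auto intro!: derivative_eq_intros\<close>)
      then show ?thesis by simp
    qed
    \<comment> \<open>\<open>L\<close> is a Lipschitz constant of \<open>t ^ m\<close> on
      \<open>[0, 2 s]\<close>, so the shell has volume at most \<open>uvol * L * |t - s|\<close>;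
      this \<open>e'\<close> makes the total exactly \<open>e * |t - s|\<close>.\<close>
    define e' where "e' = e / (uvol TYPE('a) * L)"
    have e': "e' > 0" using e L uvol_pos[where 'a='a] by (simp add: e'_def)
    have "uniformly_continuous_on (cball 0 (2 * s)) g"
      using g by (intro compact_uniformly_continuous compact_cball continuous_on_subset[OF g]) auto
    then obtain d where d: "d > 0" "\<And>y z. y \<in> cball 0 (2 * s) \<Longrightarrow> z \<in> cball 0 (2 * s) \<Longrightarrow> dist z y < d \<Longrightarrow> dist (g z) (g y) < e'"
      using e' unfolding uniformly_continuous_on_def by metis
    have k_small: "\<bar>k z\<bar> \<le> e'" if z: "norm z \<le> 2 * s" "\<bar>norm z - s\<bar> < d" "z \<noteq> 0" for z
    proof -
      have "z - s *\<^sub>R sgn z = (norm z - s) *\<^sub>R sgn z"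
        unfolding scaleR_diff_left using z by (simp add: sgn_div_norm)
      then have "dist z (s *\<^sub>R sgn z) < d"
        using z by (simp add: dist_norm norm_sgn)
      then have "dist (g z) (g (s *\<^sub>R sgn z)) < e'"
        using d(2)[of "s *\<^sub>R sgn z" z] z s by (simp add: norm_sgn)
      then show ?thesis by (simp add: k_def dist_real_def)
    qed
    show "\<exists>d>0. \<forall>y. norm (y - s) < d \<longrightarrow> norm (E y - E s - 0 * (y - s)) \<le> e * norm (y - s)"
    proof (intro exI[of _ "min d s"] conjI allI impI)
      show "min d s > 0" using d s by simp
      fix t assume "norm (t - s) < min d s"
      then have t: "\<bar>t - s\<bar> < d" "0 < t" "t < 2 * s" by auto
      have "\<bar>E t - E s\<bar> \<le> e' * uvol TYPE('a) * \<bar>t ^ ?m - s ^ ?m\<bar>"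
      proof (cases "t \<le> s")
        case True
        have "\<bar>E s - E t\<bar> \<le> e' * uvol TYPE('a) * (s ^ ?m - t ^ ?m)"
          unfolding E_def using True t s
          by (intro set_integral_annulus_bound ik k_small) auto
        moreover have "t ^ ?m \<le> s ^ ?m" using True t by (intro power_mono) auto
        ultimately show ?thesis by (simp add: abs_minus_commute)
      next
        case False
        have "\<bar>E t - E s\<bar> \<le> e' * uvol TYPE('a) * (t ^ ?m - s ^ ?m)"
          unfolding E_def using False t s
          by (intro set_integral_annulus_bound ik k_small) auto
        moreover have "s ^ ?m \<le> t ^ ?m" using False s by (intro power_mono) auto
        ultimately show ?thesis by simp
      qed
      also have "\<dots> \<le> e' * uvol TYPE('a) * (L * \<bar>t - s\<bar>)"
        using e' uvol_pos[where 'a='a] Lip[of t s] t s by (intro mult_left_mono) auto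
      also have "\<dots> = e * \<bar>t - s\<bar>"
        using L uvol_pos[where 'a='a] by (simp add: e'_def)
      finally show "norm (E t - E s - 0 * (t - s)) \<le> e * norm (t - s)" by simp
    qed
  qed
  have "((\<lambda>t. t ^ ?m * sphere_int g 0 s + E t) has_real_derivative
      real ?m * s ^ (?m - 1) * sphere_int g 0 s) (at s)"
    by (auto intro!: derivative_eq_intros E)
  then show ?thesis
  proof (rule has_field_derivative_transform_within_open[where S="{0<..<2 * s}"])
  qed (use s split in auto)
qed

section \<open>Integration by parts on the ball\<close>

lemma lborel_integral_translate:
  fixes f :: "'a::euclidean_space \<Rightarrow> real"
  assumes "f \<in> borel_measurable borel"
  shows "(LINT y|lborel. f (c + y)) = (LINT y|lborel. f y)"
proof -
  have "(LINT y|lborel. f y) = (LINT y|distr lborel borel ((+) c). f y)"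
    by (simp add: lborel_distr_plus)
  also have "\<dots> = (LINT y|lborel. f (c + y))"
    by (rule integral_distr) (use assms in auto)
  finally show ?thesis by simp
qed

lemma AE_lborel_not_on_sphere: "AE y in lborel. norm (y :: 'a::euclidean_space) \<noteq> 1"
proof -
  have "sphere (0::'a) 1 \<in> null_sets lebesgue"
    using negligible_sphere negligible_iff_null_sets by blast
  then have "sphere (0::'a) 1 \<in> null_sets lborel"
    by (simp add: null_sets_completion_iff)
  then have "AE y in lborel. y \<notin> sphere (0::'a) 1"
    by (rule AE_not_in)
  then show ?thesis by simp
qed

text \<open>Truncating the norms to \<open>a, b \<le> 1\<close> turns the difference into
  \<open>b^2 - a^2\<close>, with a factor \<open>a + b \<le> 2\<close>. The bound dominates the
  difference quotients of the cut-off weight in the integration by parts.\<close>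

lemma hat_Lipschitz:
  fixes y z :: "'a::real_normed_vector"
  shows "\<bar>max 0 (1 - (norm y)\<^sup>2) - max 0 (1 - (norm z)\<^sup>2)\<bar> \<le> 2 * norm (y - z)"
proof -
  have hat: "max 0 (1 - a\<^sup>2) = 1 - (min 1 a)\<^sup>2" if "a \<ge> 0" for a :: real
  proof (cases "a \<le> 1")
    case True
    then show ?thesis using that power_le_one[of a 2] by simp
  next
    case False
    then have "1 \<le> a\<^sup>2" by (intro one_le_power) simp
    then show ?thesis using False by simp
  qed
  define a b where "a = min 1 (norm y)" and "b = min 1 (norm z)"
  have ab: "0 \<le> a" "a \<le> 1" "0 \<le> b" "b \<le> 1" by (auto simp: a_def b_def)
  have "\<bar>(1 - a\<^sup>2) - (1 - b\<^sup>2)\<bar> = \<bar>a + b\<bar> * \<bar>a - b\<bar>"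
    by (simp add: power2_eq_square algebra_simps flip: abs_mult)
  also have "\<dots> \<le> 2 * \<bar>a - b\<bar>"
    using ab by (intro mult_right_mono) auto
  also have "\<bar>a - b\<bar> \<le> \<bar>norm y - norm z\<bar>"
    by (auto simp: a_def b_def)
  also have "\<dots> \<le> norm (y - z)" by (rule norm_triangle_ineq3)
  finally show ?thesis by (simp add: hat a_def b_def)
qed

text \<open>Integration by parts without a boundary term, as \<open>1 - \<bar>y\<bar>\<^sup>2\<close> vanishes on the unit sphere; it
  comes from the translation invariance of Lebesgue measure.\<close>

lemma integral_uball_by_parts:
  fixes g :: "'a::euclidean_space \<Rightarrow> real"
  assumes Lip: "\<And>y z. y \<in> cball 0 1 \<Longrightarrow> z \<in> cball 0 1 \<Longrightarrow> \<bar>g y - g z\<bar> \<le> L * norm (y - z)"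
    and der: "\<And>y. y \<in> ball 0 1 \<Longrightarrow> (g has_derivative g' y) (at y)"
  shows "(LINT y|uball. (1 - (norm y)\<^sup>2) * g' y e) = 2 * (LINT y|uball. g y * (y \<bullet> e))"
proof -
  \<comment> \<open>Shifts leave the unit ball, outside which \<open>g\<close> is uncontrolled. The
    nearest-point projection onto the closed ball is 1-Lipschitz, so \<open>G\<close> extends
    \<open>g\<close> to the whole space with the same constant \<open>L\<close>.\<close>
  define G where "G y = g (closest_point (cball 0 1) y)" for y
  define \<psi> :: "'a \<Rightarrow> real" where "\<psi> y = max 0 (1 - (norm y)\<^sup>2)" for y
  define X where "X n = inverse (real (Suc n))" for n
  have X: "X n > 0" "X n \<le> 1" "X n \<noteq> 0" for n by (auto simp: X_def field_simps)
  have Xlim: "X \<longlonglongrightarrow> 0" unfolding X_def by (rule LIMSEQ_inverse_real_of_nat)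
  have cp: "closest_point (cball (0::'a) 1) y \<in> cball 0 1" for y
    by (rule closest_point_in_set) auto
  have Geq: "G y = g y" if "y \<in> cball 0 1" for y
    using that by (simp add: G_def closest_point_self)
  have L0: "L \<ge> 0"
  proof -
    obtain b :: 'a where "b \<in> Basis" using nonempty_Basis by blast
    then have "\<bar>g b - g 0\<bar> \<le> L * norm (b - 0)" by (intro Lip) auto
    with \<open>b \<in> Basis\<close> show ?thesis by auto
  qed
  have GLip: "\<bar>G y - G z\<bar> \<le> L * norm (y - z)" for y z
  proof -
    have "\<bar>G y - G z\<bar> \<le> L * norm (closest_point (cball 0 1) y - closest_point (cball 0 1) z)"
      unfolding G_def by (intro Lip cp)
    also have "\<dots> \<le> L * norm (y - z)"
      using closest_point_lipschitz[of "cball (0::'a) 1" y z] L0 by (intro mult_left_mono) (auto simp: dist_norm)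
    finally show ?thesis .
  qed
  have contG: "continuous_on UNIV G"
    by (rule lipschitz_on_continuous_on[where L=L]) (auto intro!: lipschitz_onI simp: dist_norm GLip L0)
  have cont\<psi>: "continuous_on UNIV \<psi>"
    unfolding \<psi>_def by (intro continuous_intros)
  have Gm [measurable]: "G \<in> borel_measurable borel" and \<psi>m [measurable]: "\<psi> \<in> borel_measurable borel"
    using contG cont\<psi> by (auto intro: borel_measurable_continuous_onI)
  define M where "M = \<bar>g 0\<bar> + L"
  have GM: "\<bar>G y\<bar> \<le> M" for y
  proof -
    have "\<bar>G y - g 0\<bar> \<le> L * norm (closest_point (cball 0 1) y - 0)"
      unfolding G_def by (intro Lip cp) auto
    also have "\<dots> \<le> L * 1" using cp[of y] L0 by (intro mult_left_mono) auto
    finally show ?thesis by (simp add: M_def)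
  qed
  have M0: "M \<ge> 0" using L0 by (simp add: M_def)
  \<comment> \<open>Since \<open>X n \<le> 1\<close>, the supports of all shifted weights lie in
    this ball, which makes the dominating functions integrable.\<close>
  let ?B = "cball (0::'a) (1 + norm e)"
  let ?w = "\<lambda>y. indicator ?B y * (2 * M * norm e)"
  have iB: "integrable lborel (\<lambda>y::'a. indicator ?B y * c)" for c :: real
    using emeasure_lborel_cball_finite[of "0::'a" "1 + norm e"] by (intro integrable_mult_left integrable_real_indicator) auto
  have supp: "\<psi> y = 0" if "norm y \<ge> 1" for y
    using that one_le_power[of "norm y" 2] by (simp add: \<psi>_def)
  have \<psi>1: "0 \<le> \<psi> y" "\<psi> y \<le> 1" for y by (auto simp: \<psi>_def)
  have \<psi>in: "\<psi> y = 1 - (norm y)\<^sup>2" if "norm y < 1" for y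
    using that power_le_one[of "norm y" 2] by (simp add: \<psi>_def)
  have Xe: "norm (X n *\<^sub>R e) \<le> norm e" for n
    using X[of n] by (simp add: mult_left_le_one_le)
  \<comment> \<open>Two forms of one increment, with the difference quotient on
    \<open>\<psi>\<close> or on \<open>G\<close>. Their integrals agree by translation invariance,
    and their limits are the two sides of the formula.\<close>
  define l where "l n y = G y * ((\<psi> (y - X n *\<^sub>R e) - \<psi> y) / X n)" for n y
  define r where "r n y = (G (y + X n *\<^sub>R e) - G y) / X n * \<psi> y" for n y
  have lm [measurable]: "l n \<in> borel_measurable borel" and rm [measurable]: "r n \<in> borel_measurable borel" for n
    unfolding l_def r_def by measurable
  have l_bound: "norm (l n y) \<le> ?w y" for n y
  proof (cases "y \<in> ?B")
    case True
    have "\<bar>\<psi> (y - X n *\<^sub>R e) - \<psi> y\<bar> \<le> 2 * norm (X n *\<^sub>R e)"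
      using hat_Lipschitz[of "y - X n *\<^sub>R e" y] by (simp add: \<psi>_def)
    then have "\<bar>(\<psi> (y - X n *\<^sub>R e) - \<psi> y) / X n\<bar> \<le> 2 * norm e"
      using X[of n] by (simp add: divide_le_eq mult_ac)
    then have "\<bar>G y\<bar> * \<bar>(\<psi> (y - X n *\<^sub>R e) - \<psi> y) / X n\<bar> \<le> M * (2 * norm e)"
      using GM[of y] M0 by (intro mult_mono) auto
    then show ?thesis using True by (simp add: l_def abs_mult mult.commute mult.left_commute)
  next
    case False
    then have "norm y > 1 + norm e" by simp
    moreover have "norm (y - X n *\<^sub>R e) \<ge> norm y - norm e"
      using norm_triangle_ineq2[of y "X n *\<^sub>R e"] Xe[of n] by linarith
    ultimately have "norm y \<ge> 1" "norm (y - X n *\<^sub>R e) \<ge> 1"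
      using norm_ge_zero[of e] by linarith+
    then show ?thesis using False by (simp add: l_def supp)
  qed
  have r_bound: "norm (r n y) \<le> indicator ?B y * (L * norm e)" for n y
  proof (cases "y \<in> ?B")
    case True
    have "\<bar>G (y + X n *\<^sub>R e) - G y\<bar> \<le> L * norm (X n *\<^sub>R e)"
      using GLip[of "y + X n *\<^sub>R e" y] by simp
    then have "\<bar>(G (y + X n *\<^sub>R e) - G y) / X n\<bar> \<le> L * norm e"
      using X[of n] by (simp add: divide_le_eq algebra_simps)
    then have "\<bar>(G (y + X n *\<^sub>R e) - G y) / X n\<bar> * \<bar>\<psi> y\<bar> \<le> L * norm e * 1"
      using \<psi>1[of y] L0 by (intro mult_mono) auto
    then show ?thesis using True by (simp add: r_def abs_mult)
  next
    case False
    then have "\<not> norm y \<le> 1 + norm e" by simp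
    then have "norm y \<ge> 1" using norm_ge_zero[of e] by linarith
    then show ?thesis using False by (simp add: r_def supp)
  qed
  \<comment> \<open>The cut-off weight has a kink on the unit sphere, so the limit is claimed only
    off that null set. For \<open>r\<close> no exception arises, because \<open>\<psi>\<close>
    itself vanishes there.\<close>
  have l_lim: "AE y in lborel. (\<lambda>n. l n y) \<longlonglongrightarrow> indicator (ball 0 1) y * (2 * (g y * (y \<bullet> e)))"
    using AE_lborel_not_on_sphere
  proof eventually_elim
    fix y :: 'a assume y: "norm y \<noteq> 1"
    have "(\<lambda>n. norm (y - X n *\<^sub>R e)) \<longlonglongrightarrow> norm (y - 0 *\<^sub>R e)"
      by (intro tendsto_intros Xlim)
    then have lim: "(\<lambda>n. norm (y - X n *\<^sub>R e)) \<longlonglongrightarrow> norm y" by simp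
    show "(\<lambda>n. l n y) \<longlonglongrightarrow> indicator (ball 0 1) y * (2 * (g y * (y \<bullet> e)))"
    proof (cases "norm y < 1")
      case True
      have "(\<lambda>n. g y * (2 * (y \<bullet> e) - X n * (norm e)\<^sup>2)) \<longlonglongrightarrow> g y * (2 * (y \<bullet> e) - 0 * (norm e)\<^sup>2)"
        by (intro tendsto_intros Xlim)
      moreover have "eventually (\<lambda>n. l n y = g y * (2 * (y \<bullet> e) - X n * (norm e)\<^sup>2)) sequentially"
        using order_tendstoD(2)[OF lim True]
      proof eventually_elim
        fix n assume n: "norm (y - X n *\<^sub>R e) < 1"
        have "\<psi> (y - X n *\<^sub>R e) - \<psi> y = X n * (2 * (y \<bullet> e) - X n * (norm e)\<^sup>2)"
          unfolding \<psi>in[OF n] \<psi>in[OF True] power2_norm_eq_inner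
          by (simp add: algebra_simps inner_commute power2_eq_square)
        then show "l n y = g y * (2 * (y \<bullet> e) - X n * (norm e)\<^sup>2)"
          using X(3)[of n] True by (simp add: l_def Geq)
      qed
      ultimately have "(\<lambda>n. l n y) \<longlonglongrightarrow> g y * (2 * (y \<bullet> e) - 0 * (norm e)\<^sup>2)"
        by (simp cong: tendsto_cong)
      then show ?thesis using True by (simp add: mult.left_commute)
    next
      case False
      then have "1 < norm y" using y by simp
      have "eventually (\<lambda>n. l n y = 0) sequentially"
        using order_tendstoD(1)[OF lim \<open>1 < norm y\<close>]
        by eventually_elim (use \<open>1 < norm y\<close> in \<open>simp add: l_def supp\<close>)
      then have "(\<lambda>n. l n y) \<longlonglongrightarrow> 0" by (rule tendsto_eventually)
      then show ?thesis using False by simp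
    qed
  qed
  have r_lim: "(\<lambda>n. r n y) \<longlonglongrightarrow> indicator (ball 0 1) y * ((1 - (norm y)\<^sup>2) * g' y e)" for y
  proof (cases "norm y < 1")
    case True
    have "(G has_derivative g' y) (at y)"
      by (rule has_derivative_transform_within_open[OF der, of y "ball 0 1"]) (use True Geq in auto)
    then have "((\<lambda>t. (G (y + t *\<^sub>R e) - G y) / t) \<longlongrightarrow> g' y e) (at 0)"
    proof -
      assume d: "(G has_derivative g' y) (at y)"
      then have "((\<lambda>t. G (y + t *\<^sub>R e)) has_derivative (\<lambda>t. g' y (t *\<^sub>R e))) (at 0)"
        by (intro has_derivative_compose[of "\<lambda>t. y + t *\<^sub>R e" "\<lambda>t. t *\<^sub>R e" 0 UNIV G "g' y"]) (auto intro!: derivative_eq_intros)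
      moreover have "(\<lambda>t. g' y (t *\<^sub>R e)) = (*) (g' y e)"
        using linear_scale[OF has_derivative_linear[OF d]] by (auto simp: fun_eq_iff)
      ultimately have "((\<lambda>t. G (y + t *\<^sub>R e)) has_real_derivative g' y e) (at 0)"
        by (simp add: has_field_derivative_def)
      then show ?thesis by (simp add: has_field_derivative_iff)
    qed
    then have "(\<lambda>n. (G (y + X n *\<^sub>R e) - G y) / X n) \<longlonglongrightarrow> g' y e"
      using Xlim X(3) unfolding tendsto_at_iff_sequentially by (auto simp: o_def)
    then have "(\<lambda>n. r n y) \<longlonglongrightarrow> g' y e * \<psi> y"
      unfolding r_def by (intro tendsto_mult tendsto_const)
    then show ?thesis using True by (simp add: \<psi>in mult.commute)
  next
    case False
    then show ?thesis by (simp add: r_def supp)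
  qed
  have "(\<lambda>n. LINT y|lborel. l n y) \<longlonglongrightarrow> (LINT y|lborel. indicator (ball 0 1) y * (2 * (g y * (y \<bullet> e))))"
  proof (rule integral_dominated_convergence[where w="?w"])
    have "(\<lambda>y. indicator (ball 0 1) y * (2 * (G y * (y \<bullet> e)))) \<in> borel_measurable lborel"
      by (intro borel_measurable_times borel_measurable_indicator) (auto simp: Gm)
    also have "(\<lambda>y. indicator (ball 0 1) y * (2 * (G y * (y \<bullet> e)))) = (\<lambda>y. indicator (ball 0 1) y * (2 * (g y * (y \<bullet> e))))"
      using Geq by (auto simp: fun_eq_iff indicator_def)
    finally show "(\<lambda>y. indicator (ball 0 1) y * (2 * (g y * (y \<bullet> e)))) \<in> borel_measurable lborel" .
  qed (use l_lim l_bound iB lm in auto)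
  moreover have "(\<lambda>n. LINT y|lborel. r n y) \<longlonglongrightarrow> (LINT y|lborel. indicator (ball 0 1) y * ((1 - (norm y)\<^sup>2) * g' y e))"
  proof (rule integral_dominated_convergence[where w="\<lambda>y. indicator ?B y * (L * norm e)"])
    show "(\<lambda>y. indicator (ball 0 1) y * ((1 - (norm y)\<^sup>2) * g' y e)) \<in> borel_measurable lborel"
      by (rule borel_measurable_LIMSEQ_real[OF r_lim]) (simp add: rm)
  qed (use r_lim r_bound iB rm in auto)
  moreover have "(LINT y|lborel. l n y) = (LINT y|lborel. r n y)" for n
  proof -
    let ?c = "X n *\<^sub>R e"
    have int: "integrable lborel (\<lambda>y. G (y + a) * \<psi> (y - b))" if "norm b \<le> norm e" for a b
    proof (rule Bochner_Integration.integrable_bound[OF iB[of M]])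
      show "AE y in lborel. norm (G (y + a) * \<psi> (y - b)) \<le> norm (indicator ?B y * M)"
      proof (intro AE_I2)
        fix y
        show "norm (G (y + a) * \<psi> (y - b)) \<le> norm (indicator ?B y * M)"
        proof (cases "y \<in> ?B")
          case True
          have "\<bar>G (y + a)\<bar> * \<bar>\<psi> (y - b)\<bar> \<le> M * 1"
            using GM[of "y + a"] \<psi>1[of "y - b"] M0 by (intro mult_mono) auto
          then show ?thesis using True M0 by (simp add: abs_mult)
        next
          case False
          then have "1 \<le> norm (y - b)"
            using norm_triangle_ineq2[of y b] that by simp
          then show ?thesis by (simp add: supp)
        qed
      qed
    qed auto
    have i1: "integrable lborel (\<lambda>y. G y * \<psi> (y - ?c))" using int[of ?c 0] Xe[of n] by simp
    have i2: "integrable lborel (\<lambda>y. G y * \<psi> y)" using int[of 0 0] by simp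
    have i3: "integrable lborel (\<lambda>y. G (y + ?c) * \<psi> y)" using int[of 0 ?c] by simp
    have "(LINT y|lborel. l n y) = (LINT y|lborel. (G y * \<psi> (y - ?c) - G y * \<psi> y) / X n)"
      unfolding l_def by (intro Bochner_Integration.integral_cong) (auto simp: algebra_simps)
    also have "\<dots> = ((LINT y|lborel. G y * \<psi> (y - ?c)) - (LINT y|lborel. G y * \<psi> y)) / X n"
      using i1 i2 by simp
    also have "(LINT y|lborel. G y * \<psi> (y - ?c)) = (LINT y|lborel. G (?c + y) * \<psi> (?c + y - ?c))"
      by (rule lborel_integral_translate[symmetric]) measurable
    also have "\<dots> = (LINT y|lborel. G (y + ?c) * \<psi> y)"
      by (simp add: add.commute)
    also have "(\<dots> - (LINT y|lborel. G y * \<psi> y)) / X n = (LINT y|lborel. (G (y + ?c) * \<psi> y - G y * \<psi> y) / X n)"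
      using i2 i3 by simp
    also have "\<dots> = (LINT y|lborel. r n y)"
      unfolding r_def by (intro Bochner_Integration.integral_cong) (auto simp: algebra_simps diff_divide_distrib)
    finally show ?thesis .
  qed
  ultimately have "(LINT y|lborel. indicator (ball 0 1) y * ((1 - (norm y)\<^sup>2) * g' y e)) =
      (LINT y|lborel. indicator (ball 0 1) y * (2 * (g y * (y \<bullet> e))))"
    using LIMSEQ_unique by fastforce
  moreover have "(LINT y|uball. 2 * (g y * (y \<bullet> e))) = 2 * (LINT y|uball. g y * (y \<bullet> e))"
    by (rule integral_mult_right_zero)
  ultimately show ?thesis
    unfolding integral_uball_eq set_lebesgue_integral_def by (simp add: mult_ac)
qed

section \<open>Ball means of twice differentiable functions\<close>

lemma partial_deriv_eqI: "(f has_derivative f') (at x) \<Longrightarrow> partial_deriv b f x = f' b"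
  using frechet_derivative_at[of f f' x] by (simp add: partial_deriv_def)

lemma C1_on_has_derivative:
  "C1_on f S \<Longrightarrow> x \<in> S \<Longrightarrow> (f has_derivative frechet_derivative f (at x)) (at x)"
  by (simp add: C1_on_def frechet_derivative_works)

lemma C1_on_continuous_on: "C1_on f S \<Longrightarrow> continuous_on S f"
  unfolding C1_on_def
  by (auto intro!: continuous_at_imp_continuous_on differentiable_imp_continuous_within)

lemma frechet_derivative_eq_sum_partial:
  fixes f :: "'a::euclidean_space \<Rightarrow> real"
  assumes "f differentiable (at x)"
  shows "frechet_derivative f (at x) v = (\<Sum>b\<in>Basis. (v \<bullet> b) * partial_deriv b f x)"
proof -
  have lin: "linear (frechet_derivative f (at x))"
    using assms by (rule linear_frechet_derivative)
  have "frechet_derivative f (at x) v = frechet_derivative f (at x) (\<Sum>b\<in>Basis. (v \<bullet> b) *\<^sub>R b)"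
    by (simp add: euclidean_representation)
  also have "\<dots> = (\<Sum>b\<in>Basis. (v \<bullet> b) * partial_deriv b f x)"
    by (simp add: linear_sum[OF lin] linear_scale[OF lin] partial_deriv_def)
  finally show ?thesis .
qed

lemma C1_on_derivative_bound:
  fixes f :: "'a::euclidean_space \<Rightarrow> real"
  assumes f: "C1_on f S" and sub: "cball x r \<subseteq> S"
  obtains K where "K \<ge> 0" "\<And>y v. y \<in> cball x r \<Longrightarrow> \<bar>frechet_derivative f (at y) v\<bar> \<le> K * norm v"
proof -
  have "\<exists>K. \<forall>y\<in>cball x r. \<bar>partial_deriv b f y\<bar> \<le> K" if "b \<in> Basis" for b
    using continuous_on_cball_bounded[of x r "partial_deriv b f"] continuous_on_subset[OF _ sub] f that
    unfolding C1_on_def by metis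
  then obtain K where K: "\<And>b y. b \<in> Basis \<Longrightarrow> y \<in> cball x r \<Longrightarrow> \<bar>partial_deriv b f y\<bar> \<le> K b"
    by metis
  show ?thesis
  proof
    show "(\<Sum>b\<in>Basis. \<bar>K b\<bar>) \<ge> 0" by (simp add: sum_nonneg)
    fix y v assume y: "y \<in> cball x r"
    then have "\<bar>frechet_derivative f (at y) v\<bar> = \<bar>\<Sum>b\<in>Basis. (v \<bullet> b) * partial_deriv b f y\<bar>"
      using f sub by (subst frechet_derivative_eq_sum_partial) (auto simp: C1_on_def)
    also have "\<dots> \<le> (\<Sum>b\<in>Basis. \<bar>(v \<bullet> b) * partial_deriv b f y\<bar>)" by (rule sum_abs)
    also have "\<dots> \<le> (\<Sum>b\<in>Basis. norm v * \<bar>K b\<bar>)"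
    proof (rule sum_mono)
      fix b :: 'a assume b: "b \<in> Basis"
      show "\<bar>(v \<bullet> b) * partial_deriv b f y\<bar> \<le> norm v * \<bar>K b\<bar>"
        unfolding abs_mult using K[OF b y] Basis_le_norm[OF b, of v] by (intro mult_mono) auto
    qed
    finally show "\<bar>frechet_derivative f (at y) v\<bar> \<le> (\<Sum>b\<in>Basis. \<bar>K b\<bar>) * norm v"
      by (simp add: sum_distrib_left mult.commute)
  qed
qed

lemma C1_on_Lipschitz:
  fixes f :: "'a::euclidean_space \<Rightarrow> real"
  assumes f: "C1_on f S" and sub: "cball x r \<subseteq> S"
  obtains K where "K \<ge> 0" "\<And>y z. y \<in> cball x r \<Longrightarrow> z \<in> cball x r \<Longrightarrow> \<bar>f y - f z\<bar> \<le> K * norm (y - z)"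
proof -
  obtain K where K: "K \<ge> 0" "\<And>y v. y \<in> cball x r \<Longrightarrow> \<bar>frechet_derivative f (at y) v\<bar> \<le> K * norm v"
    using C1_on_derivative_bound[OF f sub] by metis
  have "norm (f y - f z) \<le> K * norm (y - z)" if "y \<in> cball x r" "z \<in> cball x r" for y z
  proof (rule differentiable_bound[where S="cball x r" and f'="\<lambda>y. frechet_derivative f (at y)"])
    show "(f has_derivative frechet_derivative f (at y)) (at y within cball x r)" if "y \<in> cball x r" for y
      by (rule has_derivative_at_withinI, rule C1_on_has_derivative[OF f]) (use sub that in auto)
    show "onorm (frechet_derivative f (at y)) \<le> K" if "y \<in> cball x r" for y
      using K that by (intro onorm_bound) auto
  qed (use that in auto)
  then show ?thesis using K(1) that by auto
qed

lemma has_real_derivative_along_ray: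
  assumes f: "C1_on f S" and y: "x + s *\<^sub>R v \<in> S"
  shows "((\<lambda>s. f (x + s *\<^sub>R v)) has_real_derivative frechet_derivative f (at (x + s *\<^sub>R v)) v) (at s)"
proof -
  let ?D = "frechet_derivative f (at (x + s *\<^sub>R v))"
  have d: "(f has_derivative ?D) (at (x + s *\<^sub>R v))"
    by (rule C1_on_has_derivative[OF f y])
  then have "((\<lambda>t. f (x + t *\<^sub>R v)) has_derivative (\<lambda>t. ?D (t *\<^sub>R v))) (at s)"
    by (intro has_derivative_compose[of "\<lambda>t. x + t *\<^sub>R v" "\<lambda>t. t *\<^sub>R v" s UNIV f ?D]) (auto intro!: derivative_eq_intros)
  moreover have "(\<lambda>t. ?D (t *\<^sub>R v)) = (*) (?D v)"
    using linear_scale[OF has_derivative_linear[OF d]] by (auto simp: fun_eq_iff)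
  ultimately show ?thesis by (simp add: has_field_derivative_def)
qed

lemma integral_uball_frechet_derivative:
  fixes f :: "'a::euclidean_space \<Rightarrow> real"
  assumes f: "C1_on f S" and sub: "cball x r \<subseteq> S" and r: "r \<ge> 0"
  shows "(LINT z|uball. frechet_derivative f (at (x + r *\<^sub>R z)) z) =
     (\<Sum>b\<in>Basis. LINT z|uball. partial_deriv b f (x + r *\<^sub>R z) * (z \<bullet> b))"
proof -
  have "x + r *\<^sub>R z \<in> S" if "z \<in> ball 0 1" for z
    using sub r mult_left_le_one_le[of r "norm z"] that mult_left_le[of "norm z" r] by (auto simp: dist_norm subset_eq)
  then have "(LINT z|uball. frechet_derivative f (at (x + r *\<^sub>R z)) z) =
      (LINT z|uball. (\<Sum>b\<in>Basis. partial_deriv b f (x + r *\<^sub>R z) * (z \<bullet> b)))"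
    using f by (intro Bochner_Integration.integral_cong)
      (auto simp: frechet_derivative_eq_sum_partial C1_on_def mult.commute)
  also have "\<dots> = (\<Sum>b\<in>Basis. LINT z|uball. partial_deriv b f (x + r *\<^sub>R z) * (z \<bullet> b))"
  proof (rule Bochner_Integration.integral_sum)
    fix b :: 'a assume "b \<in> Basis"
    then have "continuous_on (cball x r) (partial_deriv b f)"
      using f sub by (auto simp: C1_on_def intro: continuous_on_subset)
    then show "integrable uball (\<lambda>z. partial_deriv b f (x + r *\<^sub>R z) * (z \<bullet> b))"
      using r by (intro integrable_uball_continuous continuous_intros continuous_on_ball_arg) auto
  qed
  finally show ?thesis .
qed

text \<open>Differentiation under the integral gives the integral of \<open>z . grad h\<close>. As
  \<open>- z\<close> is the gradient of \<open>(1 - |z|^2) / 2\<close>, a coordinatewise integration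
  by parts passes to second derivatives without a boundary term; the factor \<open>r\<close> is from
  the chain rule in \<open>x + r z\<close>.\<close>

lemma has_real_derivative_ball_int:
  fixes h :: "'a::euclidean_space \<Rightarrow> real"
  assumes h: "C2_on h S" and S: "open S" and sub: "cball x R \<subseteq> S" and r: "0 < r" "r < R"
  shows "(ball_int h x has_real_derivative r / 2 * weighted_int (laplacian h) x r) (at r)"
proof -
  have h1: "C1_on h S" and h2: "\<And>b. b \<in> Basis \<Longrightarrow> C1_on (partial_deriv b h) S"
    using h by (auto simp: C2_on_def)
  obtain K where K: "K \<ge> 0" "\<And>y v. y \<in> cball x R \<Longrightarrow> \<bar>frechet_derivative h (at y) v\<bar> \<le> K * norm v"
    using C1_on_derivative_bound[OF h1 sub] by metis
  have inball: "x + s *\<^sub>R z \<in> cball x R" if "0 \<le> s" "s \<le> R" "norm z \<le> 1" for s z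
    using mult_mono[of s R "norm z" 1] that by (auto simp: dist_norm)
  have contR: "continuous_on (cball x R) h"
    using C1_on_continuous_on[OF h1] sub by (rule continuous_on_subset)
  have subr: "cball x r \<subseteq> S" using sub r by auto
  have "((\<lambda>s. LINT z|uball. h (x + s *\<^sub>R z)) has_real_derivative
      (LINT z|uball. frechet_derivative h (at (x + r *\<^sub>R z)) z)) (at r)"
  proof (rule uball.has_real_derivative_integral[where a=0 and b=R and K=K and f="\<lambda>z s. h (x + s *\<^sub>R z)" and f'="\<lambda>z s. frechet_derivative h (at (x + s *\<^sub>R z)) z"])
    fix z :: 'a and s assume z: "z \<in> space uball" and s: "s \<in> {0<..<R}"
    then have in1: "x + s *\<^sub>R z \<in> cball x R" by (intro inball) auto
    then show "((\<lambda>s. h (x + s *\<^sub>R z)) has_real_derivative frechet_derivative h (at (x + s *\<^sub>R z)) z) (at s)"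
      using sub by (intro has_real_derivative_along_ray[OF h1]) auto
    have "\<bar>frechet_derivative h (at (x + s *\<^sub>R z)) z\<bar> \<le> K * norm z" by (rule K(2)[OF in1])
    also have "\<dots> \<le> K" using z K(1) by (auto intro: mult_left_le)
    finally show "\<bar>frechet_derivative h (at (x + s *\<^sub>R z)) z\<bar> \<le> K" .
  next
    fix s assume "s \<in> {0<..<R}"
    then show "integrable uball (\<lambda>z. h (x + s *\<^sub>R z))"
      by (intro integrable_uball_continuous continuous_on_ball_arg[OF contR]) auto
  qed (use r in auto)
  also have "(LINT z|uball. frechet_derivative h (at (x + r *\<^sub>R z)) z) =
      (\<Sum>b\<in>Basis. LINT z|uball. partial_deriv b h (x + r *\<^sub>R z) * (z \<bullet> b))"
    using r by (intro integral_uball_frechet_derivative[OF h1 subr]) auto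
  also have "\<dots> = (\<Sum>b\<in>Basis. r / 2 * (LINT z|uball. (1 - (norm z)\<^sup>2) * partial_deriv b (partial_deriv b h) (x + r *\<^sub>R z)))"
  proof (rule sum.cong)
    fix b :: 'a assume b: "b \<in> Basis"
    let ?g = "partial_deriv b h"
    obtain L where L: "L \<ge> 0" "\<And>y z. y \<in> cball x r \<Longrightarrow> z \<in> cball x r \<Longrightarrow> \<bar>?g y - ?g z\<bar> \<le> L * norm (y - z)"
      using C1_on_Lipschitz[OF h2[OF b] subr] by metis
    have inr: "x + r *\<^sub>R z \<in> cball x r" if "norm z \<le> 1" for z
      using mult_left_le[of "norm z" r] that r by (auto simp: dist_norm)
    have "(LINT z|uball. (1 - (norm z)\<^sup>2) * frechet_derivative ?g (at (x + r *\<^sub>R z)) (r *\<^sub>R b)) =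
      2 * (LINT z|uball. ?g (x + r *\<^sub>R z) * (z \<bullet> b))"
    proof (rule integral_uball_by_parts[where L="L * r" and g="\<lambda>z. ?g (x + r *\<^sub>R z)" and g'="\<lambda>z v. frechet_derivative ?g (at (x + r *\<^sub>R z)) (r *\<^sub>R v)"])
      fix y z :: 'a assume "y \<in> cball 0 1" "z \<in> cball 0 1"
      then have "\<bar>?g (x + r *\<^sub>R y) - ?g (x + r *\<^sub>R z)\<bar> \<le> L * norm ((x + r *\<^sub>R y) - (x + r *\<^sub>R z))"
        by (intro L(2) inr) auto
      also have "(x + r *\<^sub>R y) - (x + r *\<^sub>R z) = r *\<^sub>R (y - z)" by (simp add: algebra_simps)
      finally show "\<bar>?g (x + r *\<^sub>R y) - ?g (x + r *\<^sub>R z)\<bar> \<le> L * r * norm (y - z)"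
        using r by simp
    next
      fix z :: 'a assume "z \<in> ball 0 1"
      then have "x + r *\<^sub>R z \<in> S" using inr[of z] subr by auto
      then have "(?g has_derivative frechet_derivative ?g (at (x + r *\<^sub>R z))) (at (x + r *\<^sub>R z))"
        by (rule C1_on_has_derivative[OF h2[OF b]])
      then show "((\<lambda>z. ?g (x + r *\<^sub>R z)) has_derivative (\<lambda>v. frechet_derivative ?g (at (x + r *\<^sub>R z)) (r *\<^sub>R v))) (at z)"
        by (rule has_derivative_compose[rotated]) (auto intro!: derivative_eq_intros)
    qed
    also have "(LINT z|uball. (1 - (norm z)\<^sup>2) * frechet_derivative ?g (at (x + r *\<^sub>R z)) (r *\<^sub>R b)) =
      (LINT z|uball. r * ((1 - (norm z)\<^sup>2) * partial_deriv b ?g (x + r *\<^sub>R z)))"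
    proof (rule Bochner_Integration.integral_cong)
      fix z :: 'a assume "z \<in> space uball"
      then have "x + r *\<^sub>R z \<in> S" using inr[of z] subr by auto
      then have "linear (frechet_derivative ?g (at (x + r *\<^sub>R z)))"
        using h2[OF b] by (auto simp: C1_on_def intro: linear_frechet_derivative)
      then show "(1 - (norm z)\<^sup>2) * frechet_derivative ?g (at (x + r *\<^sub>R z)) (r *\<^sub>R b) =
          r * ((1 - (norm z)\<^sup>2) * partial_deriv b ?g (x + r *\<^sub>R z))"
        by (simp add: linear_scale partial_deriv_def)
    qed simp
    finally show "(LINT z|uball. ?g (x + r *\<^sub>R z) * (z \<bullet> b)) =
      r / 2 * (LINT z|uball. (1 - (norm z)\<^sup>2) * partial_deriv b ?g (x + r *\<^sub>R z))"
      by simp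
  qed simp
  also have "\<dots> = r / 2 * weighted_int (laplacian h) x r"
  proof -
    have "(LINT z|uball. (\<Sum>b\<in>Basis. (1 - (norm z)\<^sup>2) * partial_deriv b (partial_deriv b h) (x + r *\<^sub>R z))) =
      (\<Sum>b\<in>Basis. LINT z|uball. (1 - (norm z)\<^sup>2) * partial_deriv b (partial_deriv b h) (x + r *\<^sub>R z))"
    proof (rule Bochner_Integration.integral_sum)
      fix b :: 'a assume b: "b \<in> Basis"
      have "continuous_on (cball x r) (partial_deriv b (partial_deriv b h))"
        using h2[OF b] b subr by (auto simp: C1_on_def intro: continuous_on_subset)
      then show "integrable uball (\<lambda>z. (1 - (norm z)\<^sup>2) * partial_deriv b (partial_deriv b h) (x + r *\<^sub>R z))"
        using r by (intro integrable_uball_continuous continuous_intros continuous_on_ball_arg) auto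
    qed
    then show ?thesis
      by (simp add: weighted_int_def laplacian_def sum_distrib_left)
  qed
  finally show ?thesis
    by (simp add: ball_int_def[abs_def])
qed

text \<open>One statement for three limits: \<open>\<phi>\<close> is the identity or
  \<open>sgn\<close>, and \<open>w\<close> is \<open>1\<close> or the weight
  \<open>1 - |z|^2\<close>. Continuity at \<open>x\<close> decides, because
  \<open>x + r \<phi> z\<close> stays within \<open>r\<close> of \<open>x\<close>.\<close>

lemma tendsto_integral_uball:
  fixes f w :: "'a::euclidean_space \<Rightarrow> real" and \<phi> :: "'a \<Rightarrow> 'a"
  assumes R: "R > 0" and f: "continuous_on (cball x R) f"
    and \<phi>: "\<And>z. norm z < 1 \<Longrightarrow> norm (\<phi> z) \<le> 1"
    and w: "integrable uball w" "\<And>z. norm z < 1 \<Longrightarrow> \<bar>w z\<bar> \<le> 1"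
    and int: "\<And>r. 0 < r \<Longrightarrow> r < R \<Longrightarrow> integrable uball (\<lambda>z. w z * f (x + r *\<^sub>R \<phi> z))"
  shows "((\<lambda>r. LINT z|uball. w z * f (x + r *\<^sub>R \<phi> z)) \<longlongrightarrow> f x * (LINT z|uball. w z)) (at_right 0)"
proof (rule tendstoI)
  fix e :: real assume e: "e > 0"
  define e' where "e' = e / (2 * uvol TYPE('a))"
  have e': "e' > 0" using e uvol_pos[where 'a='a] by (simp add: e'_def)
  obtain d where d: "d > 0" "\<And>y. y \<in> cball x R \<Longrightarrow> dist y x < d \<Longrightarrow> dist (f y) (f x) < e'"
    using f R e' unfolding continuous_on_iff by (metis centre_in_cball less_imp_le)
  have "eventually (\<lambda>r. r \<in> {0<..<min d R}) (at_right 0)"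
    using d R by (intro eventually_at_right_real) auto
  then show "eventually (\<lambda>r. dist (LINT z|uball. w z * f (x + r *\<^sub>R \<phi> z)) (f x * (LINT z|uball. w z)) < e) (at_right 0)"
  proof eventually_elim
    fix r assume r: "r \<in> {0<..<min d R}"
    have iw: "integrable uball (\<lambda>z. f x * w z)" using w(1) by simp
    have "(LINT z|uball. w z * f (x + r *\<^sub>R \<phi> z)) - f x * (LINT z|uball. w z) =
      (LINT z|uball. w z * f (x + r *\<^sub>R \<phi> z)) - (LINT z|uball. f x * w z)" by simp
    also have "\<dots> = (LINT z|uball. w z * f (x + r *\<^sub>R \<phi> z) - f x * w z)"
      using int[of r] r iw by (intro Bochner_Integration.integral_diff[symmetric]) auto
    finally have eq: "(LINT z|uball. w z * f (x + r *\<^sub>R \<phi> z)) - f x * (LINT z|uball. w z) = \<dots>" .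
    have iF: "integrable uball (\<lambda>z. w z * f (x + r *\<^sub>R \<phi> z) - f x * w z)"
      using int[of r] r iw by auto
    have "norm (LINT z|uball. w z * f (x + r *\<^sub>R \<phi> z) - f x * w z)
        \<le> (LINT z|uball. norm (w z * f (x + r *\<^sub>R \<phi> z) - f x * w z))"
      by (rule integral_norm_bound)
    also have "\<dots> \<le> (LINT z|(uball::'a measure). e')"
    proof (rule integral_mono)
      show "integrable uball (\<lambda>z. norm (w z * f (x + r *\<^sub>R \<phi> z) - f x * w z))"
        using iF by (rule integrable_norm)
      fix z :: 'a assume "z \<in> space uball"
      then have z: "norm z < 1" by simp
      have "r * norm (\<phi> z) \<le> r" using \<phi>[OF z] r by (auto intro: mult_left_le)
      moreover have "r < d" "r < R" using r by auto
      ultimately have "r * norm (\<phi> z) \<le> R" "r * norm (\<phi> z) < d" by linarith+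
      then have "dist (f (x + r *\<^sub>R \<phi> z)) (f x) < e'"
        using r by (intro d(2)) (auto simp: dist_norm)
      then have "\<bar>w z\<bar> * \<bar>f (x + r *\<^sub>R \<phi> z) - f x\<bar> \<le> 1 * e'"
        using w(2)[OF z] e' by (intro mult_mono) (auto simp: dist_real_def)
      then show "norm (w z * f (x + r *\<^sub>R \<phi> z) - f x * w z) \<le> e'"
        by (simp add: abs_mult[symmetric] algebra_simps)
    qed auto
    also have "\<dots> = e / 2" using uvol_pos[where 'a='a] by (simp add: e'_def)
    also have "\<dots> < e" using e by simp
    finally show "dist (LINT z|uball. w z * f (x + r *\<^sub>R \<phi> z)) (f x * (LINT z|uball. w z)) < e"
      by (simp add: dist_real_def eq)
  qed
qed

lemma tendsto_ball_int:
  fixes f :: "'a::euclidean_space \<Rightarrow> real"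
  assumes "R > 0" "continuous_on (cball x R) f"
  shows "(ball_int f x \<longlongrightarrow> uvol TYPE('a) * f x) (at_right 0)"
  using tendsto_integral_uball[OF assms, of "\<lambda>z. z" "\<lambda>_. 1"]
    integrable_uball_continuous[OF continuous_on_ball_arg[OF assms(2)]]
  by (simp add: ball_int_def[abs_def] mult.commute)

lemma integrable_sphere_int:
  fixes f :: "'a::euclidean_space \<Rightarrow> real"
  assumes "continuous_on (cball x R) f" "0 \<le> r" "r \<le> R"
  shows "integrable uball (\<lambda>z. f (x + r *\<^sub>R sgn z))"
  by (rule integrable_uball_sgn[OF continuous_on_ball_arg[OF assms]])

lemma tendsto_sphere_int:
  fixes f :: "'a::euclidean_space \<Rightarrow> real"
  assumes "R > 0" "continuous_on (cball x R) f"
  shows "(sphere_int f x \<longlongrightarrow> uvol TYPE('a) * f x) (at_right 0)"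
  using tendsto_integral_uball[OF assms, of sgn "\<lambda>_. 1"] integrable_sphere_int[OF assms(2)]
  by (simp add: sphere_int_def[abs_def] mult.commute norm_sgn_le)

lemma tendsto_weighted_int:
  fixes f :: "'a::euclidean_space \<Rightarrow> real"
  assumes "R > 0" "continuous_on (cball x R) f"
  shows "(weighted_int f x \<longlongrightarrow> f x * (LINT z|(uball::'a measure). 1 - (norm z)\<^sup>2)) (at_right 0)"
proof -
  have "((\<lambda>r. LINT z|uball. (1 - (norm z)\<^sup>2) * f (x + r *\<^sub>R z)) \<longlongrightarrow> f x * (LINT z|(uball::'a measure). 1 - (norm z)\<^sup>2)) (at_right 0)"
  proof (rule tendsto_integral_uball[OF assms])
    show "integrable (uball::'a measure) (\<lambda>z. 1 - (norm z)\<^sup>2)"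
      by (intro integrable_uball_continuous continuous_intros)
    show "\<bar>1 - (norm z)\<^sup>2\<bar> \<le> 1" if "norm z < 1" for z :: 'a
      using that power_le_one[of "norm z" 2] by (auto simp: abs_le_iff)
    show "integrable uball (\<lambda>z. (1 - (norm z)\<^sup>2) * f (x + r *\<^sub>R z))" if "0 < r" "r < R" for r
      using that by (intro integrable_uball_continuous continuous_intros continuous_on_ball_arg[OF assms(2)]) auto
  qed auto
  then show ?thesis by (simp add: weighted_int_def[abs_def])
qed

section \<open>The constant in the second-order expansion of ball means\<close>

lemma partial_deriv_inner_self: "partial_deriv b (\<lambda>z::'a::euclidean_space. z \<bullet> z) = (\<lambda>z. 2 * (z \<bullet> b))"
proof
  fix x :: 'a
  have "((\<lambda>z. z \<bullet> z) has_derivative (\<lambda>h. 2 * (x \<bullet> h))) (at x)"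
    by (auto intro!: derivative_eq_intros simp: inner_commute)
  then show "partial_deriv b (\<lambda>z. z \<bullet> z) x = 2 * (x \<bullet> b)"
    by (rule partial_deriv_eqI)
qed

lemma partial_deriv_double_inner: "partial_deriv b (\<lambda>z::'a::euclidean_space. 2 * (z \<bullet> c)) = (\<lambda>z. 2 * (b \<bullet> c))"
proof
  fix x :: 'a
  have "((\<lambda>z. 2 * (z \<bullet> c)) has_derivative (\<lambda>h. 2 * (h \<bullet> c))) (at x)"
    by (auto intro!: derivative_eq_intros)
  then show "partial_deriv b (\<lambda>z. 2 * (z \<bullet> c)) x = 2 * (b \<bullet> c)"
    by (rule partial_deriv_eqI)
qed

lemma C2_on_inner_self: "C2_on (\<lambda>z::'a::euclidean_space. z \<bullet> z) S"
proof -
  have d: "(\<lambda>z::'a. z \<bullet> z) differentiable (at x)" "(\<lambda>z::'a. 2 * (z \<bullet> c)) differentiable (at x)" for x c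
    by (auto intro!: derivative_intros bounded_linear_imp_differentiable bounded_linear_inner_left simp: differentiable_inner)
  show ?thesis unfolding C2_on_def C1_on_def partial_deriv_inner_self partial_deriv_double_inner
    using d by (auto intro!: continuous_intros)
qed

lemma laplacian_inner_self: "laplacian (\<lambda>z::'a::euclidean_space. z \<bullet> z) x = 2 * real DIM('a)"
  by (simp add: laplacian_def partial_deriv_inner_self partial_deriv_double_inner inner_same_Basis)

text \<open>The derivative formula is tested on \<open>|z|^2\<close>, whose ball integral is
  \<open>r^2 a\<close> and whose Laplacian is \<open>2 m\<close>. This gives
  \<open>2 a = m w\<close>, and \<open>w = uvol - a\<close> closes the system. The radius
  \<open>1 / 2\<close> is an arbitrary point of \<open>(0, 1)\<close>.\<close>

lemma integral_uball_weight:
  "(LINT z|(uball::'a::euclidean_space measure). 1 - (norm z)\<^sup>2) = 2 * uvol TYPE('a) / (real DIM('a) + 2)"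
proof -
  define w where "w = (LINT z|(uball::'a measure). 1 - (norm z)\<^sup>2)"
  define a where "a = (LINT z|(uball::'a measure). (norm z)\<^sup>2)"
  have "integrable (uball::'a measure) (\<lambda>z. (norm z)\<^sup>2)"
    by (intro integrable_uball_continuous continuous_intros)
  then have w: "w = uvol TYPE('a) - a"
    by (simp add: w_def a_def)
  have "(ball_int (\<lambda>z::'a. z \<bullet> z) 0 has_real_derivative (1 / 2) / 2 * weighted_int (laplacian (\<lambda>z. z \<bullet> z)) (0::'a) (1/2)) (at (1/2))"
    by (rule has_real_derivative_ball_int[of _ UNIV _ 1]) (auto simp: C2_on_inner_self)
  moreover have "ball_int (\<lambda>z::'a. z \<bullet> z) 0 = (\<lambda>r. r\<^sup>2 * a)"
  proof
    fix r
    show "ball_int (\<lambda>z::'a. z \<bullet> z) 0 r = r\<^sup>2 * a"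
      unfolding ball_int_def a_def power2_norm_eq_inner by (simp add: power2_eq_square mult.assoc)
  qed
  moreover have "((\<lambda>r. r\<^sup>2 * a) has_real_derivative a) (at (1/2))"
    by (auto intro!: derivative_eq_intros)
  moreover have "weighted_int (laplacian (\<lambda>z. z \<bullet> z)) (0::'a) (1/2) = 2 * real DIM('a) * w"
    by (simp add: weighted_int_def laplacian_inner_self w_def mult.commute)
  ultimately have "2 * a = real DIM('a) * w"
    using DERIV_unique by fastforce
  with w have "w * (real DIM('a) + 2) = 2 * uvol TYPE('a)" by (simp add: algebra_simps)
  then show ?thesis unfolding w_def[symmetric] by (simp add: eq_divide_eq)
qed

text \<open>L'Hopital's rule gives the defect the limit \<open>w / 4\<close> times the Laplacian,
  where \<open>w = 2 uvol / (m + 2)\<close> is the integral of the weight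
  \<open>1 - |z|^2\<close>.\<close>

abbreviation mean_const :: "'a::euclidean_space itself \<Rightarrow> real" where
  "mean_const (_::'a itself) \<equiv> uvol TYPE('a) / (2 * (real DIM('a) + 2))"

lemma C2_on_continuous_laplacian:
  "C2_on h S \<Longrightarrow> continuous_on S (laplacian h)"
  unfolding laplacian_def[abs_def] C2_on_def C1_on_def by (auto intro!: continuous_on_sum)

text \<open>The derivative of the ball integral already carries a factor \<open>r\<close> and the
  weighted Laplacian, so one use of L'Hopital's rule against \<open>r^2\<close> leaves a limit known
  by continuity; no Taylor expansion is involved.\<close>

lemma tendsto_ball_int_laplacian:
  fixes h :: "'a::euclidean_space \<Rightarrow> real"
  assumes h: "C2_on h S" and S: "open S" and x: "x \<in> S"
  shows "((\<lambda>r. (ball_int h x r - uvol TYPE('a) * h x) / r\<^sup>2) \<longlongrightarrow> mean_const TYPE('a) * laplacian h x) (at_right 0)"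
proof -
  obtain R where R: "R > 0" "cball x R \<subseteq> S"
    using S x open_contains_cball by blast
  have cont: "continuous_on (cball x R) h"
    using h R C1_on_continuous_on[of h S] unfolding C2_on_def by (blast intro: continuous_on_subset)
  have contL: "continuous_on (cball x R) (laplacian h)"
    using C2_on_continuous_laplacian[OF h] R by (blast intro: continuous_on_subset)
  have evR: "eventually (\<lambda>r. r \<in> {0<..<R}) (at_right 0)"
    using R by (intro eventually_at_right_real) auto
  show ?thesis
  proof (rule lhopital_right_0[where f'="\<lambda>r. r / 2 * weighted_int (laplacian h) x r" and g'="\<lambda>r. 2 * r"])
    have "((\<lambda>r. ball_int h x r - uvol TYPE('a) * h x) \<longlongrightarrow> uvol TYPE('a) * h x - uvol TYPE('a) * h x) (at_right 0)"
      by (intro tendsto_intros tendsto_ball_int[OF R(1) cont])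
    then show "((\<lambda>r. ball_int h x r - uvol TYPE('a) * h x) \<longlongrightarrow> 0) (at_right 0)" by simp
    show "((\<lambda>r. r\<^sup>2) \<longlongrightarrow> (0::real)) (at_right 0)"
      by (auto intro!: tendsto_eq_intros)
    show "\<forall>\<^sub>F r in at_right 0. r\<^sup>2 \<noteq> (0::real)" "\<forall>\<^sub>F r in at_right 0. 2 * r \<noteq> (0::real)"
      using evR by (eventually_elim, simp)+
    show "\<forall>\<^sub>F r in at_right 0. ((\<lambda>r. ball_int h x r - uvol TYPE('a) * h x) has_real_derivative r / 2 * weighted_int (laplacian h) x r) (at r)"
      using evR by eventually_elim (auto intro!: derivative_eq_intros has_real_derivative_ball_int[OF h S R(2)])
    show "\<forall>\<^sub>F r in at_right 0. ((\<lambda>r. r\<^sup>2) has_real_derivative 2 * r) (at r)"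
      by (auto intro!: derivative_eq_intros always_eventually)
    have lim: "((\<lambda>r. weighted_int (laplacian h) x r / 4) \<longlongrightarrow> laplacian h x * (LINT z|(uball::'a measure). 1 - (norm z)\<^sup>2) / 4) (at_right 0)"
      by (intro tendsto_divide tendsto_weighted_int[OF R(1) contL] tendsto_const) simp
    have eq: "laplacian h x * (LINT z|(uball::'a measure). 1 - (norm z)\<^sup>2) / 4 = mean_const TYPE('a) * laplacian h x"
      unfolding integral_uball_weight by (simp add: field_simps)
    have "\<forall>\<^sub>F r in at_right 0. weighted_int (laplacian h) x r / 4 = (r / 2 * weighted_int (laplacian h) x r) / (2 * r)"
      using evR by eventually_elim simp
    then show "((\<lambda>r. (r / 2 * weighted_int (laplacian h) x r) / (2 * r)) \<longlongrightarrow> mean_const TYPE('a) * laplacian h x) (at_right 0)"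
      by (rule Lim_transform_eventually[OF lim[unfolded eq]])
  qed
qed

text \<open>The polar-coordinate derivative speaks of functions continuous on the whole space; the
  nearest-point projection of the closed ball supplies one that agrees with \<open>u\<close> there,
  recentred at the origin.\<close>

lemma continuous_on_cball_extend:
  fixes u :: "'a::euclidean_space \<Rightarrow> real"
  assumes "continuous_on (cball x R) u" "R > 0"
  obtains g where "continuous_on UNIV g" "\<And>z. norm z \<le> R \<Longrightarrow> g z = u (x + z)"
proof
  show "continuous_on UNIV (\<lambda>z. u (closest_point (cball x R) (x + z)))"
  proof (rule continuous_on_compose2[OF assms(1)])
    show "continuous_on UNIV (\<lambda>z. closest_point (cball x R) (x + z))"
      using assms by (intro continuous_on_compose2[OF continuous_on_closest_point[of "cball x R" UNIV]] continuous_intros) auto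
    show "(\<lambda>z. closest_point (cball x R) (x + z)) ` UNIV \<subseteq> cball x R"
    proof clarify
      fix z show "closest_point (cball x R) (x + z) \<in> cball x R"
        using assms closest_point_in_set[of "cball x R" "x + z"] by auto
    qed
  qed
  show "u (closest_point (cball x R) (x + z)) = u (x + z)" if "norm z \<le> R" for z
    using that by (subst closest_point_self) (auto simp: dist_norm)
qed

text \<open>\<open>t ^ m * ball_int g x t\<close> is the unnormalised integral over the ball of
  radius \<open>t\<close>, and its rate of growth is an integral over the boundary sphere. This
  links the two kinds of means for functions that are merely continuous.\<close>

lemma has_real_derivative_power_ball_int:
  fixes g :: "'a::euclidean_space \<Rightarrow> real"
  assumes g: "continuous_on UNIV g" and s: "s > 0"
  shows "((\<lambda>t. t ^ DIM('a) * ball_int g x t) has_real_derivative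
    real DIM('a) * s ^ (DIM('a) - 1) * sphere_int g x s) (at s)"
proof -
  let ?g = "\<lambda>z. g (x + z)"
  have cont: "continuous_on UNIV ?g"
    by (intro continuous_on_compose2[OF g] continuous_intros) auto
  then have m: "?g \<in> borel_measurable borel" by (rule borel_measurable_continuous_onI)
  have "((\<lambda>t. LINT z:ball 0 t|lborel. ?g z) has_real_derivative
    real DIM('a) * s ^ (DIM('a) - 1) * sphere_int ?g 0 s) (at s)"
    by (rule has_real_derivative_ball_integral[OF cont s])
  then have "((\<lambda>t. LINT z:ball 0 t|lborel. ?g z) has_real_derivative
    real DIM('a) * s ^ (DIM('a) - 1) * sphere_int g x s) (at s)"
    by (simp add: sphere_int_def)
  then show ?thesis
  proof (rule has_field_derivative_transform_within_open[where S="{0<..}"])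
    fix t :: real assume "t \<in> {0<..}"
    then have "(LINT z:ball 0 t|lborel. ?g z) = t ^ DIM('a) * ball_int ?g 0 t"
      using m by (intro set_integral_ball_scale) (auto simp: set_borel_measurable_def intro!: borel_measurable_times borel_measurable_indicator)
    then show "(LINT z:ball 0 t|lborel. ?g z) = t ^ DIM('a) * ball_int g x t"
      by (simp add: ball_int_def)
  qed (use s in auto)
qed

section \<open>Flux and the radial derivative of the spherical mean\<close>

lemma continuous_on_normal_derivative:
  fixes u :: "'a::euclidean_space \<Rightarrow> real"
  assumes u: "C1_on u D" and sub: "cball x r \<subseteq> D"
  shows "continuous_on (sphere x r) (\<lambda>y. frechet_derivative u (at y) ((y - x) /\<^sub>R r))"
proof -
  have s: "sphere x r \<subseteq> D" using sub by auto
  have "continuous_on (sphere x r) (\<lambda>y. \<Sum>b\<in>Basis. (((y - x) /\<^sub>R r) \<bullet> b) * partial_deriv b u y)"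
    using u s by (auto simp: C1_on_def intro!: continuous_intros intro: continuous_on_subset)
  then show ?thesis
  proof (rule continuous_on_eq)
    fix y assume "y \<in> sphere x r"
    then have "u differentiable (at y)" using u s by (auto simp: C1_on_def)
    then show "(\<Sum>b\<in>Basis. (((y - x) /\<^sub>R r) \<bullet> b) * partial_deriv b u y) = frechet_derivative u (at y) ((y - x) /\<^sub>R r)"
      by (rule frechet_derivative_eq_sum_partial[symmetric])
  qed
qed

text \<open>As \<open>r\<close> grows, the point \<open>x + r sgn z\<close> moves along its own
  exterior normal, so the integrand changes at the rate of the normal derivative. The divergence
  theorem, which would ask for second derivatives, does not enter.\<close>

lemma has_real_derivative_sphere_int:
  fixes u :: "'a::euclidean_space \<Rightarrow> real"
  assumes u: "C1_on u D" and sub: "cball x R \<subseteq> D" and r: "0 < r" "r < R"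
  shows "(sphere_int u x has_real_derivative uvol TYPE('a) * mean_flux u x r) (at r)"
proof -
  obtain K where K: "K \<ge> 0" "\<And>y v. y \<in> cball x R \<Longrightarrow> \<bar>frechet_derivative u (at y) v\<bar> \<le> K * norm v"
    using C1_on_derivative_bound[OF u sub] by metis
  have cont: "continuous_on (cball x R) u"
    using C1_on_continuous_on[OF u] sub by (rule continuous_on_subset)
  have subr: "cball x r \<subseteq> D" using sub r by auto
  have "((\<lambda>s. LINT z|uball. u (x + s *\<^sub>R sgn z)) has_real_derivative
      (LINT z|uball. frechet_derivative u (at (x + r *\<^sub>R sgn z)) (sgn z))) (at r)"
  proof (rule uball.has_real_derivative_integral[where a=0 and b=R and K=K and f="\<lambda>z s. u (x + s *\<^sub>R sgn z)" and f'="\<lambda>z s. frechet_derivative u (at (x + s *\<^sub>R sgn z)) (sgn z)"])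
    fix z :: 'a and s assume s: "s \<in> {0<..<R}"
    then have in1: "x + s *\<^sub>R sgn z \<in> cball x R" by (auto simp: dist_norm norm_sgn)
    then show "((\<lambda>s. u (x + s *\<^sub>R sgn z)) has_real_derivative frechet_derivative u (at (x + s *\<^sub>R sgn z)) (sgn z)) (at s)"
      using sub by (intro has_real_derivative_along_ray[OF u]) auto
    have "\<bar>frechet_derivative u (at (x + s *\<^sub>R sgn z)) (sgn z)\<bar> \<le> K * norm (sgn z)" by (rule K(2)[OF in1])
    also have "\<dots> \<le> K" using K(1) by (simp add: norm_sgn)
    finally show "\<bar>frechet_derivative u (at (x + s *\<^sub>R sgn z)) (sgn z)\<bar> \<le> K" .
  next
    fix s assume "s \<in> {0<..<R}"
    then show "integrable uball (\<lambda>z. u (x + s *\<^sub>R sgn z))"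
      by (intro integrable_sphere_int[OF cont]) auto
  qed (use r in auto)
  moreover have "uvol TYPE('a) * mean_flux u x r = (LINT z|uball. frechet_derivative u (at (x + r *\<^sub>R sgn z)) (sgn z))"
    unfolding mean_flux_eq[OF r(1) continuous_on_normal_derivative[OF u subr]]
    using uvol_pos[where 'a='a] by (intro nonzero_mult_div_cancel_left[of "uvol TYPE('a)", unfolded times_divide_eq_right[symmetric]]) auto
  ultimately show ?thesis unfolding sphere_int_def[abs_def] by (simp only:)
qed

text \<open>With \<open>u\<close> only \<open>C1\<close>, the limit comes from the flux identity in
  two steps. The spherical defect has derivative \<open>- lam^2 r ball_int / m\<close>, hence limit
  \<open>- lam^2 uvol u / (2 m)\<close> after division by \<open>r^2\<close>; passing from spheres
  to balls multiplies this by \<open>m / (m + 2)\<close>. The product carries the same constant as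
  in the smooth case.\<close>

lemma tendsto_ball_int_of_flux:
  fixes u :: "'a::euclidean_space \<Rightarrow> real"
  assumes u: "C1_on u D" and R: "R > 0" and sub: "cball x R \<subseteq> D"
    and flux: "\<And>r. 0 < r \<Longrightarrow> r \<le> R \<Longrightarrow> real DIM('a) * mean_flux u x r = - (lam\<^sup>2) * r * ball_mean u x r"
  shows "((\<lambda>r. (ball_int u x r - uvol TYPE('a) * u x) / r\<^sup>2) \<longlongrightarrow> mean_const TYPE('a) * (- (lam\<^sup>2) * u x)) (at_right 0)"
proof -
  let ?m = "real DIM('a)" and ?V = "uvol TYPE('a)"
  have V: "?V > 0" by (rule uvol_pos)
  have cont: "continuous_on (cball x R) u"
    using C1_on_continuous_on[OF u] sub by (rule continuous_on_subset)
  have evR: "eventually (\<lambda>r. r \<in> {0<..<R}) (at_right 0)"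
    using R by (intro eventually_at_right_real) auto
  have F: "?V * mean_flux u x r = - (lam\<^sup>2) * r * ball_int u x r / ?m" if "0 < r" "r < R" for r
  proof -
    have "continuous_on (ball x r) u"
      using that by (intro continuous_on_subset[OF cont]) auto
    then have A: "ball_int u x r = ?V * ball_mean u x r"
      using that by (simp add: ball_mean_eq)
    have "?V * mean_flux u x r = ?V * (?m * mean_flux u x r) / ?m" by simp
    also have "\<dots> = - (lam\<^sup>2) * r * ball_int u x r / ?m"
      using flux[of r] that by (simp add: A mult_ac)
    finally show ?thesis .
  qed
  have sph: "((\<lambda>r. (sphere_int u x r - ?V * u x) / r\<^sup>2) \<longlongrightarrow> - (lam\<^sup>2) * (?V * u x) / (2 * ?m)) (at_right 0)"
  proof (rule lhopital_right_0[where f'="\<lambda>r. ?V * mean_flux u x r" and g'="\<lambda>r. 2 * r"])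
    have "((\<lambda>r. sphere_int u x r - ?V * u x) \<longlongrightarrow> ?V * u x - ?V * u x) (at_right 0)"
      by (intro tendsto_intros tendsto_sphere_int[OF R(1) cont])
    then show "((\<lambda>r. sphere_int u x r - ?V * u x) \<longlongrightarrow> 0) (at_right 0)" by simp
    show "((\<lambda>r. r\<^sup>2) \<longlongrightarrow> (0::real)) (at_right 0)"
      by (auto intro!: tendsto_eq_intros)
    show "\<forall>\<^sub>F r in at_right 0. r\<^sup>2 \<noteq> (0::real)" "\<forall>\<^sub>F r in at_right 0. 2 * r \<noteq> (0::real)"
      using evR by (eventually_elim, simp)+
    show "\<forall>\<^sub>F r in at_right 0. ((\<lambda>r. sphere_int u x r - ?V * u x) has_real_derivative ?V * mean_flux u x r) (at r)"
      using evR by eventually_elim (auto intro!: derivative_eq_intros has_real_derivative_sphere_int[OF u sub])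
    show "\<forall>\<^sub>F r in at_right 0. ((\<lambda>r. r\<^sup>2) has_real_derivative 2 * r) (at r)"
      by (auto intro!: derivative_eq_intros always_eventually)
    have "((\<lambda>r. - (lam\<^sup>2) * ball_int u x r / (2 * ?m)) \<longlongrightarrow> - (lam\<^sup>2) * (?V * u x) / (2 * ?m)) (at_right 0)"
      by (intro tendsto_intros tendsto_ball_int[OF R cont]) auto
    moreover have "\<forall>\<^sub>F r in at_right 0. - (lam\<^sup>2) * ball_int u x r / (2 * ?m) = (?V * mean_flux u x r) / (2 * r)"
      using evR by eventually_elim (subst F, auto)
    ultimately show "((\<lambda>r. (?V * mean_flux u x r) / (2 * r)) \<longlongrightarrow> - (lam\<^sup>2) * (?V * u x) / (2 * ?m)) (at_right 0)"
      by (rule Lim_transform_eventually)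
  qed
  obtain g where g: "continuous_on UNIV g" "\<And>z. norm z \<le> R \<Longrightarrow> g z = u (x + z)"
    using continuous_on_cball_extend[OF cont R] by metis
  have gb: "ball_int g 0 r = ball_int u x r" and gs: "sphere_int g 0 r = sphere_int u x r" if "r \<in> {0<..<R}" for r
  proof -
    have "norm (r *\<^sub>R z) \<le> R" if "z \<in> ball 0 1" for z :: 'a
      using mult_mono[of r R "norm z" 1] that \<open>r \<in> {0<..<R}\<close> by auto
    then show "ball_int g 0 r = ball_int u x r"
      unfolding ball_int_def by (intro Bochner_Integration.integral_cong) (auto simp: g(2))
    show "sphere_int g 0 r = sphere_int u x r"
      unfolding sphere_int_def using that by (intro Bochner_Integration.integral_cong) (auto simp: g(2) norm_sgn)
  qed
  \<comment> \<open>Multiplied through by \<open>r ^ m\<close>, the ball defect has the spherical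
    defect in its derivative, and the derivative of \<open>r ^ (m + 2)\<close> supplies the
    denominator \<open>m + 2\<close>.\<close>
  have "((\<lambda>r. (r ^ DIM('a) * ball_int g 0 r - r ^ DIM('a) * (?V * u x)) / r ^ (DIM('a) + 2)) \<longlongrightarrow> mean_const TYPE('a) * (- (lam\<^sup>2) * u x)) (at_right 0)"
  proof (rule lhopital_right_0[where f'="\<lambda>r. ?m * r ^ (DIM('a) - 1) * (sphere_int g 0 r - ?V * u x)" and g'="\<lambda>r. (?m + 2) * r ^ (DIM('a) + 1)"])
    have "((\<lambda>r. r ^ DIM('a) * ball_int g 0 r - r ^ DIM('a) * (?V * u x)) \<longlongrightarrow> 0 ^ DIM('a) * (?V * g 0) - 0 ^ DIM('a) * (?V * u x)) (at_right 0)"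
      by (intro tendsto_intros tendsto_ball_int[of R] continuous_on_subset[OF g(1)] R) auto
    moreover have "(0::real) ^ DIM('a) = 0" using DIM_positive[where 'a='a] by (rule zero_power)
    ultimately show "((\<lambda>r. r ^ DIM('a) * ball_int g 0 r - r ^ DIM('a) * (?V * u x)) \<longlongrightarrow> 0) (at_right 0)"
      by (simp only: mult_zero_left diff_zero)
    show "((\<lambda>r. r ^ (DIM('a) + 2)) \<longlongrightarrow> (0::real)) (at_right 0)"
      by (auto intro!: tendsto_eq_intros)
    show "\<forall>\<^sub>F r in at_right 0. r ^ (DIM('a) + 2) \<noteq> (0::real)" "\<forall>\<^sub>F r in at_right 0. (?m + 2) * r ^ (DIM('a) + 1) \<noteq> (0::real)"
      using evR by (eventually_elim, simp)+
    show "\<forall>\<^sub>F r in at_right 0. ((\<lambda>r. r ^ DIM('a) * ball_int g 0 r - r ^ DIM('a) * (?V * u x)) has_real_derivative ?m * r ^ (DIM('a) - 1) * (sphere_int g 0 r - ?V * u x)) (at r)"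
      using evR
    proof eventually_elim
      fix r assume r: "r \<in> {0<..<R}"
      show "((\<lambda>r. r ^ DIM('a) * ball_int g 0 r - r ^ DIM('a) * (?V * u x)) has_real_derivative ?m * r ^ (DIM('a) - 1) * (sphere_int g 0 r - ?V * u x)) (at r)"
      proof (rule DERIV_cong[OF DERIV_diff])
        show "((\<lambda>r. r ^ DIM('a) * ball_int g 0 r) has_real_derivative ?m * r ^ (DIM('a) - 1) * sphere_int g 0 r) (at r)"
          using r by (intro has_real_derivative_power_ball_int g(1)) auto
        show "((\<lambda>r. r ^ DIM('a) * (?V * u x)) has_real_derivative ?m * r ^ (DIM('a) - 1) * (?V * u x)) (at r)"
          by (auto intro!: derivative_eq_intros)
      qed (rule right_diff_distrib[symmetric])
    qed
    show "\<forall>\<^sub>F r in at_right 0. ((\<lambda>r. r ^ (DIM('a) + 2)) has_real_derivative (?m + 2) * r ^ (DIM('a) + 1)) (at r)"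
    proof (rule always_eventually, rule allI)
      fix r :: real
      show "((\<lambda>r. r ^ (DIM('a) + 2)) has_real_derivative (?m + 2) * r ^ (DIM('a) + 1)) (at r)"
        using DERIV_pow[of "DIM('a) + 2" r UNIV] by (simp add: add.commute)
    qed
    have lim: "((\<lambda>r. ?m / (?m + 2) * ((sphere_int u x r - ?V * u x) / r\<^sup>2)) \<longlongrightarrow> ?m / (?m + 2) * (- (lam\<^sup>2) * (?V * u x) / (2 * ?m))) (at_right 0)"
      by (intro tendsto_intros sph)
    have eq: "?m / (?m + 2) * (- (lam\<^sup>2) * (?V * u x) / (2 * ?m)) = mean_const TYPE('a) * (- (lam\<^sup>2) * u x)"
      by (simp add: divide_simps)
    have "\<forall>\<^sub>F r in at_right 0. ?m / (?m + 2) * ((sphere_int u x r - ?V * u x) / r\<^sup>2) = (?m * r ^ (DIM('a) - 1) * (sphere_int g 0 r - ?V * u x)) / ((?m + 2) * r ^ (DIM('a) + 1))"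
      using evR
    proof eventually_elim
      fix r assume r: "r \<in> {0<..<R}"
      have "r ^ (DIM('a) + 1) = r ^ (DIM('a) - 1) * r\<^sup>2"
        by (subst power_add[symmetric]) (use DIM_positive[where 'a='a] in \<open>simp add: Suc_leI\<close>)
      then show "?m / (?m + 2) * ((sphere_int u x r - ?V * u x) / r\<^sup>2) = (?m * r ^ (DIM('a) - 1) * (sphere_int g 0 r - ?V * u x)) / ((?m + 2) * r ^ (DIM('a) + 1))"
        using r by (simp add: gs)
    qed
    then show "((\<lambda>r. (?m * r ^ (DIM('a) - 1) * (sphere_int g 0 r - ?V * u x)) / ((?m + 2) * r ^ (DIM('a) + 1))) \<longlongrightarrow> mean_const TYPE('a) * (- (lam\<^sup>2) * u x)) (at_right 0)"
      by (rule Lim_transform_eventually[OF lim[unfolded eq]])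
  qed
  moreover have "\<forall>\<^sub>F r in at_right 0. (r ^ DIM('a) * ball_int g 0 r - r ^ DIM('a) * (?V * u x)) / r ^ (DIM('a) + 2) = (ball_int u x r - ?V * u x) / r\<^sup>2"
    using evR by eventually_elim (simp add: gb power_add power2_eq_square right_diff_distrib[symmetric])
  ultimately show ?thesis by (rule Lim_transform_eventually)
qed

section \<open>Polynomials and the Dirichlet problem on a ball\<close>

text \<open>Forms of degree \<open>n\<close>, generated by linear factors instead of multi-indices.
  The zero function is a form of every degree, and the grading drives the inductions behind the
  Dirichlet problem.\<close>

inductive hpoly :: "nat \<Rightarrow> ('a::euclidean_space \<Rightarrow> real) \<Rightarrow> bool" where
  const: "hpoly 0 (\<lambda>x. c)"
| linear: "hpoly n f \<Longrightarrow> hpoly (Suc n) (\<lambda>x. (x \<bullet> v) * f x)"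
| add: "hpoly n f \<Longrightarrow> hpoly n g \<Longrightarrow> hpoly n (\<lambda>x. f x + g x)"

lemma hpoly_zero: "hpoly n (\<lambda>x. 0)"
proof (induction n)
  case 0 show ?case by (rule hpoly.const)
next
  case (Suc n) then show ?case using hpoly.linear[of n "\<lambda>x. 0" 0] by simp
qed

lemma hpoly_cmult: "hpoly n f \<Longrightarrow> hpoly n (\<lambda>x. c * f x)"
proof (induction rule: hpoly.induct)
  case (const d) show ?case by (rule hpoly.const)
next
  case (linear n f v) then show ?case using hpoly.linear[OF linear.IH, of v] by (simp add: mult.left_commute)
next
  case (add n f g) then show ?case using hpoly.add[OF add.IH] by (simp add: distrib_left)
qed

lemma hpoly_sum: "(\<And>i. i \<in> I \<Longrightarrow> hpoly n (f i)) \<Longrightarrow> hpoly n (\<lambda>x. \<Sum>i\<in>I. f i x)"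
  by (induction I rule: infinite_finite_induct) (auto intro: hpoly_zero hpoly.add)

lemma hpoly_mult: "hpoly n f \<Longrightarrow> hpoly k g \<Longrightarrow> hpoly (n + k) (\<lambda>x. f x * g x)"
proof (induction rule: hpoly.induct)
  case (const c) then show ?case using hpoly_cmult by simp
next
  case (linear n f v) then show ?case
    using hpoly.linear[OF linear.IH, of v] by (simp add: mult.assoc)
next
  case (add n f h) then show ?case using hpoly.add[OF add.IH] by (simp add: distrib_right)
qed

lemma hpoly_inner_self: "hpoly 2 (\<lambda>x::'a::euclidean_space. x \<bullet> x)"
proof -
  have "hpoly (Suc (Suc 0)) (\<lambda>x::'a. \<Sum>b\<in>Basis. (x \<bullet> b) * ((x \<bullet> b) * 1))"
    by (intro hpoly_sum hpoly.intros)
  then show ?thesis by (simp add: euclidean_inner[symmetric] numeral_2_eq_2)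
qed

lemma hpoly_differentiable: "hpoly n f \<Longrightarrow> f differentiable (at x)"
  by (induction rule: hpoly.induct) (auto intro!: derivative_intros)

lemma frechet_derivative_linear_mult_hpoly:
  assumes "hpoly n f"
  shows "frechet_derivative (\<lambda>x. (x \<bullet> v) * f x) (at x) h = (h \<bullet> v) * f x + (x \<bullet> v) * frechet_derivative f (at x) h"
proof -
  have "(f has_derivative frechet_derivative f (at x)) (at x)"
    using hpoly_differentiable[OF assms] by (simp add: frechet_derivative_works)
  then have "((\<lambda>x. (x \<bullet> v) * f x) has_derivative (\<lambda>h. (x \<bullet> v) * frechet_derivative f (at x) h + (h \<bullet> v) * f x)) (at x)"
    by (rule has_derivative_mult[OF has_derivative_inner_left[OF has_derivative_ident]])
  from frechet_derivative_at[OF this, symmetric] show ?thesis by simp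
qed

lemma frechet_derivative_add:
  assumes "f differentiable (at x)" "g differentiable (at x)"
  shows "frechet_derivative (\<lambda>x. f x + g x) (at x) h = frechet_derivative f (at x) h + frechet_derivative g (at x) h"
proof -
  have "((\<lambda>x. f x + g x) has_derivative (\<lambda>h. frechet_derivative f (at x) h + frechet_derivative g (at x) h)) (at x)"
    using assms by (intro derivative_intros) (simp_all add: frechet_derivative_works)
  from frechet_derivative_at[OF this, symmetric] show ?thesis by simp
qed

lemma partial_deriv_add:
  assumes "f differentiable (at x)" "g differentiable (at x)"
  shows "partial_deriv b (\<lambda>x. f x + g x) x = partial_deriv b f x + partial_deriv b g x"
  using frechet_derivative_add[OF assms] by (simp add: partial_deriv_def)

text \<open>Euler's identity, which later turns the cross term in the Laplacian of
  \<open>|x|^2 f\<close> into a multiple of \<open>f\<close>.\<close>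

lemma hpoly_euler: "hpoly n f \<Longrightarrow> frechet_derivative f (at x) x = real n * f x"
proof (induction rule: hpoly.induct)
  case (const c) then show ?case by (simp add: frechet_derivative_const)
next
  case (linear n f v) then show ?case
    using frechet_derivative_linear_mult_hpoly[OF linear.hyps] by (simp add: algebra_simps)
next
  case (add n f g) then show ?case
    using frechet_derivative_add[OF hpoly_differentiable hpoly_differentiable, OF add.hyps] by (simp add: algebra_simps)
qed

text \<open>At degree \<open>0\<close> the truncated \<open>n - 1\<close> is \<open>0\<close> again;
  the second conjunct records that the derivative then vanishes, so that its product with a linear
  factor still counts as degree \<open>0\<close> in the induction.\<close>

lemma hpoly_partial_deriv:
  "hpoly n f \<Longrightarrow> hpoly (n - 1) (partial_deriv b f) \<and> (n = 0 \<longrightarrow> partial_deriv b f = (\<lambda>x. 0))"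
proof (induction rule: hpoly.induct)
  case (const c)
  have "partial_deriv b (\<lambda>x. c) = (\<lambda>x. 0)"
    by (simp add: partial_deriv_def[abs_def] frechet_derivative_const)
  then show ?case using hpoly_zero[of 0] by simp
next
  case (linear n f v)
  have eq: "partial_deriv b (\<lambda>x. (x \<bullet> v) * f x) = (\<lambda>x. (b \<bullet> v) * f x + (x \<bullet> v) * partial_deriv b f x)"
    using frechet_derivative_linear_mult_hpoly[OF linear.hyps] by (simp add: partial_deriv_def[abs_def])
  have *: "hpoly n (\<lambda>x. (x \<bullet> v) * partial_deriv b f x)"
  proof (cases n)
    case 0 then show ?thesis using linear.IH hpoly_zero[of 0] by simp
  next
    case (Suc k) then show ?thesis using linear.IH hpoly.linear[of k] by simp
  qed
  then show ?case
    unfolding eq using hpoly.add[OF hpoly_cmult[OF linear.hyps] *] by simp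
next
  case (add n f g)
  have "partial_deriv b (\<lambda>x. f x + g x) = (\<lambda>x. partial_deriv b f x + partial_deriv b g x)"
    using partial_deriv_add[OF hpoly_differentiable hpoly_differentiable, OF add.hyps] by auto
  then show ?case using add.IH hpoly.add by auto
qed

inductive mpoly :: "('a::euclidean_space \<Rightarrow> real) \<Rightarrow> bool" where
  hpoly: "hpoly n f \<Longrightarrow> mpoly f"
| add: "mpoly f \<Longrightarrow> mpoly g \<Longrightarrow> mpoly (\<lambda>x. f x + g x)"

lemma mpoly_cmult: "mpoly f \<Longrightarrow> mpoly (\<lambda>x. c * f x)"
proof (induction rule: mpoly.induct)
  case (hpoly n f) then show ?case by (rule mpoly.hpoly[OF hpoly_cmult])
next
  case (add f g) then show ?case using mpoly.add[OF add.IH] by (simp add: distrib_left)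
qed

lemma mpoly_diff: "mpoly f \<Longrightarrow> mpoly g \<Longrightarrow> mpoly (\<lambda>x. f x - g x)"
  using mpoly.add[of f, OF _ mpoly_cmult[of g "-1"]] by simp

lemma mpoly_mult_hpoly: "mpoly f \<Longrightarrow> hpoly k g \<Longrightarrow> mpoly (\<lambda>x. f x * g x)"
proof (induction rule: mpoly.induct)
  case (hpoly n f) then show ?case by (rule mpoly.hpoly[OF hpoly_mult])
next
  case (add f h) then show ?case using mpoly.add[OF add.IH] by (simp add: distrib_right)
qed

lemma mpoly_mult: "mpoly g \<Longrightarrow> mpoly f \<Longrightarrow> mpoly (\<lambda>x. f x * g x)"
proof (induction rule: mpoly.induct)
  case (hpoly n g) then show ?case by (intro mpoly_mult_hpoly)
next
  case (add g h) then show ?case using mpoly.add[OF add.IH] by (simp add: distrib_left)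
qed

lemma mpoly_real_polynomial_function:
  fixes f :: "'a::euclidean_space \<Rightarrow> real"
  shows "real_polynomial_function f \<Longrightarrow> mpoly f"
proof (induction rule: real_polynomial_function.induct)
  case (linear f)
  define v where "v = (\<Sum>b\<in>Basis. f b *\<^sub>R b)"
  have lin: "linear f" using linear by (rule bounded_linear.linear)
  have "f x = x \<bullet> v" for x
  proof -
    have "f x = f (\<Sum>b\<in>Basis. (x \<bullet> b) *\<^sub>R b)" by (simp add: euclidean_representation)
    also have "\<dots> = x \<bullet> v"
      by (simp add: linear_sum[OF lin] linear_scale[OF lin] v_def inner_sum_right mult.commute)
    finally show ?thesis .
  qed
  moreover have "mpoly (\<lambda>x. (x \<bullet> v) * 1)"
    by (rule mpoly.hpoly[OF hpoly.linear[OF hpoly.const]])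
  moreover have "f = (\<lambda>x. (x \<bullet> v) * 1)" using \<open>\<And>x. f x = x \<bullet> v\<close> by auto
  ultimately show ?case by simp
next
  case (const c) show ?case by (rule mpoly.hpoly[OF hpoly.const])
qed (auto intro: mpoly.add mpoly_mult)

lemma mpoly_differentiable: "mpoly f \<Longrightarrow> f differentiable (at x)"
  by (induction rule: mpoly.induct) (auto intro!: derivative_intros hpoly_differentiable)

lemma mpoly_partial_deriv: "mpoly f \<Longrightarrow> mpoly (partial_deriv b f)"
proof (induction rule: mpoly.induct)
  case (hpoly n f) then show ?case using hpoly_partial_deriv mpoly.hpoly by blast
next
  case (add f g)
  have "partial_deriv b (\<lambda>x. f x + g x) = (\<lambda>x. partial_deriv b f x + partial_deriv b g x)"
    using partial_deriv_add[OF mpoly_differentiable mpoly_differentiable, OF add.hyps] by auto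
  then show ?case using mpoly.add[OF add.IH] by simp
qed

lemma mpoly_C2_on: "mpoly f \<Longrightarrow> C2_on f S"
proof -
  have C1: "C1_on f S" if "mpoly f" for f :: "'a \<Rightarrow> real"
    unfolding C1_on_def using that
    by (auto intro!: mpoly_differentiable continuous_at_imp_continuous_on differentiable_imp_continuous_within mpoly_partial_deriv)
  then show "mpoly f \<Longrightarrow> C2_on f S"
    by (simp add: C2_on_def mpoly_partial_deriv)
qed

lemma mpoly_continuous_on: "mpoly f \<Longrightarrow> continuous_on S f"
  by (auto intro!: mpoly_differentiable continuous_at_imp_continuous_on differentiable_imp_continuous_within)

section \<open>The Laplacian on polynomials\<close>

lemma laplacian_add:
  assumes "mpoly f" "mpoly g"
  shows "laplacian (\<lambda>x. f x + g x) x = laplacian f x + laplacian g x"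
proof -
  have "partial_deriv b (\<lambda>x. f x + g x) = (\<lambda>x. partial_deriv b f x + partial_deriv b g x)" for b
    using partial_deriv_add[OF mpoly_differentiable mpoly_differentiable, OF assms] by auto
  then have "partial_deriv b (partial_deriv b (\<lambda>x. f x + g x)) x = partial_deriv b (partial_deriv b f) x + partial_deriv b (partial_deriv b g) x" for b
    using partial_deriv_add[OF mpoly_differentiable mpoly_differentiable, OF mpoly_partial_deriv mpoly_partial_deriv, OF assms] by simp
  then show ?thesis by (simp add: laplacian_def sum.distrib)
qed

lemma partial_deriv_cmult:
  assumes "f differentiable (at x)"
  shows "partial_deriv b (\<lambda>x. c * f x) x = c * partial_deriv b f x"
proof -
  have "(f has_derivative frechet_derivative f (at x)) (at x)"
    using assms by (simp add: frechet_derivative_works)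
  then have "((\<lambda>x. c * f x) has_derivative (\<lambda>h. c * frechet_derivative f (at x) h)) (at x)"
    by (intro derivative_intros)
  then show ?thesis by (simp add: partial_deriv_eqI partial_deriv_def[of b f])
qed

lemma laplacian_cmult:
  assumes "mpoly f"
  shows "laplacian (\<lambda>x. c * f x) x = c * laplacian f x"
proof -
  have "partial_deriv b (\<lambda>x. c * f x) = (\<lambda>x. c * partial_deriv b f x)" for b
    using partial_deriv_cmult[OF mpoly_differentiable[OF assms]] by auto
  then have "partial_deriv b (partial_deriv b (\<lambda>x. c * f x)) x = c * partial_deriv b (partial_deriv b f) x" for b
    using partial_deriv_cmult[OF mpoly_differentiable, OF mpoly_partial_deriv, OF assms] by simp
  then show ?thesis by (simp add: laplacian_def sum_distrib_left)
qed

lemma laplacian_diff: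
  assumes "mpoly f" "mpoly g"
  shows "laplacian (\<lambda>x. f x - g x) x = laplacian f x - laplacian g x"
  using laplacian_add[OF assms(1) mpoly_cmult[OF assms(2), of "-1"], of x] laplacian_cmult[OF assms(2), of "-1" x] by simp

lemma hpoly_laplacian:
  assumes "hpoly n f"
  shows "hpoly (n - 2) (laplacian f)" "n < 2 \<Longrightarrow> laplacian f = (\<lambda>x. 0)"
proof -
  have "hpoly (n - 1 - 1) (\<lambda>x. \<Sum>b\<in>Basis. partial_deriv b (partial_deriv b f) x)"
    using hpoly_partial_deriv assms by (intro hpoly_sum) blast
  then show "hpoly (n - 2) (laplacian f)"
    by (simp add: laplacian_def[abs_def] numeral_2_eq_2)
  assume "n < 2"
  then have "partial_deriv b (partial_deriv b f) = (\<lambda>x. 0)" for b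
    using hpoly_partial_deriv[OF assms, of b] hpoly_partial_deriv[of "n - 1" "partial_deriv b f" b] by simp
  then show "laplacian f = (\<lambda>x. 0)" by (simp add: laplacian_def[abs_def])
qed

lemma partial_deriv_inner_self_mult:
  assumes "f differentiable (at x)"
  shows "partial_deriv b (\<lambda>x. (x \<bullet> x) * f x) x = 2 * (x \<bullet> b) * f x + (x \<bullet> x) * partial_deriv b f x"
proof -
  have "(f has_derivative frechet_derivative f (at x)) (at x)"
    using assms by (simp add: frechet_derivative_works)
  then have "((\<lambda>x. (x \<bullet> x) * f x) has_derivative (\<lambda>h. (x \<bullet> x) * frechet_derivative f (at x) h + (x \<bullet> h + h \<bullet> x) * f x)) (at x)"
    by (auto intro!: derivative_eq_intros)
  then show ?thesis by (simp add: partial_deriv_eqI partial_deriv_def[of b f] inner_commute)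
qed

text \<open>The product rule gives \<open>2 m f\<close>, from the Laplacian of \<open>|x|^2\<close>,
  and a cross term of four times \<open>x . grad f\<close>, which is \<open>4 n f\<close> by Euler's
  identity.\<close>

lemma laplacian_inner_self_mult:
  fixes f :: "'a::euclidean_space \<Rightarrow> real"
  assumes f: "hpoly n f"
  shows "laplacian (\<lambda>x. (x \<bullet> x) * f x) x = (2 * real DIM('a) + 4 * real n) * f x + (x \<bullet> x) * laplacian f x"
proof -
  note d = hpoly_differentiable[OF f]
  have pd: "partial_deriv b f differentiable (at x)" for b x
    by (rule mpoly_differentiable[OF mpoly_partial_deriv[OF mpoly.hpoly[OF f]]])
  have d1: "partial_deriv b (\<lambda>x. (x \<bullet> x) * f x) = (\<lambda>x. 2 * ((x \<bullet> b) * f x) + (x \<bullet> x) * partial_deriv b f x)" for b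
    using partial_deriv_inner_self_mult[OF d] by (auto simp: mult.assoc)
  have d2: "partial_deriv b (partial_deriv b (\<lambda>x. (x \<bullet> x) * f x)) x =
      2 * f x + 4 * ((x \<bullet> b) * partial_deriv b f x) + (x \<bullet> x) * partial_deriv b (partial_deriv b f) x"
    if b: "b \<in> Basis" for b
  proof -
    have "(f has_derivative frechet_derivative f (at x)) (at x)"
      "(partial_deriv b f has_derivative frechet_derivative (partial_deriv b f) (at x)) (at x)"
      using d pd by (simp_all add: frechet_derivative_works)
    then have "((\<lambda>x. 2 * ((x \<bullet> b) * f x) + (x \<bullet> x) * partial_deriv b f x) has_derivative
      (\<lambda>h. 2 * ((x \<bullet> b) * frechet_derivative f (at x) h + (h \<bullet> b) * f x) +
        ((x \<bullet> x) * frechet_derivative (partial_deriv b f) (at x) h + (x \<bullet> h + h \<bullet> x) * partial_deriv b f x))) (at x)"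
      by (auto intro!: derivative_eq_intros)
    then show ?thesis
      unfolding d1 using b
      by (simp add: partial_deriv_eqI partial_deriv_def[of b f] partial_deriv_def[of b "partial_deriv b f"] inner_same_Basis algebra_simps inner_commute)
  qed
  have "laplacian (\<lambda>x. (x \<bullet> x) * f x) x = 
     (\<Sum>b\<in>Basis. 2 * f x + 4 * ((x \<bullet> b) * partial_deriv b f x) + (x \<bullet> x) * partial_deriv b (partial_deriv b f) x)"
    unfolding laplacian_def by (rule sum.cong) (simp_all add: d2)
  also have "\<dots> = 2 * real DIM('a) * f x + 4 * (\<Sum>b\<in>Basis. (x \<bullet> b) * partial_deriv b f x) + (x \<bullet> x) * laplacian f x"
    by (simp add: sum.distrib sum_distrib_left laplacian_def)
  also have "(\<Sum>b\<in>Basis. (x \<bullet> b) * partial_deriv b f x) = real n * f x"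
    using frechet_derivative_eq_sum_partial[OF d, of x x] hpoly_euler[OF f] by simp
  finally show ?thesis by (simp add: algebra_simps)
qed

text \<open>Eliminating the top term \<open>\<bar>x\<bar>\<^sup>2 \<Delta> q\<close> turns the equation for \<open>q\<close> into one of the same
  shape, with a larger \<open>c\<close>, for a form of degree \<open>n - 2\<close>.\<close>

lemma hpoly_solve:
  fixes P :: "'a::euclidean_space \<Rightarrow> real"
  assumes "hpoly n P" "c > 0"
  shows "\<exists>q. hpoly n q \<and> (\<forall>x. c * q x + (x \<bullet> x) * laplacian q x = P x)"
  using assms
proof (induction n arbitrary: P c rule: less_induct)
  case (less n)
  note P = \<open>hpoly n P\<close> and c = \<open>c > 0\<close>
  show ?case
  proof (cases "n < 2")
    case True
    have "laplacian (\<lambda>x. (1 / c) * P x) = (\<lambda>x. 0)"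
      by (rule hpoly_laplacian(2)[OF hpoly_cmult[OF P] True])
    then show ?thesis
      using hpoly_cmult[OF P, of "1 / c"] c by (intro exI[of _ "\<lambda>x. (1 / c) * P x"]) simp
  next
    case False
    define k where "k = n - 2"
    have k: "k < n" "n = 2 + k" using False by (auto simp: k_def)
    \<comment> \<open>Applying the Laplacian to the equation for \<open>q\<close> and writing
      \<open>s\<close> for \<open>\<Delta> q\<close> gives
      \<open>c s + (2 m + 4 k) s + |x|^2 \<Delta> s = \<Delta> P\<close>; this is the new constant,
      positive again.\<close>
    define c' where "c' = c + (2 * real DIM('a) + 4 * real k)"
    have "hpoly k (laplacian P)" using hpoly_laplacian(1)[OF P] by (simp add: k_def)
    moreover have "c' > 0" using c by (simp add: c'_def add_pos_nonneg)
    ultimately obtain s where s: "hpoly k s" "\<And>x. c' * s x + (x \<bullet> x) * laplacian s x = laplacian P x"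
      using less.IH[OF k(1)] by blast
    \<comment> \<open>The original equation solved for \<open>q\<close>, with \<open>s\<close> in
      place of its Laplacian; the equation for \<open>s\<close> then makes \<open>s\<close> the
      Laplacian of this \<open>q\<close>.\<close>
    define q where "q x = (1 / c) * (P x - (x \<bullet> x) * s x)" for x
    have hs: "hpoly n (\<lambda>x. (x \<bullet> x) * s x)"
      using hpoly_mult[OF hpoly_inner_self s(1)] k by simp
    have "hpoly n (\<lambda>x. (1 / c) * (P x + (-1) * ((x \<bullet> x) * s x)))"
      by (intro hpoly.add P hpoly_cmult hs)
    then have hq: "hpoly n q"
      by (simp add: q_def[abs_def])
    have "laplacian q x = (1 / c) * (laplacian P x - laplacian (\<lambda>x. (x \<bullet> x) * s x) x)" for x
      unfolding q_def
      by (simp only: laplacian_cmult[OF mpoly_diff[OF mpoly.hpoly[OF P] mpoly.hpoly[OF hs]]] laplacian_diff[OF mpoly.hpoly[OF P] mpoly.hpoly[OF hs]])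
    then have "laplacian q x = (1 / c) * (c * s x)" for x
      unfolding laplacian_inner_self_mult[OF s(1)] s(2)[symmetric] by (simp add: c'_def algebra_simps)
    then have "c * q x + (x \<bullet> x) * laplacian q x = P x" for x
      using c by (simp add: q_def)
    with hq show ?thesis by blast
  qed
qed

text \<open>The factor \<open>R^2 - |x|^2\<close> builds in zero boundary values. A form
  \<open>q\<close> with \<open>(2 m + 4 n) q + |x|^2 \<Delta> q = - P\<close> produces
  \<open>P\<close> up to the error \<open>R^2 \<Delta> q\<close>, a form of degree
  \<open>n - 2\<close>, which the induction hypothesis removes; for \<open>n < 2\<close> the error
  is zero.\<close>

lemma hpoly_dirichlet:
  fixes P :: "'a::euclidean_space \<Rightarrow> real"
  assumes "hpoly n P"
  shows "\<exists>q. mpoly q \<and> (\<forall>x. laplacian (\<lambda>x. (R\<^sup>2 - x \<bullet> x) * q x) x = P x)"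
  using assms
proof (induction n arbitrary: P rule: less_induct)
  case (less n)
  note P = \<open>hpoly n P\<close>
  have "2 * real DIM('a) + 4 * real n > 0" by (simp add: add_pos_nonneg)
  then obtain q where q: "hpoly n q" "\<And>x. (2 * real DIM('a) + 4 * real n) * q x + (x \<bullet> x) * laplacian q x = - P x"
    using hpoly_solve[OF hpoly_cmult[OF P, of "-1"]] by auto
  have mq: "mpoly q" by (rule mpoly.hpoly[OF q(1)])
  have mxq: "mpoly (\<lambda>x. (x \<bullet> x) * q x)"
    by (rule mpoly.hpoly[OF hpoly_mult[OF hpoly_inner_self q(1)]])
  have lap: "laplacian (\<lambda>x. (R\<^sup>2 - x \<bullet> x) * q x) x = R\<^sup>2 * laplacian q x + P x" for x
    unfolding left_diff_distrib laplacian_diff[OF mpoly_cmult[OF mq] mxq] laplacian_cmult[OF mq] laplacian_inner_self_mult[OF q(1)] q(2)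
    by simp
  show ?case
  proof (cases "n < 2")
    case True
    then show ?thesis using lap hpoly_laplacian(2)[OF q(1)] mq by (intro exI[of _ q]) auto
  next
    case False
    then have "hpoly (n - 2) (\<lambda>x. R\<^sup>2 * laplacian q x)" "n - 2 < n"
      using hpoly_cmult[OF hpoly_laplacian(1)[OF q(1)]] by auto
    then obtain p where p: "mpoly p" "\<And>x. laplacian (\<lambda>x. (R\<^sup>2 - x \<bullet> x) * p x) x = R\<^sup>2 * laplacian q x"
      using less.IH by blast
    have m: "mpoly (\<lambda>x. (R\<^sup>2 - x \<bullet> x) * f x)" if "mpoly f" for f :: "'a \<Rightarrow> real"
      by (intro mpoly_mult mpoly_diff that mpoly.hpoly[OF hpoly.const] mpoly.hpoly[OF hpoly_inner_self])
    have "laplacian (\<lambda>x. (R\<^sup>2 - x \<bullet> x) * (q x - p x)) x = P x" for x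
      unfolding right_diff_distrib laplacian_diff[OF m[OF mq] m[OF p(1)]] lap p(2) by simp
    then show ?thesis using mpoly_diff[OF mq p(1)] by blast
  qed
qed

lemma mpoly_dirichlet:
  fixes P :: "'a::euclidean_space \<Rightarrow> real"
  assumes "mpoly P"
  shows "\<exists>v. mpoly v \<and> (\<forall>x. laplacian v x = P x) \<and> (\<forall>x. norm x = \<bar>R\<bar> \<longrightarrow> v x = 0)"
  using assms
proof (induction rule: mpoly.induct)
  case (hpoly n P)
  obtain q where q: "mpoly q" "\<And>x. laplacian (\<lambda>x. (R\<^sup>2 - x \<bullet> x) * q x) x = P x"
    using hpoly_dirichlet[OF hpoly] by blast
  have "mpoly (\<lambda>x. (R\<^sup>2 - x \<bullet> x) * q x)"
    by (intro mpoly_mult mpoly_diff q mpoly.hpoly[OF hpoly.const] mpoly.hpoly[OF hpoly_inner_self])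
  moreover have "(R\<^sup>2 - x \<bullet> x) * q x = 0" if "norm x = \<bar>R\<bar>" for x
    using that by (simp add: power2_norm_eq_inner[symmetric])
  ultimately show ?case using q(2) by blast
next
  case (add P Q)
  then obtain v w where "mpoly v" "\<forall>x. laplacian v x = P x" "\<forall>x. norm x = \<bar>R\<bar> \<longrightarrow> v x = 0"
    "mpoly w" "\<forall>x. laplacian w x = Q x" "\<forall>x. norm x = \<bar>R\<bar> \<longrightarrow> w x = 0" by blast
  then show ?case by (intro exI[of _ "\<lambda>x. v x + w x"]) (auto simp: laplacian_add mpoly.add)
qed

section \<open>Comparison with polynomials\<close>

lemma continuous_on_ball_arg_UNIV:
  assumes "continuous_on UNIV (f :: 'a::euclidean_space \<Rightarrow> real)"
  shows "continuous_on S (\<lambda>z. f (x + s *\<^sub>R z))"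
  by (intro continuous_on_compose2[OF assms] continuous_intros) auto

lemma integrable_uball_UNIV:
  assumes "continuous_on UNIV (f :: 'a::euclidean_space \<Rightarrow> real)"
  shows "integrable uball (\<lambda>z. f (x + r *\<^sub>R z))"
  by (intro integrable_uball_continuous continuous_on_ball_arg_UNIV assms)

lemma ball_int_comb:
  fixes f g :: "'a::euclidean_space \<Rightarrow> real"
  assumes "continuous_on UNIV f" "continuous_on UNIV g"
  shows "ball_int (\<lambda>z. a * f z + b * g z) x r = a * ball_int f x r + b * ball_int g x r"
  unfolding ball_int_def using integrable_uball_UNIV[OF assms(1)] integrable_uball_UNIV[OF assms(2)] by simp

text \<open>Divided by \<open>mean_const\<close>, the limit at \<open>r = 0\<close> is the
  Blaschke-Privalov Laplacian, which agrees with the Laplacian on \<open>C2\<close> functions and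
  may exist for functions that are merely continuous.\<close>

definition mean_defect :: "('a::euclidean_space \<Rightarrow> real) \<Rightarrow> 'a \<Rightarrow> real \<Rightarrow> real" where
  "mean_defect f x r = (ball_int f x r - uvol TYPE('a) * f x) / r\<^sup>2"

lemma tendsto_mean_defect_comb:
  fixes f g :: "'a::euclidean_space \<Rightarrow> real"
  assumes "continuous_on UNIV f" "continuous_on UNIV g"
    and "(mean_defect f x \<longlongrightarrow> k * l) F" "(mean_defect g x \<longlongrightarrow> k * l') F"
  shows "(mean_defect (\<lambda>z. a * f z + b * g z) x \<longlongrightarrow> k * (a * l + b * l')) F"
proof -
  have "((\<lambda>r. a * mean_defect f x r + b * mean_defect g x r) \<longlongrightarrow> a * (k * l) + b * (k * l')) F"
    by (intro tendsto_intros assms)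
  moreover have "mean_defect (\<lambda>z. a * f z + b * g z) x = (\<lambda>r. a * mean_defect f x r + b * mean_defect g x r)"
    unfolding mean_defect_def[abs_def] ball_int_comb[OF assms(1,2)]
    by (auto simp: fun_eq_iff add_divide_distrib diff_divide_distrib algebra_simps)
  moreover have "a * (k * l) + b * (k * l') = k * (a * l + b * l')" by (simp add: algebra_simps)
  ultimately show ?thesis by (simp only:)
qed

section \<open>A maximum principle for the mean defect\<close>

lemma mean_const_pos: "mean_const TYPE('a::euclidean_space) > 0"
  using uvol_pos[where 'a='a] by (intro divide_pos_pos) (auto simp: add_nonneg_pos)

text \<open>At an interior maximum no ball mean exceeds the central value, so the defect is
  nonpositive and cannot have a positive limit. The contradiction uses the limit at that one point,
  so the rate of convergence may vary freely between points.\<close>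

lemma max_on_sphere:
  fixes w :: "'a::euclidean_space \<Rightarrow> real"
  assumes R: "R > 0" and w: "continuous_on UNIV w"
    and lim: "\<And>x. x \<in> ball 0 R \<Longrightarrow> (mean_defect w x \<longlongrightarrow> l x) (at_right 0)"
    and pos: "\<And>x. x \<in> ball 0 R \<Longrightarrow> l x > 0"
    and x: "x \<in> cball 0 R"
  obtains y where "y \<in> sphere 0 R" "w x \<le> w y"
proof -
  obtain y where y: "y \<in> cball 0 R" "\<And>z. z \<in> cball 0 R \<Longrightarrow> w z \<le> w y"
    using continuous_attains_sup[of "cball 0 R" w] R continuous_on_subset[OF w] by (auto simp: not_le)
  have "y \<notin> ball 0 R"
  proof
    assume yb: "y \<in> ball 0 R"
    then have "eventually (\<lambda>r. r \<in> {0<..<R - norm y}) (at_right 0)"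
      by (intro eventually_at_right_real) auto
    then have "eventually (\<lambda>r. mean_defect w y r \<le> 0) (at_right 0)"
    proof eventually_elim
      fix r assume r: "r \<in> {0<..<R - norm y}"
      have "ball_int w y r \<le> (LINT z|(uball::'a measure). w y)"
        unfolding ball_int_def
      proof (rule integral_mono)
        fix z :: 'a assume "z \<in> space uball"
        then have "norm (r *\<^sub>R z) \<le> r" using r by (auto intro: mult_left_le)
        then have "norm (y + r *\<^sub>R z) \<le> R"
          using norm_triangle_ineq[of y "r *\<^sub>R z"] r unfolding greaterThanLessThan_iff by linarith
        then show "w (y + r *\<^sub>R z) \<le> w y" by (intro y(2)) simp
      qed (auto intro: integrable_uball_UNIV w)
      then show "mean_defect w y r \<le> 0"
        by (simp add: mean_defect_def divide_nonpos_nonneg)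
    qed
    then have "l y \<le> 0"
      by (intro tendsto_upperbound[OF lim[OF yb]]) auto
    with pos[OF yb] show False by simp
  qed
  then have "y \<in> sphere 0 R" using y(1) by auto
  then show ?thesis using y(2)[OF x] by (rule that)
qed

text \<open>Adding \<open>\<eta> |z|^2\<close> raises the generalised Laplacian by
  \<open>2 m \<eta> > \<eta>\<close> and makes it strictly positive; on the sphere this costs
  \<open>\<eta> R^2\<close>.\<close>

lemma mean_defect_comparison:
  fixes f :: "'a::euclidean_space \<Rightarrow> real"
  assumes R: "R > 0" and f: "continuous_on UNIV f"
    and lim: "\<And>x. x \<in> ball 0 R \<Longrightarrow> (mean_defect f x \<longlongrightarrow> mean_const TYPE('a) * l x) (at_right 0)"
    and lower: "\<And>x. x \<in> ball 0 R \<Longrightarrow> l x \<ge> - \<eta>" and \<eta>: "\<eta> > 0"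
    and sphere: "\<And>x. x \<in> sphere 0 R \<Longrightarrow> f x \<le> \<epsilon>"
    and x: "x \<in> cball 0 R"
  shows "f x \<le> \<epsilon> + \<eta> * R\<^sup>2"
proof -
  let ?w = "\<lambda>z. 1 * f z + \<eta> * (z \<bullet> z)"
  have cont: "continuous_on UNIV (\<lambda>z::'a. z \<bullet> z)" by (intro continuous_intros)
  have "\<exists>y\<in>sphere 0 R. ?w x \<le> ?w y"
  proof (rule max_on_sphere[OF R _ _ _ x, of ?w "\<lambda>x. mean_const TYPE('a) * (1 * l x + \<eta> * (2 * real DIM('a)))"])
    show "continuous_on UNIV ?w" by (intro continuous_intros f)
    fix y :: 'a assume y: "y \<in> ball 0 R"
    have "(mean_defect (\<lambda>z::'a. z \<bullet> z) y \<longlongrightarrow> mean_const TYPE('a) * (2 * real DIM('a))) (at_right 0)"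
      using tendsto_ball_int_laplacian[OF C2_on_inner_self open_UNIV UNIV_I, of y]
      by (simp only: laplacian_inner_self mean_defect_def[abs_def])
    then show "(mean_defect ?w y \<longlongrightarrow> mean_const TYPE('a) * (1 * l y + \<eta> * (2 * real DIM('a)))) (at_right 0)"
      by (rule tendsto_mean_defect_comb[OF f cont lim[OF y]])
    have "\<eta> * 1 < \<eta> * (2 * real DIM('a))"
      using \<eta> DIM_positive[where 'a='a] by (intro mult_strict_left_mono) linarith+
    then have "1 * l y + \<eta> * (2 * real DIM('a)) > 0"
      using lower[OF y] by linarith
    then show "mean_const TYPE('a) * (1 * l y + \<eta> * (2 * real DIM('a))) > 0"
      by (intro mult_pos_pos mean_const_pos)
  qed blast
  then obtain y where y: "y \<in> sphere 0 R" "?w x \<le> ?w y" by blast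
  have "y \<bullet> y = R\<^sup>2" using y(1) by (simp add: power2_norm_eq_inner[symmetric])
  moreover have "\<eta> * (x \<bullet> x) \<ge> 0" using \<eta> by simp
  ultimately show ?thesis using y sphere[OF y(1)] by simp
qed

text \<open>With \<open>h\<close> solving the Poisson equation for the right side
  \<open>- lam^2 p\<close> and equal to \<open>p\<close> on the sphere, the generalised Laplacian of
  \<open>g - h\<close> is \<open>lam^2 (p - g)\<close>, small throughout the ball. Comparison of
  both signs then works for every \<open>R\<close>.\<close>

lemma approx_by_mpoly_solution:
  fixes g :: "'a::euclidean_space \<Rightarrow> real"
  assumes R: "R > 0" and g: "continuous_on UNIV g" and lam: "lam > 0"
    and lim: "\<And>x. x \<in> ball 0 R \<Longrightarrow> (mean_defect g x \<longlongrightarrow> mean_const TYPE('a) * (- (lam\<^sup>2) * g x)) (at_right 0)"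
    and \<delta>: "\<delta> > 0"
  shows "\<exists>h. mpoly h \<and> (\<forall>x\<in>cball 0 R. \<bar>g x - h x\<bar> \<le> \<delta> \<and> \<bar>laplacian h x + lam\<^sup>2 * h x\<bar> \<le> \<delta>)"
proof -
  \<comment> \<open>Comparison bounds \<open>|g - h|\<close> by
    \<open>\<epsilon> (1 + lam^2 R^2)\<close>, one more \<open>\<epsilon>\<close> accounts for
    \<open>|g - p|\<close>, and \<open>\<Delta> h + lam^2 h = lam^2 (h - p)\<close> costs a factor
    \<open>lam^2\<close>; the factor \<open>1 + lam^2\<close> covers both conclusions.\<close>
  let ?K = "(1 + lam\<^sup>2) * (2 + lam\<^sup>2 * R\<^sup>2)"
  define \<epsilon> where "\<epsilon> = \<delta> / ?K"
  have K: "?K > 0" by (intro mult_pos_pos) (auto simp: add_pos_nonneg)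
  have \<epsilon>: "\<epsilon> > 0" using \<delta> K by (simp add: \<epsilon>_def)
  have \<epsilon>K: "(1 + lam\<^sup>2) * (\<epsilon> * (2 + lam\<^sup>2 * R\<^sup>2)) = \<delta>" using K by (simp add: \<epsilon>_def field_simps)
  have e2: "\<epsilon> * (2 + lam\<^sup>2 * R\<^sup>2) > 0" using \<epsilon> by (intro mult_pos_pos) (auto simp: add_pos_nonneg)
  obtain p where p: "real_polynomial_function p" "\<And>x. x \<in> cball 0 R \<Longrightarrow> \<bar>g x - p x\<bar> < \<epsilon>"
    using Stone_Weierstrass_real_polynomial_function[OF compact_cball continuous_on_subset[OF g subset_UNIV] \<epsilon>] by metis
  have mp: "mpoly p" by (rule mpoly_real_polynomial_function[OF p(1)])
  have mlp: "mpoly (laplacian p)"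
  proof -
    have "mpoly (\<lambda>x. \<Sum>b\<in>A. partial_deriv b (partial_deriv b p) x)" for A
      by (induction A rule: infinite_finite_induct)
         (auto intro!: mpoly.add mpoly_partial_deriv mp mpoly.hpoly[OF hpoly.const])
    then show ?thesis by (simp add: laplacian_def[abs_def])
  qed
  \<comment> \<open>A correction vanishing on the sphere, with Laplacian chosen so that
    \<open>p + v\<close> has Laplacian \<open>- lam^2 p\<close>.\<close>
  obtain v where v: "mpoly v" "\<And>x. laplacian v x = - (lam\<^sup>2) * p x - laplacian p x" "\<And>x. norm x = R \<Longrightarrow> v x = 0"
    using mpoly_dirichlet[OF mpoly_diff[OF mpoly_cmult[OF mp, of "- (lam\<^sup>2)"] mlp], of R] R by auto
  define h where "h x = p x + v x" for x
  have mh: "mpoly h" unfolding h_def by (intro mpoly.add mp v)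
  have lh: "laplacian h x = - (lam\<^sup>2) * p x" for x
    unfolding h_def by (simp add: laplacian_add[OF mp v(1)] v(2))
  have hs: "h x = p x" if "x \<in> sphere 0 R" for x using v(3)[of x] that by (simp add: h_def)
  have ch: "continuous_on UNIV h" by (rule mpoly_continuous_on[OF mh])
  have limh: "(mean_defect h x \<longlongrightarrow> mean_const TYPE('a) * (- (lam\<^sup>2) * p x)) (at_right 0)" for x
    using tendsto_ball_int_laplacian[OF mpoly_C2_on[OF mh] open_UNIV UNIV_I, of x]
    by (simp only: lh mean_defect_def[abs_def])
  let ?\<eta> = "lam\<^sup>2 * \<epsilon>"
  have \<eta>: "?\<eta> > 0" using lam \<epsilon> by simp
  have close: "\<bar>lam\<^sup>2 * (p x - g x)\<bar> \<le> ?\<eta>" if "x \<in> cball 0 R" for x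
    using p(2)[OF that] by (simp add: abs_mult abs_minus_commute mult_left_mono)
  have c1: "1 * g x + (-1) * h x \<le> \<epsilon> + ?\<eta> * R\<^sup>2" if x: "x \<in> cball 0 R" for x
  proof (rule mean_defect_comparison[OF R _ tendsto_mean_defect_comb[OF g ch lim limh] _ \<eta> _ x])
    show "- ?\<eta> \<le> 1 * (- (lam\<^sup>2) * g y) + (-1) * (- (lam\<^sup>2) * p y)" if "y \<in> ball 0 R" for y
      using close[of y] that by (auto simp: algebra_simps abs_le_iff)
    show "1 * g y + (-1) * h y \<le> \<epsilon>" if "y \<in> sphere 0 R" for y
      using hs[OF that] p(2)[of y] that by auto
  qed (auto intro!: continuous_intros g ch)
  have c2: "(-1) * g x + 1 * h x \<le> \<epsilon> + ?\<eta> * R\<^sup>2" if x: "x \<in> cball 0 R" for x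
  proof (rule mean_defect_comparison[OF R _ tendsto_mean_defect_comb[OF g ch lim limh] _ \<eta> _ x])
    show "- ?\<eta> \<le> (-1) * (- (lam\<^sup>2) * g y) + 1 * (- (lam\<^sup>2) * p y)" if "y \<in> ball 0 R" for y
      using close[of y] that by (auto simp: algebra_simps abs_le_iff)
    show "(-1) * g y + 1 * h y \<le> \<epsilon>" if "y \<in> sphere 0 R" for y
      using hs[OF that] p(2)[of y] that by auto
  qed (auto intro!: continuous_intros g ch)
  have "\<bar>g x - h x\<bar> \<le> \<delta> \<and> \<bar>laplacian h x + lam\<^sup>2 * h x\<bar> \<le> \<delta>" if x: "x \<in> cball 0 R" for x
  proof
    have gh: "\<bar>g x - h x\<bar> \<le> \<epsilon> + ?\<eta> * R\<^sup>2" using c1[OF x] c2[OF x] by (simp add: abs_le_iff)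
    have "\<epsilon> + ?\<eta> * R\<^sup>2 \<le> \<epsilon> * (2 + lam\<^sup>2 * R\<^sup>2)" using \<epsilon> by (simp add: algebra_simps)
    also have "\<dots> \<le> (1 + lam\<^sup>2) * (\<epsilon> * (2 + lam\<^sup>2 * R\<^sup>2))"
      using e2 by (simp add: distrib_right)
    finally show "\<bar>g x - h x\<bar> \<le> \<delta>" using gh \<epsilon>K by linarith
    have "\<bar>h x - p x\<bar> \<le> \<epsilon> * (2 + lam\<^sup>2 * R\<^sup>2)"
    proof -
      have "\<epsilon> * (2 + lam\<^sup>2 * R\<^sup>2) = \<epsilon> + \<epsilon> + ?\<eta> * R\<^sup>2" by (simp add: algebra_simps)
      then show ?thesis using gh p(2)[OF x] by linarith
    qed
    then have "lam\<^sup>2 * \<bar>h x - p x\<bar> \<le> lam\<^sup>2 * (\<epsilon> * (2 + lam\<^sup>2 * R\<^sup>2))"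
      by (intro mult_left_mono) auto
    moreover have "\<bar>laplacian h x + lam\<^sup>2 * h x\<bar> = lam\<^sup>2 * \<bar>h x - p x\<bar>"
    proof -
      have "laplacian h x + lam\<^sup>2 * h x = lam\<^sup>2 * (h x - p x)" by (simp add: lh algebra_simps)
      then show ?thesis by (simp add: abs_mult)
    qed
    moreover have "lam\<^sup>2 * (\<epsilon> * (2 + lam\<^sup>2 * R\<^sup>2)) \<le> (1 + lam\<^sup>2) * (\<epsilon> * (2 + lam\<^sup>2 * R\<^sup>2))"
      using e2 by (intro mult_right_mono) auto
    ultimately show "\<bar>laplacian h x + lam\<^sup>2 * h x\<bar> \<le> \<delta>" using \<epsilon>K by linarith
  qed
  with mh show ?thesis by blast
qed

text \<open>A mean value inequality whose left end is a limit, since the derivatives of the means in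
  the radius are known for positive radii.\<close>

lemma derivative_bound_at_right:
  fixes f f' :: "real \<Rightarrow> real"
  assumes s: "0 < s" and der: "\<And>t. 0 < t \<Longrightarrow> t \<le> s \<Longrightarrow> (f has_real_derivative f' t) (at t)"
    and bound: "\<And>t. 0 < t \<Longrightarrow> t \<le> s \<Longrightarrow> \<bar>f' t\<bar> \<le> B" and lim: "(f \<longlongrightarrow> l) (at_right 0)"
  shows "\<bar>f s - l\<bar> \<le> B * s"
proof (rule tendsto_upperbound[of "\<lambda>a. \<bar>f s - f a\<bar>" _ "at_right (0::real)"])
  show "((\<lambda>a. \<bar>f s - f a\<bar>) \<longlongrightarrow> \<bar>f s - l\<bar>) (at_right 0)"
    by (intro tendsto_intros lim)
  have B: "B \<ge> 0" using bound[of s] s by linarith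
  have "eventually (\<lambda>a. a \<in> {0<..<s}) (at_right 0)" using s by (rule eventually_at_right_real)
  then show "eventually (\<lambda>a. \<bar>f s - f a\<bar> \<le> B * s) (at_right 0)"
  proof eventually_elim
    fix a assume a: "a \<in> {0<..<s}"
    have "norm (f s - f a) \<le> B * norm (s - a)"
      by (rule field_differentiable_bound[where S="{a..s}" and f'=f'])
         (use a der bound in \<open>auto intro: has_field_derivative_at_within\<close>)
    also have "\<dots> \<le> B * s" using a B by (intro mult_left_mono) auto
    finally show "\<bar>f s - f a\<bar> \<le> B * s" by simp
  qed
qed simp

section \<open>The integral equation in the radius\<close>

lemma AE_uball_nonzero: "AE z in uball. z \<noteq> (0::'a::euclidean_space)"
  unfolding uball_def using AE_lborel_singleton[of "0::'a"] by (subst AE_restrict_space_iff) auto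

text \<open>\<open>t ^ (m + 2) * weighted_int q 0 t\<close> is the integral of
  \<open>(t^2 - |z|^2) q z\<close> over the ball of radius \<open>t\<close>. That weight vanishes on
  the boundary sphere, so the two surface terms cancel and the derivative \<open>2 t\<close> of the
  weight remains. Weighted integrals are thus governed by ball integrals over smaller radii.\<close>

lemma has_real_derivative_power_weighted_int:
  fixes q :: "'a::euclidean_space \<Rightarrow> real"
  assumes q: "continuous_on UNIV q" and t: "t > 0"
  shows "((\<lambda>t. t ^ (DIM('a) + 2) * weighted_int q 0 t) has_real_derivative 2 * t ^ (DIM('a) + 1) * ball_int q 0 t) (at t)"
proof -
  let ?m = "DIM('a)"
  let ?p = "\<lambda>z. (z \<bullet> z) * q z"
  have cp: "continuous_on UNIV ?p" by (intro continuous_intros q)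
  have eq: "t\<^sup>2 * (t ^ ?m * ball_int q 0 t) - t ^ ?m * ball_int ?p 0 t = t ^ (?m + 2) * weighted_int q 0 t" for t
  proof -
    define N where "N = (LINT z|uball. (norm z)\<^sup>2 * q (t *\<^sub>R z))"
    have p: "ball_int ?p 0 t = t\<^sup>2 * N"
      unfolding ball_int_def power2_norm_eq_inner N_def by (simp add: power2_eq_square mult.assoc)
    have w: "weighted_int q 0 t = ball_int q 0 t - N"
    proof -
      have "integrable uball (\<lambda>z. q (t *\<^sub>R z))" "integrable uball (\<lambda>z. (norm z)\<^sup>2 * q (t *\<^sub>R z))"
        using continuous_on_ball_arg_UNIV[OF q, of "cball 0 1" 0 t]
        by (auto intro!: integrable_uball_continuous continuous_intros)
      then show ?thesis by (simp add: weighted_int_def ball_int_def N_def left_diff_distrib)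
    qed
    show ?thesis unfolding p w by (simp add: power_add algebra_simps power2_eq_square)
  qed
  have sp: "sphere_int ?p 0 t = t\<^sup>2 * sphere_int q 0 t"
  proof -
    have i1: "integrable uball (\<lambda>z. ?p (0 + t *\<^sub>R sgn z))" and i2: "integrable uball (\<lambda>z. q (0 + t *\<^sub>R sgn z))"
      using t by (auto intro!: integrable_sphere_int[where R=t, simplified] continuous_on_subset[OF cp] continuous_on_subset[OF q] simp del: inner_scaleR_left inner_scaleR_right add_0)
    have "sphere_int ?p 0 t = (LINT z|uball. t\<^sup>2 * q (0 + t *\<^sub>R sgn z))"
      unfolding sphere_int_def
    proof (rule integral_cong_AE)
      show "(\<lambda>z. ?p (0 + t *\<^sub>R sgn z)) \<in> borel_measurable uball" using i1 by (rule borel_measurable_integrable)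
      show "(\<lambda>z. t\<^sup>2 * q (0 + t *\<^sub>R sgn z)) \<in> borel_measurable uball" using i2 by (intro borel_measurable_times borel_measurable_const borel_measurable_integrable)
      show "AE z in uball. ?p (0 + t *\<^sub>R sgn z) = t\<^sup>2 * q (0 + t *\<^sub>R sgn z)"
        using AE_uball_nonzero
      proof eventually_elim
        fix z :: 'a assume "z \<noteq> 0"
        then have "sgn z \<bullet> sgn z = 1" using norm_sgn[of z] by (simp add: norm_eq_1)
        then show "?p (0 + t *\<^sub>R sgn z) = t\<^sup>2 * q (0 + t *\<^sub>R sgn z)" by (simp add: power2_eq_square)
      qed
    qed
    then show ?thesis by (simp add: sphere_int_def)
  qed
  have "((\<lambda>t. t\<^sup>2 * (t ^ ?m * ball_int q 0 t) - t ^ ?m * ball_int ?p 0 t) has_real_derivative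
    (t\<^sup>2 * (real ?m * t ^ (?m - 1) * sphere_int q 0 t) + 2 * t * (t ^ ?m * ball_int q 0 t)) - real ?m * t ^ (?m - 1) * sphere_int ?p 0 t) (at t)"
  proof (rule DERIV_diff)
    have "((\<lambda>t. t\<^sup>2) has_real_derivative 2 * t) (at t)" by (auto intro!: derivative_eq_intros)
    from DERIV_mult[OF this has_real_derivative_power_ball_int[OF q t]]
    show "((\<lambda>t. t\<^sup>2 * (t ^ ?m * ball_int q 0 t)) has_real_derivative
        (t\<^sup>2 * (real ?m * t ^ (?m - 1) * sphere_int q 0 t) + 2 * t * (t ^ ?m * ball_int q 0 t))) (at t)"
      by (simp add: algebra_simps)
  qed (rule has_real_derivative_power_ball_int[OF cp t])
  then show ?thesis unfolding eq sp by (simp add: algebra_simps)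
qed

text \<open>The derivative just computed is at most \<open>2 s ^ (m + 1) \<Phi>\<close> on
  \<open>(0, s]\<close>. The factor 2 is crude but good enough for a contraction.\<close>

lemma weighted_int_bound:
  fixes q :: "'a::euclidean_space \<Rightarrow> real"
  assumes q: "continuous_on UNIV q" and s: "s > 0"
    and bound: "\<And>t. 0 < t \<Longrightarrow> t \<le> s \<Longrightarrow> \<bar>ball_int q 0 t\<bar> \<le> \<Phi>"
  shows "\<bar>weighted_int q 0 s\<bar> \<le> 2 * \<Phi>"
proof -
  let ?m = "DIM('a)"
  have \<Phi>: "\<Phi> \<ge> 0" using bound[of s] s by linarith
  have "\<bar>s ^ (?m + 2) * weighted_int q 0 s - 0\<bar> \<le> 2 * s ^ (?m + 1) * \<Phi> * s"
  proof (rule derivative_bound_at_right[OF s has_real_derivative_power_weighted_int[OF q]])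
    fix t assume t: "0 < t" "t \<le> s"
    have "\<bar>2 * t ^ (?m + 1) * ball_int q 0 t\<bar> = 2 * t ^ (?m + 1) * \<bar>ball_int q 0 t\<bar>"
      using t by (simp add: abs_mult)
    also have "\<dots> \<le> 2 * s ^ (?m + 1) * \<Phi>"
      using t bound[OF t] by (intro mult_mono power_mono) auto
    finally show "\<bar>2 * t ^ (?m + 1) * ball_int q 0 t\<bar> \<le> 2 * s ^ (?m + 1) * \<Phi>" .
  next
    have "((\<lambda>t. t ^ (?m + 2) * weighted_int q 0 t) \<longlongrightarrow> 0 ^ (?m + 2) * (q 0 * (LINT z|(uball::'a measure). 1 - (norm z)\<^sup>2))) (at_right 0)"
      by (intro tendsto_intros tendsto_weighted_int[of 1] continuous_on_subset[OF q]) auto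
    then show "((\<lambda>t. t ^ (?m + 2) * weighted_int q 0 t) \<longlongrightarrow> 0) (at_right 0)" by simp
  qed auto
  then have "s ^ (?m + 2) * \<bar>weighted_int q 0 s\<bar> \<le> s ^ (?m + 2) * (2 * \<Phi>)"
    using s by (simp add: abs_mult mult_ac)
  then show ?thesis using s by simp
qed


text \<open>For \<open>\<Delta> q = e - lam^2 q\<close> the ball integrals obey this differential
  equation, and the weighted integrals on its right are controlled by the ball integrals themselves.
  On radii up to \<open>r0\<close> the dependence is a contraction, so the central value and
  \<open>\<eta>\<close> control everything.\<close>

lemma ball_int_small:
  fixes q e :: "'a::euclidean_space \<Rightarrow> real"
  assumes q: "continuous_on UNIV q" and e: "continuous_on UNIV e"
    and r0: "r0 > 0" and small: "lam\<^sup>2 * r0\<^sup>2 \<le> 1 / 2"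
    and der: "\<And>r. 0 < r \<Longrightarrow> r \<le> r0 \<Longrightarrow>
      (ball_int q 0 has_real_derivative r / 2 * (weighted_int e 0 r - lam\<^sup>2 * weighted_int q 0 r)) (at r)"
    and e_bound: "\<And>z. norm z \<le> r0 \<Longrightarrow> \<bar>e z\<bar> \<le> \<eta>"
  shows "\<bar>ball_int q 0 r0\<bar> \<le> uvol TYPE('a) * (2 * \<bar>q 0\<bar> + r0\<^sup>2 * \<eta>)"
proof -
  let ?V = "uvol TYPE('a)"
  let ?A = "(\<lambda>r. \<bar>ball_int q 0 r\<bar>) ` {0<..r0}"
  \<comment> \<open>This supremum is finite because \<open>q\<close> is bounded on the ball of
    radius \<open>r0\<close>; finiteness is what permits half of it to be absorbed at the
    end.\<close>
  define \<Phi> where "\<Phi> = Sup ?A"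
  obtain K where K: "K > 0" "\<And>z. z \<in> cball 0 r0 \<Longrightarrow> \<bar>q z\<bar> \<le> K"
    using continuous_on_cball_bounded[OF continuous_on_subset[OF q subset_UNIV]] by metis
  have int_bound: "\<bar>LINT z|uball. f z\<bar> \<le> ?V * c" if "integrable uball f" "\<And>z. norm z < 1 \<Longrightarrow> \<bar>f z\<bar> \<le> c" for f :: "'a \<Rightarrow> real" and c
  proof -
    have "\<bar>LINT z|uball. f z\<bar> \<le> (LINT z|uball. \<bar>f z\<bar>)"
      using integral_norm_bound[of uball f] by simp
    also have "\<dots> \<le> (LINT z|(uball::'a measure). c)"
      using that by (intro integral_mono integrable_abs) auto
    finally show ?thesis by simp
  qed
  have arg: "norm (t *\<^sub>R z) \<le> r0" if "0 < t" "t \<le> r0" "norm z < 1" for t and z :: 'a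
    using mult_mono[of t r0 "norm z" 1] that by simp
  have bdd: "bdd_above ?A"
  proof (rule bdd_aboveI2)
    fix t assume "t \<in> {0<..r0}"
    then show "\<bar>ball_int q 0 t\<bar> \<le> ?V * K"
      unfolding ball_int_def using arg[of t] K(2) by (intro int_bound integrable_uball_UNIV q) auto
  qed
  have \<Phi>: "\<bar>ball_int q 0 t\<bar> \<le> \<Phi>" if "0 < t" "t \<le> r0" for t
    unfolding \<Phi>_def using that by (intro cSUP_upper bdd) auto
  have \<Phi>0: "\<Phi> \<ge> 0" using \<Phi>[of r0] r0 by linarith
  have \<eta>0: "\<eta> \<ge> 0" using e_bound[of 0] r0 by simp
  \<comment> \<open>A bound for the derivative: \<open>r / 2 \<le> r0 / 2\<close>, the error term
    contributes at most \<open>uvol * \<eta>\<close>, and the weighted integral of \<open>q\<close>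
    at most \<open>2 * \<Phi>\<close>.\<close>
  define B where "B = r0 / 2 * (?V * \<eta> + lam\<^sup>2 * (2 * \<Phi>))"
  have B0: "B \<ge> 0"
    unfolding B_def using r0 \<eta>0 \<Phi>0 less_imp_le[OF uvol_pos[where 'a='a]] by (intro mult_nonneg_nonneg add_nonneg_nonneg) auto
  have main: "\<bar>ball_int q 0 t - ?V * q 0\<bar> \<le> B * t" if t: "0 < t" "t \<le> r0" for t
  proof (rule derivative_bound_at_right[OF t(1) der])
    fix r assume r: "0 < r" "r \<le> t"
    then have r': "0 < r" "r \<le> r0" using t by auto
    have "\<bar>weighted_int e 0 r\<bar> \<le> ?V * \<eta>"
      unfolding weighted_int_def
    proof (rule int_bound)
      show "integrable uball (\<lambda>z. (1 - (norm z)\<^sup>2) * e (0 + r *\<^sub>R z))"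
        by (intro integrable_uball_continuous continuous_intros continuous_on_ball_arg_UNIV e)
      fix z :: 'a assume z: "norm z < 1"
      have "\<bar>1 - (norm z)\<^sup>2\<bar> * \<bar>e (0 + r *\<^sub>R z)\<bar> \<le> 1 * \<eta>"
        using z power_le_one[of "norm z" 2] e_bound[of "r *\<^sub>R z"] arg[OF r' z]
        by (intro mult_mono) (auto simp: abs_le_iff)
      then show "\<bar>(1 - (norm z)\<^sup>2) * e (0 + r *\<^sub>R z)\<bar> \<le> \<eta>" by (simp add: abs_mult)
    qed
    moreover have "lam\<^sup>2 * \<bar>weighted_int q 0 r\<bar> \<le> lam\<^sup>2 * (2 * \<Phi>)"
      using r' by (intro mult_left_mono weighted_int_bound q \<Phi>) auto
    moreover have "\<bar>weighted_int e 0 r - lam\<^sup>2 * weighted_int q 0 r\<bar> \<le> \<bar>weighted_int e 0 r\<bar> + lam\<^sup>2 * \<bar>weighted_int q 0 r\<bar>"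
      using abs_triangle_ineq4[of "weighted_int e 0 r" "lam\<^sup>2 * weighted_int q 0 r"] by (simp add: abs_mult)
    ultimately have "\<bar>weighted_int e 0 r - lam\<^sup>2 * weighted_int q 0 r\<bar> \<le> ?V * \<eta> + lam\<^sup>2 * (2 * \<Phi>)"
      by linarith
    then have "r / 2 * \<bar>weighted_int e 0 r - lam\<^sup>2 * weighted_int q 0 r\<bar> \<le> B"
      unfolding B_def using r' by (intro mult_mono) auto
    then show "\<bar>r / 2 * (weighted_int e 0 r - lam\<^sup>2 * weighted_int q 0 r)\<bar> \<le> B"
      using r' by (simp add: abs_mult)
  next
    show "(ball_int q 0 \<longlongrightarrow> ?V * q 0) (at_right 0)"
      by (rule tendsto_ball_int[of 1]) (auto intro: continuous_on_subset[OF q])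
  qed (use t in auto)
  have each: "\<bar>ball_int q 0 t\<bar> \<le> ?V * \<bar>q 0\<bar> + r0\<^sup>2 * ?V * \<eta> / 2 + \<Phi> / 2" if t: "0 < t" "t \<le> r0" for t
  proof -
    have "\<bar>ball_int q 0 t\<bar> \<le> \<bar>?V * q 0\<bar> + B * t" using main[OF t] by linarith
    also have "B * t \<le> B * r0" using B0 t by (intro mult_left_mono) auto
    also have "B * r0 = r0\<^sup>2 * ?V * \<eta> / 2 + lam\<^sup>2 * r0\<^sup>2 * \<Phi>"
      by (simp add: B_def power2_eq_square algebra_simps)
    also have "lam\<^sup>2 * r0\<^sup>2 * \<Phi> \<le> 1 / 2 * \<Phi>" using small \<Phi>0 by (rule mult_right_mono)
    finally show ?thesis using less_imp_le[OF uvol_pos[where 'a='a]] by (simp add: abs_mult)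
  qed
  define X where "X = ?V * \<bar>q 0\<bar> + r0\<^sup>2 * ?V * \<eta> / 2"
  have "\<Phi> \<le> X + \<Phi> / 2"
    unfolding \<Phi>_def using r0 each by (intro cSUP_least) (auto simp: \<Phi>_def X_def)
  then have "\<bar>ball_int q 0 r0\<bar> \<le> 2 * X" using \<Phi>[of r0] r0 by linarith
  also have "2 * X = ?V * (2 * \<bar>q 0\<bar> + r0\<^sup>2 * \<eta>)" by (simp add: X_def algebra_simps)
  finally show ?thesis .
qed

text \<open>The combination \<open>g y * g (x + z) - g x * g (y + z)\<close> is zero at
  \<open>z = 0\<close>. Were \<open>g\<close> a smooth solution, the ball integrals of the
  combination would vanish by the homogeneous equation. Instead the polynomial \<open>h\<close> is
  inserted, for which central value and residual are of order \<open>\<delta>\<close>, and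
  \<open>\<delta>\<close> is arbitrary.\<close>

lemma ball_int_proportional:
  fixes g :: "'a::euclidean_space \<Rightarrow> real"
  assumes R: "R > 0" and g: "continuous_on UNIV g" and lam: "lam > 0"
    and lim: "\<And>x. x \<in> ball 0 R \<Longrightarrow> (mean_defect g x \<longlongrightarrow> mean_const TYPE('a) * (- (lam\<^sup>2) * g x)) (at_right 0)"
    and small: "lam\<^sup>2 * R\<^sup>2 \<le> 1 / 2"
    and x: "x \<in> ball 0 (R / 2)" and y: "y \<in> ball 0 (R / 2)" and r: "0 < r" "r < R / 2"
  shows "g y * ball_int g x r = g x * ball_int g y r"
proof -
  let ?V = "uvol TYPE('a)"
  define G where "G = \<bar>g x\<bar> + \<bar>g y\<bar>"
  have G0: "G \<ge> 0" by (simp add: G_def)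
  have V0: "?V \<ge> 0" using less_imp_le[OF uvol_pos[where 'a='a]] .
  \<comment> \<open>Two contributions \<open>G * \<delta>\<close> come from the central value,
    \<open>r^2 * G * \<delta>\<close> from the residual, and one more \<open>G * \<delta>\<close>
    from replacing \<open>h\<close> by \<open>g\<close>.\<close>
  define C where "C = ?V * (3 * G + r\<^sup>2 * G)"
  have C0: "C \<ge> 0" using G0 V0 by (simp add: C_def)
  have inR: "x + z \<in> cball 0 R" "y + z \<in> cball 0 R" if "norm z \<le> r" for z
    using norm_triangle_ineq[of x z] norm_triangle_ineq[of y z] x y r that
    unfolding mem_ball_0 mem_cball_0 by linarith+
  have key: "\<bar>g y * ball_int g x r - g x * ball_int g y r\<bar> \<le> C * \<delta>" if \<delta>: "\<delta> > 0" for \<delta>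
  proof -
    obtain h where h: "mpoly h" "\<And>z. z \<in> cball 0 R \<Longrightarrow> \<bar>g z - h z\<bar> \<le> \<delta>"
      "\<And>z. z \<in> cball 0 R \<Longrightarrow> \<bar>laplacian h z + lam\<^sup>2 * h z\<bar> \<le> \<delta>"
      using approx_by_mpoly_solution[OF R g lam lim \<delta>] by blast
    have hc: "continuous_on UNIV h" by (rule mpoly_continuous_on[OF h(1)])
    have lc: "continuous_on UNIV (laplacian h)" by (rule C2_on_continuous_laplacian[OF mpoly_C2_on[OF h(1)]])
    \<comment> \<open>The coefficients are values of \<open>g\<close>, not of \<open>h\<close>, so
      they do not depend on \<open>\<delta>\<close>; the price is that \<open>comb h 0\<close> is
      small rather than zero.\<close>
    define comb where "comb f z = g y * f (x + z) - g x * f (y + z)" for f :: "'a \<Rightarrow> real" and z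
    have comb_cont: "continuous_on UNIV (comb f)" if "continuous_on UNIV f" for f
      unfolding comb_def[abs_def]
      using continuous_on_ball_arg_UNIV[OF that, of UNIV x 1] continuous_on_ball_arg_UNIV[OF that, of UNIV y 1]
      by (intro continuous_intros) simp_all
    have comb_bound: "\<bar>comb f z\<bar> \<le> G * \<delta>" if "\<And>z. z \<in> cball 0 R \<Longrightarrow> \<bar>f z\<bar> \<le> \<delta>" "norm z \<le> r" for f z
    proof -
      note z = inR[OF that(2)]
      have "\<bar>comb f z\<bar> \<le> \<bar>g y\<bar> * \<bar>f (x + z)\<bar> + \<bar>g x\<bar> * \<bar>f (y + z)\<bar>"
        unfolding comb_def by (metis abs_mult abs_triangle_ineq4)
      also have "\<dots> \<le> \<bar>g y\<bar> * \<delta> + \<bar>g x\<bar> * \<delta>"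
        using that(1)[OF z(1)] that(1)[OF z(2)] by (intro add_mono mult_left_mono) auto
      finally show ?thesis by (simp add: G_def algebra_simps)
    qed
    have comb_ball: "ball_int (comb f) 0 s = g y * ball_int f x s - g x * ball_int f y s" if "continuous_on UNIV f" for f s
      unfolding ball_int_def comb_def using integrable_uball_UNIV[OF that] by simp
    have comb_weighted: "weighted_int (comb f) 0 s = g y * weighted_int f x s - g x * weighted_int f y s" if "continuous_on UNIV f" for f s
    proof -
      have i: "integrable uball (\<lambda>z. (1 - (norm z)\<^sup>2) * f (c + s *\<^sub>R z))" for c
        by (intro integrable_uball_continuous continuous_intros continuous_on_ball_arg_UNIV that)
      have "weighted_int (comb f) 0 s = (LINT z|uball. g y * ((1 - (norm z)\<^sup>2) * f (x + s *\<^sub>R z)) - g x * ((1 - (norm z)\<^sup>2) * f (y + s *\<^sub>R z)))"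
        unfolding weighted_int_def comb_def by (intro Bochner_Integration.integral_cong) (auto simp: algebra_simps)
      also have "\<dots> = g y * weighted_int f x s - g x * weighted_int f y s"
        unfolding weighted_int_def using i[of x] i[of y] by simp
      finally show ?thesis .
    qed
    let ?e = "\<lambda>z. laplacian h z + lam\<^sup>2 * h z"
    have ec: "continuous_on UNIV ?e" by (intro continuous_intros hc lc)
    have we: "weighted_int ?e c s = weighted_int (laplacian h) c s + lam\<^sup>2 * weighted_int h c s" for c s
    proof -
      have i: "integrable uball (\<lambda>z. (1 - (norm z)\<^sup>2) * f (c + s *\<^sub>R z))" if "continuous_on UNIV f" for f
        by (intro integrable_uball_continuous continuous_intros continuous_on_ball_arg_UNIV that)
      have "weighted_int ?e c s = (LINT z|uball. (1 - (norm z)\<^sup>2) * laplacian h (c + s *\<^sub>R z) + lam\<^sup>2 * ((1 - (norm z)\<^sup>2) * h (c + s *\<^sub>R z)))"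
        unfolding weighted_int_def by (intro Bochner_Integration.integral_cong) (auto simp: algebra_simps)
      also have "\<dots> = weighted_int (laplacian h) c s + lam\<^sup>2 * weighted_int h c s"
        unfolding weighted_int_def using i[OF lc] i[OF hc] by simp
      finally show ?thesis .
    qed
    have dh: "(ball_int h c has_real_derivative s / 2 * weighted_int (laplacian h) c s) (at s)" if "0 < s" for c s
      by (rule has_real_derivative_ball_int[OF mpoly_C2_on[OF h(1)] open_UNIV subset_UNIV, of s "s + 1"]) (use that in auto)
    have "\<bar>ball_int (comb h) 0 r\<bar> \<le> ?V * (2 * \<bar>comb h 0\<bar> + r\<^sup>2 * (G * \<delta>))"
    proof (rule ball_int_small[of _ "comb ?e" _ lam])
      have "lam\<^sup>2 * r\<^sup>2 \<le> lam\<^sup>2 * R\<^sup>2" using r by (intro mult_left_mono power_mono) auto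
      then show "lam\<^sup>2 * r\<^sup>2 \<le> 1 / 2" using small by linarith
      fix s assume s: "0 < s" "s \<le> r"
      have "((\<lambda>s. g y * ball_int h x s - g x * ball_int h y s) has_real_derivative
        g y * (s / 2 * weighted_int (laplacian h) x s) - g x * (s / 2 * weighted_int (laplacian h) y s)) (at s)"
        by (intro DERIV_diff DERIV_cmult dh s)
      moreover have "g y * (s / 2 * weighted_int (laplacian h) x s) - g x * (s / 2 * weighted_int (laplacian h) y s) =
        s / 2 * (weighted_int (comb ?e) 0 s - lam\<^sup>2 * weighted_int (comb h) 0 s)"
        unfolding comb_weighted[OF ec] comb_weighted[OF hc] we by (simp add: algebra_simps)
      ultimately show "(ball_int (comb h) 0 has_real_derivative s / 2 * (weighted_int (comb ?e) 0 s - lam\<^sup>2 * weighted_int (comb h) 0 s)) (at s)"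
        unfolding comb_ball[OF hc, abs_def] by (simp only:)
    next
      show "\<bar>comb ?e z\<bar> \<le> G * \<delta>" if "norm z \<le> r" for z
        by (rule comb_bound[OF h(3) that])
    qed (auto intro: comb_cont hc ec r)
    moreover have "\<bar>comb h 0\<bar> \<le> G * \<delta>"
    proof -
      have "comb h 0 = - comb (\<lambda>z. g z - h z) 0" by (simp add: comb_def algebra_simps)
      then show ?thesis using comb_bound[of "\<lambda>z. g z - h z" 0] h(2) r by simp
    qed
    moreover have "\<bar>ball_int (comb (\<lambda>z. g z - h z)) 0 r\<bar> \<le> ?V * (G * \<delta>)"
    proof -
      have cc: "continuous_on UNIV (\<lambda>z. g z - h z)" by (intro continuous_intros g hc)
      have i: "integrable uball (\<lambda>z. comb (\<lambda>z. g z - h z) (0 + r *\<^sub>R z))"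
        by (intro integrable_uball_UNIV comb_cont cc)
      have "\<bar>ball_int (comb (\<lambda>z. g z - h z)) 0 r\<bar> \<le> (LINT z|uball. \<bar>comb (\<lambda>z. g z - h z) (0 + r *\<^sub>R z)\<bar>)"
        unfolding ball_int_def using integral_norm_bound[of uball "\<lambda>z. comb (\<lambda>z. g z - h z) (0 + r *\<^sub>R z)"] by simp
      also have "\<dots> \<le> (LINT z|(uball::'a measure). G * \<delta>)"
      proof (rule integral_mono)
        fix z :: 'a assume "z \<in> space uball"
        then have "norm (0 + r *\<^sub>R z) \<le> r" using r by (auto intro: mult_left_le)
        then show "\<bar>comb (\<lambda>z. g z - h z) (0 + r *\<^sub>R z)\<bar> \<le> G * \<delta>"
          using h(2) by (intro comb_bound[of "\<lambda>z. g z - h z"]) auto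
      qed (use i in auto)
      finally show ?thesis by simp
    qed
    moreover have "ball_int (comb g) 0 r = ball_int (comb h) 0 r + ball_int (comb (\<lambda>z. g z - h z)) 0 r"
    proof -
      have cc: "continuous_on UNIV (\<lambda>z. g z - h z)" by (intro continuous_intros g hc)
      have "integrable uball (\<lambda>z. comb h (0 + r *\<^sub>R z))" "integrable uball (\<lambda>z. comb (\<lambda>z. g z - h z) (0 + r *\<^sub>R z))"
        by (intro integrable_uball_UNIV comb_cont cc hc)+
      then have "ball_int (comb h) 0 r + ball_int (comb (\<lambda>z. g z - h z)) 0 r =
          (LINT z|uball. comb h (0 + r *\<^sub>R z) + comb (\<lambda>z. g z - h z) (0 + r *\<^sub>R z))"
        unfolding ball_int_def by simp
      also have "\<dots> = ball_int (comb g) 0 r"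
        unfolding ball_int_def by (intro Bochner_Integration.integral_cong) (auto simp: comb_def algebra_simps)
      finally show ?thesis by simp
    qed
    moreover have "?V * (2 * \<bar>comb h 0\<bar> + r\<^sup>2 * (G * \<delta>)) \<le> ?V * (2 * (G * \<delta>) + r\<^sup>2 * (G * \<delta>))"
      using \<open>\<bar>comb h 0\<bar> \<le> G * \<delta>\<close> V0 by (intro mult_left_mono) auto
    moreover have "C * \<delta> = ?V * (2 * (G * \<delta>) + r\<^sup>2 * (G * \<delta>)) + ?V * (G * \<delta>)"
      by (simp add: C_def algebra_simps)
    ultimately show ?thesis unfolding comb_ball[OF g, symmetric] by linarith
  qed
  have "\<bar>g y * ball_int g x r - g x * ball_int g y r\<bar> \<le> 0"
  proof (rule field_le_epsilon)
    fix e :: real assume e: "0 < e"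
    then have "\<bar>g y * ball_int g x r - g x * ball_int g y r\<bar> \<le> C * (e / (C + 1))"
      using C0 by (intro key divide_pos_pos) auto
    also have "\<dots> \<le> e" using e C0 by (simp add: field_simps)
    finally show "\<bar>g y * ball_int g x r - g x * ball_int g y r\<bar> \<le> 0 + e" by simp
  qed
  then show ?thesis by simp
qed

text \<open>The relation between ball integrals holds on an interval of radii, so it can be
  multiplied by \<open>t ^ m\<close> and differentiated, which produces sphere integrals. Spheres
  are wanted because regularity will be drawn from the spherical means.\<close>

lemma sphere_int_proportional:
  fixes g :: "'a::euclidean_space \<Rightarrow> real"
  assumes g: "continuous_on UNIV g"
    and proportional: "\<And>r. 0 < r \<Longrightarrow> r < R \<Longrightarrow> g y * ball_int g x r = g x * ball_int g y r"
    and r: "0 < r" "r < R"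
  shows "g y * sphere_int g x r = g x * sphere_int g y r"
proof -
  let ?k = "real DIM('a) * r ^ (DIM('a) - 1)"
  have d: "((\<lambda>t. g c * (t ^ DIM('a) * ball_int g c' t)) has_real_derivative g c * (?k * sphere_int g c' r)) (at r)" for c c'
    by (intro DERIV_cmult has_real_derivative_power_ball_int g r)
  have "((\<lambda>t. g x * (t ^ DIM('a) * ball_int g y t)) has_real_derivative g y * (?k * sphere_int g x r)) (at r)"
  proof (rule has_field_derivative_transform_within_open[OF d[of y x], where S="{0<..<R}"])
    fix t assume "t \<in> {0<..<R}"
    then show "g y * (t ^ DIM('a) * ball_int g x t) = g x * (t ^ DIM('a) * ball_int g y t)"
      using proportional[of t] by (simp add: mult.left_commute)
  qed (use r in auto)
  then have "g y * (?k * sphere_int g x r) = g x * (?k * sphere_int g y r)"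
    using d[of x y] by (rule DERIV_unique)
  then have "?k * (g y * sphere_int g x r) = ?k * (g x * sphere_int g y r)"
    by (simp only: mult.left_commute)
  moreover have "?k \<noteq> 0" using r by simp
  ultimately show ?thesis unfolding mult_cancel_left by blast
qed

section \<open>Regularity and the equation\<close>

lemma C1_on_subset: "C1_on f S \<Longrightarrow> T \<subseteq> S \<Longrightarrow> C1_on f T"
  unfolding C1_on_def by (auto intro: continuous_on_subset)

lemma C2_on_subset: "C2_on f S \<Longrightarrow> T \<subseteq> S \<Longrightarrow> C2_on f T"
  unfolding C2_on_def by (auto intro: C1_on_subset)

lemma C1_on_cong:
  fixes f g :: "'a::euclidean_space \<Rightarrow> real"
  assumes f: "C1_on f S" and S: "open S" and eq: "\<And>x. x \<in> S \<Longrightarrow> f x = g x"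
  shows "C1_on g S" "\<And>b x. x \<in> S \<Longrightarrow> partial_deriv b f x = partial_deriv b g x"
proof -
  have d: "(g has_derivative frechet_derivative f (at x)) (at x)" if "x \<in> S" for x
    by (rule has_derivative_transform_within_open[OF C1_on_has_derivative[OF f that] S that eq])
  show pd: "partial_deriv b f x = partial_deriv b g x" if "x \<in> S" for b x
    using partial_deriv_eqI[OF d[OF that], of b] by (simp add: partial_deriv_def)
  have "continuous_on S (partial_deriv b g)" if "b \<in> Basis" for b
    using f that pd continuous_on_cong[of S S "partial_deriv b f" "partial_deriv b g"] by (simp add: C1_on_def)
  then show "C1_on g S"
    using d unfolding C1_on_def differentiable_def by blast
qed

lemma C2_on_cong:
  fixes f g :: "'a::euclidean_space \<Rightarrow> real"
  assumes f: "C2_on f S" and S: "open S" and eq: "\<And>x. x \<in> S \<Longrightarrow> f x = g x"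
  shows "C2_on g S"
  using f C1_on_cong[of f S g] C1_on_cong(1)[of "partial_deriv _ f" S "partial_deriv _ g"] S eq
  unfolding C2_on_def by metis

lemma C1_on_cmult:
  fixes f :: "'a::euclidean_space \<Rightarrow> real"
  assumes f: "C1_on f S"
  shows "C1_on (\<lambda>x. c * f x) S"
proof -
  have "continuous_on S (partial_deriv b (\<lambda>x. c * f x))" if "b \<in> Basis" for b
  proof (rule continuous_on_eq)
    show "continuous_on S (\<lambda>x. c * partial_deriv b f x)"
      using f that by (auto simp: C1_on_def intro!: continuous_intros)
    show "c * partial_deriv b f x = partial_deriv b (\<lambda>x. c * f x) x" if "x \<in> S" for x
      using f that by (subst partial_deriv_cmult) (auto simp: C1_on_def)
  qed
  then show ?thesis
    using f unfolding C1_on_def by (auto intro!: derivative_intros)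
qed

lemma C2_on_cmult:
  fixes f :: "'a::euclidean_space \<Rightarrow> real"
  assumes f: "C2_on f S" and S: "open S"
  shows "C2_on (\<lambda>x. c * f x) S"
  unfolding C2_on_def
proof (intro conjI ballI)
  have f1: "C1_on f S" and f2: "\<And>b. b \<in> Basis \<Longrightarrow> C1_on (partial_deriv b f) S"
    using f by (auto simp: C2_on_def)
  show "C1_on (\<lambda>x. c * f x) S" by (rule C1_on_cmult[OF f1])
  fix b :: 'a assume b: "b \<in> Basis"
  show "C1_on (partial_deriv b (\<lambda>x. c * f x)) S"
  proof (rule C1_on_cong(1)[OF C1_on_cmult[OF f2[OF b], of c] S])
    show "c * partial_deriv b f x = partial_deriv b (\<lambda>x. c * f x) x" if "x \<in> S" for x
      using f1 that by (subst partial_deriv_cmult) (auto simp: C1_on_def)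
  qed
qed

lemma C1_on_local:
  assumes "\<And>x. x \<in> S \<Longrightarrow> \<exists>r>0. C1_on f (ball x r)"
  shows "C1_on f S"
  unfolding C1_on_def
proof (intro conjI ballI)
  fix x assume "x \<in> S"
  then obtain r where "r > 0" "C1_on f (ball x r)" using assms by blast
  then show "f differentiable (at x)" by (simp add: C1_on_def)
next
  fix b :: 'a assume b: "b \<in> Basis"
  show "continuous_on S (partial_deriv b f)"
  proof (rule continuous_at_imp_continuous_on, rule ballI)
    fix x assume "x \<in> S"
    then obtain r where "r > 0" "C1_on f (ball x r)" using assms by blast
    then have "continuous_on (ball x r) (partial_deriv b f)" "x \<in> ball x r" using b by (auto simp: C1_on_def)
    then show "isCont (partial_deriv b f) x"
      using continuous_on_eq_continuous_at[OF open_ball] by blast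
  qed
qed

lemma C2_on_local:
  assumes "\<And>x. x \<in> S \<Longrightarrow> \<exists>r>0. C2_on f (ball x r)"
  shows "C2_on f S"
  using assms C1_on_local[of S] unfolding C2_on_def by meson

text \<open>If \<open>u\<close> is nonzero at some point near \<open>x0\<close>, proportionality
  writes \<open>u x\<close> as the spherical mean at \<open>x\<close> times a factor fixed by that
  point and free of \<open>x\<close>. Otherwise \<open>u\<close> vanishes near \<open>x0\<close> and
  the factor \<open>0\<close> serves. The radius is kept below \<open>r0\<close>, the range in which
  the spherical mean will be known to be \<open>C2\<close>.\<close>

lemma locally_scaled_sphere_mean:
  fixes u :: "'a::euclidean_space \<Rightarrow> real"
  assumes D: "open D" and lam: "lam > 0" and u: "C1_on u D"
    and rad: "\<And>x. x \<in> D \<Longrightarrow> rad x > 0 \<and> cball x (rad x) \<subseteq> D"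
    and flux: "\<And>x r. x \<in> D \<Longrightarrow> 0 < r \<Longrightarrow> r \<le> rad x \<Longrightarrow>
           real DIM('a) * mean_flux u x r = - (lam\<^sup>2) * r * ball_mean u x r"
    and x0: "x0 \<in> D" and r0: "r0 > 0"
  shows "\<exists>\<rho> r c. \<rho> > 0 \<and> 0 < r \<and> r < r0 \<and> 
    (\<forall>x\<in>ball x0 \<rho>. cball x r \<subseteq> D \<and> x \<in> D \<and> u x = c * sphere_mean u x r)"
proof -
  let ?V = "uvol TYPE('a)"
  obtain R1 where R1: "R1 > 0" "cball x0 R1 \<subseteq> D"
    using D x0 open_contains_cball by blast
  \<comment> \<open>\<open>R \<le> 1 / (2 lam)\<close> gives \<open>lam^2 R^2 \<le> 1 / 4\<close>,
    within the bound \<open>1 / 2\<close> of the contraction.\<close>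
  define R where "R = min R1 (1 / (2 * lam))"
  have R: "R > 0" "cball x0 R \<subseteq> D" using R1 lam by (auto simp: R_def)
  have small: "lam\<^sup>2 * R\<^sup>2 \<le> 1 / 2"
  proof -
    have "lam * R \<le> lam * (1 / (2 * lam))" using lam by (intro mult_left_mono) (auto simp: R_def)
    also have "\<dots> = 1 / 2" using lam by simp
    finally have "(lam * R)\<^sup>2 \<le> (1 / 2)\<^sup>2" using lam R by (intro power_mono) auto
    also have "(1 / 2)\<^sup>2 \<le> (1 / 2 :: real)" by (simp add: power2_eq_square)
    finally show ?thesis by (simp only: power_mult_distrib)
  qed
  obtain g where g: "continuous_on UNIV g" "\<And>z. norm z \<le> R \<Longrightarrow> g z = u (x0 + z)"
    using continuous_on_cball_extend[OF continuous_on_subset[OF C1_on_continuous_on[OF u] R(2)] R(1)] by metis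
  have lim: "(mean_defect g x \<longlongrightarrow> mean_const TYPE('a) * (- (lam\<^sup>2) * g x)) (at_right 0)" if x: "x \<in> ball 0 R" for x
  proof -
    have xD: "x0 + x \<in> D" using R(2) x by (auto simp: subset_eq dist_norm)
    \<comment> \<open>The radius \<open>rad (x0 + x)\<close> changes with the point and may have no
      positive lower bound; this is harmless, as only the limit at \<open>r = 0\<close> is
      kept.\<close>
    have "((\<lambda>r. (ball_int u (x0 + x) r - ?V * u (x0 + x)) / r\<^sup>2) \<longlongrightarrow> mean_const TYPE('a) * (- (lam\<^sup>2) * u (x0 + x))) (at_right 0)"
      by (rule tendsto_ball_int_of_flux[OF u, of "rad (x0 + x)"]) (use rad[OF xD] flux[OF xD] in auto)
    moreover have ux: "u (x0 + x) = g x" using x g(2)[of x] by simp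
    moreover have "eventually (\<lambda>r. r \<in> {0<..<R - norm x}) (at_right 0)"
      using x by (intro eventually_at_right_real) auto
    then have "eventually (\<lambda>r. (ball_int u (x0 + x) r - ?V * u (x0 + x)) / r\<^sup>2 = mean_defect g x r) (at_right 0)"
    proof eventually_elim
      fix r assume r: "r \<in> {0<..<R - norm x}"
      have "ball_int u (x0 + x) r = ball_int g x r"
        unfolding ball_int_def
      proof (rule Bochner_Integration.integral_cong)
        fix z :: 'a assume "z \<in> space uball"
        then have "norm (r *\<^sub>R z) \<le> r" using r by (auto intro: mult_left_le)
        then have "norm (x + r *\<^sub>R z) \<le> R"
          using norm_triangle_ineq[of x "r *\<^sub>R z"] r unfolding greaterThanLessThan_iff by linarith
        then show "u (x0 + x + r *\<^sub>R z) = g (x + r *\<^sub>R z)" by (simp add: g(2) add.assoc)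
      qed simp
      then show "(ball_int u (x0 + x) r - ?V * u (x0 + x)) / r\<^sup>2 = mean_defect g x r"
        by (simp add: mean_defect_def ux)
    qed
    ultimately show ?thesis by (simp only: ux) (rule Lim_transform_eventually)
  qed
  have sph: "g y * sphere_int g x r = g x * sphere_int g y r"
    if "x \<in> ball 0 (R / 2)" "y \<in> ball 0 (R / 2)" "0 < r" "r < R / 2" for x y r
    using that by (intro sphere_int_proportional[of _ "R / 2"] g ball_int_proportional[OF R(1) g(1) lam lim small]) auto
  have inD: "cball x r \<subseteq> D \<and> x \<in> D" "norm (x - x0) < R / 2" if "x \<in> ball x0 (R / 2)" "0 < r" "r < R / 2" for x r
  proof -
    show "norm (x - x0) < R / 2" using that by (simp add: dist_norm norm_minus_commute)
    have "cball x r \<subseteq> cball x0 R"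
    proof
      fix z assume "z \<in> cball x r"
      then show "z \<in> cball x0 R" using dist_triangle[of x0 z x] that by auto
    qed
    moreover have "x \<in> cball x r" using that by simp
    ultimately show "cball x r \<subseteq> D \<and> x \<in> D" using R(2) by blast
  qed
  have sm: "sphere_mean u x r = sphere_int g (x - x0) r / ?V" if x: "x \<in> ball x0 (R / 2)" and r: "0 < r" "r < R / 2" for x r
  proof -
    have "continuous_on (sphere x r) u"
      using C1_on_continuous_on[OF u] inD(1)[OF x r] sphere_cball[of x r] by (blast intro: continuous_on_subset)
    then have "sphere_mean u x r = sphere_int u x r / ?V" by (rule sphere_mean_eq[OF r(1)])
    also have "sphere_int u x r = sphere_int g (x - x0) r"
      unfolding sphere_int_def
    proof (rule Bochner_Integration.integral_cong)
      fix z :: 'a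
      have "norm (r *\<^sub>R sgn z) \<le> r" using r norm_sgn_le[of z] by (simp add: mult_left_le)
      then have "norm (x - x0 + r *\<^sub>R sgn z) \<le> R"
        using norm_triangle_ineq[of "x - x0" "r *\<^sub>R sgn z"] inD(2)[OF x r] r by linarith
      then show "u (x + r *\<^sub>R sgn z) = g (x - x0 + r *\<^sub>R sgn z)" by (simp add: g(2))
    qed simp
    finally show ?thesis .
  qed
  have ug: "u x = g (x - x0)" if "x \<in> ball x0 (R / 2)" for x
    using g(2)[of "x - x0"] that R(1) by (simp add: dist_norm norm_minus_commute)
  have inball: "x - x0 \<in> ball 0 (R / 2)" if "x \<in> ball x0 (R / 2)" for x
    using that by (simp add: dist_norm norm_minus_commute)
  show ?thesis
  proof (cases "\<exists>y\<in>ball 0 (R / 2). g y \<noteq> 0")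
    case True
    then obtain y where y: "y \<in> ball 0 (R / 2)" "g y \<noteq> 0" by blast
    \<comment> \<open>A spherical mean may vanish at particular radii. For small ones it is close to
      its nonzero central value, so division by it is possible there.\<close>
    have "(sphere_int g y \<longlongrightarrow> ?V * g y) (at_right 0)"
      by (rule tendsto_sphere_int[of 1]) (auto intro: continuous_on_subset[OF g(1)])
    then have "eventually (\<lambda>r. sphere_int g y r \<noteq> 0) (at_right 0)"
      by (rule tendsto_imp_eventually_ne) (use y in simp)
    moreover have "eventually (\<lambda>r. r \<in> {0<..<min r0 (R / 2)}) (at_right 0)"
      using R(1) r0 by (intro eventually_at_right_real) auto
    ultimately have "eventually (\<lambda>r. sphere_int g y r \<noteq> 0 \<and> r \<in> {0<..<min r0 (R / 2)}) (at_right 0)"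
      by (rule eventually_conj)
    then obtain r where r: "sphere_int g y r \<noteq> 0" "0 < r" "r < r0" "r < R / 2"
      using eventually_happens[of _ "at_right (0::real)"] by auto
    show ?thesis
    proof (rule exI[of _ "R / 2"], rule exI[of _ r], rule exI[of _ "?V * g y / sphere_int g y r"], intro conjI ballI)
      fix x assume x: "x \<in> ball x0 (R / 2)"
      show "cball x r \<subseteq> D" "x \<in> D" using inD(1)[OF x r(2,4)] by auto
      show "u x = ?V * g y / sphere_int g y r * sphere_mean u x r"
        using sph[OF inball[OF x] y(1) r(2,4)] r(1)
        by (simp add: sm[OF x r(2,4)] ug[OF x] field_simps)
    qed (use R(1) r in auto)
  next
    case False
    define r where "r = min r0 (R / 2) / 2"
    have r: "0 < r" "r < r0" "r < R / 2" using R(1) r0 by (auto simp: r_def)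
    show ?thesis
    proof (rule exI[of _ "R / 2"], rule exI[of _ r], rule exI[of _ 0], intro conjI ballI)
      fix x assume x: "x \<in> ball x0 (R / 2)"
      show "cball x r \<subseteq> D" "x \<in> D" using inD(1)[OF x r(1,3)] by auto
      show "u x = 0 * sphere_mean u x r" using False inball[OF x] ug[OF x] by auto
    qed (use R(1) r in auto)
  qed
qed

theorem theorem6:
  fixes D :: "'a::euclidean_space set"
    and u :: "'a \<Rightarrow> real"
    and lam :: real
    and rad :: "'a \<Rightarrow> real"
  assumes dim: "DIM('a) \<ge> 2"
    and domain: "open D" "connected D" "bounded D"
    and lam: "lam > 0"
    and u_C1: "C1_on u D"
    and u_C0: "continuous_on (closure D) u"
    and means_C2: "\<exists>r0>0. \<forall>r. 0 < r \<and> r < r0 \<longrightarrow>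
           C2_on (\<lambda>x. mean_flux u x r) {x \<in> D. cball x r \<subseteq> D} \<and>
           C2_on (\<lambda>x. sphere_mean u x r) {x \<in> D. cball x r \<subseteq> D}"
    and rad: "\<forall>x\<in>D. rad x > 0 \<and> cball x (rad x) \<subseteq> D"
    and equality: "\<forall>x\<in>D. \<forall>r\<in>{0<..rad x}.
           real DIM('a) * mean_flux u x r = - (lam\<^sup>2) * r * ball_mean u x r"
  shows "metaharmonic_on lam u D"
proof -
  obtain r0 where r0: "r0 > 0" "\<And>r. 0 < r \<Longrightarrow> r < r0 \<Longrightarrow> C2_on (\<lambda>x. sphere_mean u x r) {x \<in> D. cball x r \<subseteq> D}"
    using means_C2 by blast
  have C2: "C2_on u D"
  proof (rule C2_on_local)
    fix x0 assume x0: "x0 \<in> D"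
    obtain \<rho> r c where \<rho>: "\<rho> > 0" "0 < r" "r < r0"
      "\<And>x. x \<in> ball x0 \<rho> \<Longrightarrow> cball x r \<subseteq> D \<and> x \<in> D \<and> u x = c * sphere_mean u x r"
      using locally_scaled_sphere_mean[OF domain(1) lam u_C1, of rad x0 r0] rad equality x0 r0(1)
      by (auto simp: Ball_def)
    have "C2_on (\<lambda>x. sphere_mean u x r) (ball x0 \<rho>)"
      by (rule C2_on_subset[OF r0(2)[OF \<rho>(2,3)]]) (use \<rho>(4) in blast)
    \<comment> \<open>Neither \<open>c\<close> nor \<open>r\<close> depends on \<open>x\<close>, so
      regularity of the mean at one fixed radius passes to \<open>u\<close>.\<close>
    then have "C2_on (\<lambda>x. c * sphere_mean u x r) (ball x0 \<rho>)"
      by (rule C2_on_cmult) simp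
    then have "C2_on u (ball x0 \<rho>)"
      by (rule C2_on_cong) (use \<rho>(4) in auto)
    with \<rho>(1) show "\<exists>r>0. C2_on u (ball x0 r)" by blast
  qed
  have "laplacian u x + lam\<^sup>2 * u x = 0" if x: "x \<in> D" for x
  proof -
    have "mean_const TYPE('a) * laplacian u x = mean_const TYPE('a) * (- (lam\<^sup>2) * u x)"
    proof (rule tendsto_unique[OF trivial_limit_at_right_real])
      show "((\<lambda>r. (ball_int u x r - uvol TYPE('a) * u x) / r\<^sup>2) \<longlongrightarrow> mean_const TYPE('a) * laplacian u x) (at_right 0)"
        by (rule tendsto_ball_int_laplacian[OF C2 domain(1) x])
      show "((\<lambda>r. (ball_int u x r - uvol TYPE('a) * u x) / r\<^sup>2) \<longlongrightarrow> mean_const TYPE('a) * (- (lam\<^sup>2) * u x)) (at_right 0)"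
        by (rule tendsto_ball_int_of_flux[OF u_C1, of "rad x"]) (use rad equality x in auto)
    qed
    then show ?thesis
      using mean_const_pos[where 'a='a] unfolding mult_cancel_left by auto
  qed
  with C2 show ?thesis by (simp add: metaharmonic_on_def)
qed

end
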